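(* Suppose that $M$ is RCDDZ, its nonzero entries have absolute values $\Omega(1)$, $b,t\ge0$ entrywise, we can sample from $t/\|t\|_1$ in $O(1)$ time, $\|t\|_1$ and $f_{\mathrm{row}}(M)$ are known, we can scan the nonzero entries of $b$ in $O(\|b\|_0)$ time, and $t^{\top}x^{\ast}\ge\eta$ for a given $\eta>0$. Then there exists a randomized algorithm that computes $\hat x$ with $\Pr\{|\hat x-t^{\top}x^{\ast}|\le\varepsilon\,t^{\top}x^{\ast}\}\ge\frac34$ in time $O(\|b\|_0)$ plus $$O\big(f_{\mathrm{row}}(M)^{1/2}\|t\|_1^{1/2}\|b\|_1^{1/2}L^2\varepsilon^{-1}\eta^{-1/2}\big).$$
   Context: Setting: $M\in\mathbb{R}^{n\times n}$, $b\in\operatorname{range}(M)$, $t\in\mathbb{R}^n$, $b,t\ne0$, nonzero entries of absolute value in $[1/\mathrm{poly}(n),\mathrm{poly}(n)]$. RCDDZ: $M$ and $M^{\top}$ are both RDD (positive diagonal, $M(j,j)\ge\sum_{k\ne j}|M(j,k)|$) and all off-diagonal entries are nonpositive. Write $M=D_M-A_M^{\top}$ ($D_M$ diagonal part, $A_M^{\top}$ zero diagonal); $x^{\ast}:=\frac12\sum_{\ell\ge0}(\frac12(I+D_M^{-1}A_M^{\top}))^{\ell}D_M^{-1}b$. Access: diagonal of $M$ in $O(1)$; nonzero entries of rows/columns of $M$ in time linear in their number; entries of $b,t$ in $O(1)$. The algorithm is given $\varepsilon>0$ and $0<\gamma\le\gamma_{\max}(M)$ with $\gamma_{\max}(M)=\max_{p\in[1,\infty]}\big(1-\|\frac12(I+D_M^{-1/q}A_M^{\top}D_M^{-1/p})|_{\operatorname{range}(I-D_M^{-1/q}A_M^{\top}D_M^{-1/p})}\|_p\big)$,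 $q$ conjugate to $p$; $L=\Theta\big(\frac1\gamma\log(\frac{1}{\gamma E}d_{\max}(M)\|t\|_0\|D_M^{-1}t\|_\infty\|b\|_0\|D_M^{-1}b\|_\infty)\big)$, $E$ the target accuracy, with suitable bounds on quantities in the log known. $f_{\mathrm{row}}(M)$: maximum time to simulate one step of the (possibly terminating) random walk with transition matrix $\frac12(I+D_M^{-1}|A_M^{\top}|)$. *)

theory Defs
  imports "HOL-Probability.Probability" "HOL-Computational_Algebra.Polynomial"
    "Jordan_Normal_Form.Matrix"
begin

unbundle no vec_syntax

section \<open>Matrices and vectors\<close>

definition RDD :: "real mat \<Rightarrow> bool" where
  "RDD M \<longleftrightarrow> square_mat M \<and>
     (\<forall>j<dim_row M. 0 < M $$ (j,j) \<and> (\<Sum>k\<in>{..<dim_row M} - {j}. \<bar>M $$ (j,k)\<bar>) \<le> M $$ (j,j))"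

definition RCDDZ :: "real mat \<Rightarrow> bool" where
  "RCDDZ M \<longleftrightarrow> RDD M \<and> RDD (transpose_mat M) \<and>
     (\<forall>j<dim_row M. \<forall>k<dim_row M. j \<noteq> k \<longrightarrow> M $$ (j,k) \<le> 0)"

text \<open>\<open>diag_powr M a\<close> is the power \<open>D\<^sub>M\<^sup>a\<close> of the diagonal part, for positive diagonals;
  \<open>A_tr M\<close> is the matrix \<open>A\<^sub>M\<^sup>T\<close> of the splitting \<open>M = D\<^sub>M - A\<^sub>M\<^sup>T\<close>.\<close>

definition diag_powr :: "real mat \<Rightarrow> real \<Rightarrow> real mat" where
  "diag_powr M a = mat_diag (dim_row M) (\<lambda>i. M $$ (i,i) powr a)"

definition A_tr :: "real mat \<Rightarrow> real mat" where
  "A_tr M = mat_diag (dim_row M) (\<lambda>i. M $$ (i,i)) - M"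

definition d_max :: "real mat \<Rightarrow> real" where
  "d_max M = Max ((\<lambda>i. M $$ (i,i)) ` {..<dim_row M})"

definition mat_range :: "real mat \<Rightarrow> real Matrix.vec set" where
  "mat_range M = (\<lambda>x. M *\<^sub>v x) ` carrier_vec (dim_col M)"

definition x_star :: "real mat \<Rightarrow> real Matrix.vec \<Rightarrow> real Matrix.vec" where
  "x_star M b =
     (let n = dim_row M; W = (1/2) \<cdot>\<^sub>m (1\<^sub>m n + diag_powr M (-1) * A_tr M)
      in Matrix.vec n (\<lambda>i. 1/2 * (\<Sum>l. ((W ^\<^sub>m l) *\<^sub>v (diag_powr M (-1) *\<^sub>v b)) $ i)))"

definition norm0 :: "real Matrix.vec \<Rightarrow> nat" where
  "norm0 x = card {i. i < dim_vec x \<and> x $ i \<noteq> 0}"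

definition lp_norm :: "ereal \<Rightarrow> real Matrix.vec \<Rightarrow> real" where
  "lp_norm p x =
     (if p = \<infinity> then Max ((\<lambda>i. \<bar>x $ i\<bar>) ` {..<dim_vec x})
      else (\<Sum>i<dim_vec x. \<bar>x $ i\<bar> powr real_of_ereal p) powr (1 / real_of_ereal p))"

text \<open>The operator norm of the restriction of \<open>T\<close> to a subspace \<open>V\<close>, induced by the \<open>p\<close>-norm.\<close>

definition restricted_norm :: "ereal \<Rightarrow> real mat \<Rightarrow> real Matrix.vec set \<Rightarrow> real" where
  "restricted_norm p T V =
     (SUP x\<in>V - {0\<^sub>v (dim_col T)}. lp_norm p (T *\<^sub>v x) / lp_norm p x)"

text \<open>In \<open>gamma_max\<close>, \<open>1 / \<infinity> = 0\<close> holds in \<^typ>\<open>ereal\<close>, so the endpoints \<open>p = 1\<close> and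
  \<open>p = \<infinity>\<close> are included. The quantity depends continuously on \<open>1/p \<in> [0,1]\<close>, so the supremum
  is a maximum.\<close>

definition scaled_A :: "real mat \<Rightarrow> ereal \<Rightarrow> ereal \<Rightarrow> real mat" where
  "scaled_A M p q =
     diag_powr M (- real_of_ereal (1/q)) * A_tr M * diag_powr M (- real_of_ereal (1/p))"

definition gamma_max :: "real mat \<Rightarrow> real" where
  "gamma_max M = Sup {1 - restricted_norm p ((1/2) \<cdot>\<^sub>m (1\<^sub>m (dim_row M) + scaled_A M p q))
                            (mat_range (1\<^sub>m (dim_row M) - scaled_A M p q)) |
                      p q. 1 \<le> p \<and> 1 \<le> q \<and> 1/p + 1/q = 1}"

text \<open>The argument of the logarithm in
  \<open>L = \<Theta>((1/\<gamma>) log((1/(\<gamma> E)) d_max(M) \<parallel>t\<parallel>\<^sub>0 \<parallel>D\<^sub>M\<^sup>-\<^sup>1 t\<parallel>\<^sub>\<infinity> \<parallel>b\<parallel>\<^sub>0 \<parallel>D\<^sub>M\<^sup>-\<^sup>1 b\<parallel>\<^sub>\<infinity>))\<close>, as a function of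
  the quantities that occur in it.\<close>

definition log_arg :: "real \<Rightarrow> real \<Rightarrow> real \<Rightarrow> real \<Rightarrow> real \<Rightarrow> real \<Rightarrow> real \<Rightarrow> real" where
  "log_arg \<gamma> E d t0 ti b0 bi = 1 / (\<gamma> * E) * d * t0 * ti * b0 * bi"

definition log_arg_of ::
  "real \<Rightarrow> real \<Rightarrow> real mat \<Rightarrow> real Matrix.vec \<Rightarrow> real Matrix.vec \<Rightarrow> real" where
  "log_arg_of \<gamma> E M b t =
     log_arg \<gamma> E (d_max M) (real (norm0 t)) (lp_norm \<infinity> (diag_powr M (-1) *\<^sub>v t))
       (real (norm0 b)) (lp_norm \<infinity> (diag_powr M (-1) *\<^sub>v b))"

section \<open>Problem instances and access to them\<close>

text \<open>Besides \<open>M\<close>, \<open>b\<close>, \<open>t\<close>, an instance contains the (arbitrary) orders in which nonzero entries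
  are listed, and the time needed to simulate one step of the random walk from each vertex.\<close>

record problem =
  sysM :: "real mat"
  sysb :: "real Matrix.vec"
  syst :: "real Matrix.vec"
  row_nz :: "nat \<Rightarrow> nat list"
  col_nz :: "nat \<Rightarrow> nat list"
  b_nz :: "nat list"
  step_time :: "nat \<Rightarrow> nat"

definition well_formed :: "nat \<Rightarrow> problem \<Rightarrow> bool" where
  "well_formed n I \<longleftrightarrow>
     sysM I \<in> carrier_mat n n \<and> sysb I \<in> carrier_vec n \<and> syst I \<in> carrier_vec n \<and>
     (\<forall>i<n. distinct (row_nz I i) \<and> set (row_nz I i) = {j. j < n \<and> sysM I $$ (i,j) \<noteq> 0}) \<and>
     (\<forall>j<n. distinct (col_nz I j) \<and> set (col_nz I j) = {i. i < n \<and> sysM I $$ (i,j) \<noteq> 0}) \<and>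
     distinct (b_nz I) \<and> set (b_nz I) = {i. i < n \<and> sysb I $ i \<noteq> 0} \<and>
     (\<forall>v<n. 1 \<le> step_time I v)"

definition f_row :: "problem \<Rightarrow> nat" where
  "f_row I = Max (step_time I ` {..<dim_row (sysM I)})"

text \<open>One step of the walk with substochastic transition matrix \<open>(I + D\<^sub>M\<^sup>-\<^sup>1 |A\<^sub>M\<^sup>T|) / 2\<close>; the
  missing mass, on \<^const>\<open>None\<close>, is the probability of termination.\<close>

definition walk_step :: "real mat \<Rightarrow> nat \<Rightarrow> nat option pmf" where
  "walk_step M v = embed_spmf (\<lambda>u. if u < dim_row M
     then ((1/2) \<cdot>\<^sub>m (1\<^sub>m (dim_row M) + diag_powr M (-1) * map_mat abs (A_tr M))) $$ (v,u) else 0)"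

definition sample_t :: "real Matrix.vec \<Rightarrow> nat pmf" where
  "sample_t t = embed_pmf (\<lambda>v. if v < dim_vec t then t $ v / lp_norm 1 t else 0)"

section \<open>Randomized algorithms\<close>

text \<open>Algorithms are programs of a unit-cost random access machine over natural numbers (for
  indices, counters and addresses) and real numbers. The memory consists of arrays of either kind,
  each named by a natural number, with unbounded index range; a scalar variable is cell \<open>0\<close> of an
  array. Every operation and every memory access takes one time unit. The instance can be inspected
  only through the query commands.\<close>

datatype nexp = NConst nat | NGet nat nexp | NAdd nexp nexp | NSub nexp nexp | NMul nexp nexp

datatype rexp = RNat nexp | RGet nat nexp | RAdd rexp rexp | RSub rexp rexp | RMul rexp rexp
  | RDiv rexp rexp | RSqrt rexp | RLn rexp

datatype bexp = NLess nexp nexp | RLess rexp rexp | BNot bexp | BAnd bexp bexp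

text \<open>In the commands below, the leading \<^typ>\<open>nat\<close> and \<^typ>\<open>nexp\<close> designate the memory cell
  receiving the result; \<open>ReadRow\<close>, \<open>ReadCol\<close>, \<open>ScanB\<close> write to a whole pair of arrays.\<close>

datatype com =
    SetN nat nexp nexp
  | SetR nat nexp rexp
  | Seq com com
  | Cond bexp com com
  | While bexp com
  | Uniform nat nexp nexp
  | GetDiag nat nexp nexp
  | GetB nat nexp nexp
  | GetT nat nexp nexp
  | ReadRow nat nexp
  | ReadCol nat nexp
  | ScanB nat
  | SampleT nat nexp
  | WalkStep nat nexp nexp

record state =
  nmem :: "nat \<Rightarrow> nat \<Rightarrow> nat"
  rmem :: "nat \<Rightarrow> nat \<Rightarrow> real"
  clock :: nat

primrec nval :: "state \<Rightarrow> nexp \<Rightarrow> nat" where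
  "nval s (NConst k) = k"
| "nval s (NGet a e) = nmem s a (nval s e)"
| "nval s (NAdd e f) = nval s e + nval s f"
| "nval s (NSub e f) = nval s e - nval s f"
| "nval s (NMul e f) = nval s e * nval s f"

primrec rval :: "state \<Rightarrow> rexp \<Rightarrow> real" where
  "rval s (RNat e) = real (nval s e)"
| "rval s (RGet a e) = rmem s a (nval s e)"
| "rval s (RAdd e f) = rval s e + rval s f"
| "rval s (RSub e f) = rval s e - rval s f"
| "rval s (RMul e f) = rval s e * rval s f"
| "rval s (RDiv e f) = rval s e / rval s f"
| "rval s (RSqrt e) = sqrt (rval s e)"
| "rval s (RLn e) = ln (rval s e)"

primrec bval :: "state \<Rightarrow> bexp \<Rightarrow> bool" where
  "bval s (NLess e f) \<longleftrightarrow> nval s e < nval s f"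
| "bval s (RLess e f) \<longleftrightarrow> rval s e < rval s f"
| "bval s (BNot b) \<longleftrightarrow> \<not> bval s b"
| "bval s (BAnd b c) \<longleftrightarrow> bval s b \<and> bval s c"

primrec ncost :: "nexp \<Rightarrow> nat" where
  "ncost (NConst k) = 1"
| "ncost (NGet a e) = 1 + ncost e"
| "ncost (NAdd e f) = 1 + ncost e + ncost f"
| "ncost (NSub e f) = 1 + ncost e + ncost f"
| "ncost (NMul e f) = 1 + ncost e + ncost f"

primrec rcost :: "rexp \<Rightarrow> nat" where
  "rcost (RNat e) = 1 + ncost e"
| "rcost (RGet a e) = 1 + ncost e"
| "rcost (RAdd e f) = 1 + rcost e + rcost f"
| "rcost (RSub e f) = 1 + rcost e + rcost f"
| "rcost (RMul e f) = 1 + rcost e + rcost f"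
| "rcost (RDiv e f) = 1 + rcost e + rcost f"
| "rcost (RSqrt e) = 1 + rcost e"
| "rcost (RLn e) = 1 + rcost e"

primrec bcost :: "bexp \<Rightarrow> nat" where
  "bcost (NLess e f) = 1 + ncost e + ncost f"
| "bcost (RLess e f) = 1 + rcost e + rcost f"
| "bcost (BNot b) = 1 + bcost b"
| "bcost (BAnd b c) = 1 + bcost b + bcost c"

definition tick :: "nat \<Rightarrow> state \<Rightarrow> state" where
  "tick k s = s\<lparr>clock := clock s + k\<rparr>"

definition put_n :: "nat \<Rightarrow> nat \<Rightarrow> nat \<Rightarrow> state \<Rightarrow> state" where
  "put_n a i x s = s\<lparr>nmem := (nmem s)(a := (nmem s a)(i := x))\<rparr>"

definition put_r :: "nat \<Rightarrow> nat \<Rightarrow> real \<Rightarrow> state \<Rightarrow> state" where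
  "put_r a i x s = s\<lparr>rmem := (rmem s)(a := (rmem s a)(i := x))\<rparr>"

text \<open>A list of index-value pairs is delivered as its length, in cell \<open>0\<close> of natural array \<open>a\<close>, and
  the indices and values, in cells \<open>1, 2, \<dots>\<close> of the natural and the real array \<open>a\<close>.\<close>

definition put_list :: "nat \<Rightarrow> (nat \<times> real) list \<Rightarrow> state \<Rightarrow> state" where
  "put_list a xs s = s\<lparr>
     nmem := (nmem s)(a := (\<lambda>k. if k = 0 then length xs
                                else if k \<le> length xs then fst (xs ! (k - 1)) else nmem s a k)),
     rmem := (rmem s)(a := (\<lambda>k. if 1 \<le> k \<and> k \<le> length xs then snd (xs ! (k - 1)) else rmem s a k))\<rparr>"

definition row_list :: "problem \<Rightarrow> nat \<Rightarrow> (nat \<times> real) list" where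
  "row_list I i = (if i < dim_row (sysM I) then map (\<lambda>j. (j, sysM I $$ (i,j))) (row_nz I i) else [])"

definition col_list :: "problem \<Rightarrow> nat \<Rightarrow> (nat \<times> real) list" where
  "col_list I j = (if j < dim_col (sysM I) then map (\<lambda>i. (i, sysM I $$ (i,j))) (col_nz I j) else [])"

definition b_list :: "problem \<Rightarrow> (nat \<times> real) list" where
  "b_list I = map (\<lambda>i. (i, sysb I $ i)) (b_nz I)"

text \<open>A configuration is a stack of commands still to be executed together with a state; \<open>[]\<close> means
  that the program has halted. Queries with an index out of range return \<open>0\<close> or the empty list.
  \<open>WalkStep\<close> returns \<open>0\<close> if the walk terminates and \<open>u + 1\<close> if it moves to \<open>u\<close>.\<close>

fun step :: "problem \<Rightarrow> com list \<times> state \<Rightarrow> (com list \<times> state) pmf" where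
  "step I ([], s) = return_pmf ([], s)"
| "step I (SetN a i e # K, s) =
     return_pmf (K, tick (1 + ncost i + ncost e) (put_n a (nval s i) (nval s e) s))"
| "step I (SetR a i e # K, s) =
     return_pmf (K, tick (1 + ncost i + rcost e) (put_r a (nval s i) (rval s e) s))"
| "step I (Seq c d # K, s) = return_pmf (c # d # K, s)"
| "step I (Cond b c d # K, s) = return_pmf ((if bval s b then c else d) # K, tick (1 + bcost b) s)"
| "step I (While b c # K, s) =
     return_pmf (if bval s b then c # While b c # K else K, tick (1 + bcost b) s)"
| "step I (Uniform a i e # K, s) =
     map_pmf (\<lambda>x. (K, tick (1 + ncost i + ncost e) (put_n a (nval s i) x s)))
       (pmf_of_set {..nval s e})"
| "step I (GetDiag a i e # K, s) =
     return_pmf (K, tick (1 + ncost i + ncost e) (put_r a (nval s i)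
       (if nval s e < dim_row (sysM I) then sysM I $$ (nval s e, nval s e) else 0) s))"
| "step I (GetB a i e # K, s) =
     return_pmf (K, tick (1 + ncost i + ncost e) (put_r a (nval s i)
       (if nval s e < dim_vec (sysb I) then sysb I $ nval s e else 0) s))"
| "step I (GetT a i e # K, s) =
     return_pmf (K, tick (1 + ncost i + ncost e) (put_r a (nval s i)
       (if nval s e < dim_vec (syst I) then syst I $ nval s e else 0) s))"
| "step I (ReadRow a e # K, s) =
     return_pmf (K, tick (1 + ncost e + length (row_list I (nval s e)))
       (put_list a (row_list I (nval s e)) s))"
| "step I (ReadCol a e # K, s) =
     return_pmf (K, tick (1 + ncost e + length (col_list I (nval s e)))
       (put_list a (col_list I (nval s e)) s))"
| "step I (ScanB a # K, s) =
     return_pmf (K, tick (1 + length (b_list I)) (put_list a (b_list I) s))"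
| "step I (SampleT a i # K, s) =
     map_pmf (\<lambda>v. (K, tick (1 + ncost i) (put_n a (nval s i) v s))) (sample_t (syst I))"
| "step I (WalkStep a i e # K, s) =
     (if nval s e < dim_row (sysM I)
      then map_pmf (\<lambda>r. (K, tick (1 + ncost i + ncost e + step_time I (nval s e))
             (put_n a (nval s i) (case r of None \<Rightarrow> 0 | Some u \<Rightarrow> Suc u) s)))
             (walk_step (sysM I) (nval s e))
      else return_pmf (K, tick (1 + ncost i + ncost e) (put_n a (nval s i) 0 s)))"

primrec run :: "problem \<Rightarrow> nat \<Rightarrow> com list \<times> state \<Rightarrow> (com list \<times> state) pmf" where
  "run I 0 cfg = return_pmf cfg"
| "run I (Suc k) cfg = bind_pmf (step I cfg) (run I k)"

text \<open>The dimension and the known real parameters are in cell \<open>0\<close> of natural array \<open>0\<close> and in real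
  array \<open>0\<close>; all other cells are \<open>0\<close>. The output is expected in cell \<open>0\<close> of real array \<open>1\<close>.\<close>

definition initial_state :: "nat \<Rightarrow> real list \<Rightarrow> state" where
  "initial_state n ps = \<lparr>
     nmem = (\<lambda>a i. if a = 0 \<and> i = 0 then n else 0),
     rmem = (\<lambda>a i. if a = 0 \<and> i < length ps then ps ! i else 0),
     clock = 0\<rparr>"

definition result :: "state \<Rightarrow> real" where
  "result s = rmem s 1 0"

text \<open>On the given instance and parameters, the program always halts, within time \<open>T\<close>, and its
  output satisfies \<open>good\<close> with probability at least \<open>\<pi>\<close>.\<close>

definition computes ::
  "com \<Rightarrow> problem \<Rightarrow> nat \<Rightarrow> real list \<Rightarrow> real \<Rightarrow> real \<Rightarrow> (real \<Rightarrow> bool) \<Rightarrow> bool" where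
  "computes P I n ps T \<pi> good \<longleftrightarrow>
     (\<exists>k. let R = run I k ([P], initial_state n ps) in
        (\<forall>(K, s)\<in>set_pmf R. K = [] \<and> real (clock s) \<le> T) \<and>
        measure_pmf.prob R {(K, s). good (result s)} \<ge> \<pi>)"

end

theory Submission
  imports Defs
begin

text \<open>
  Let \<open>W = I - D\<^sup>-\<^sup>1 M / 2\<close>, so that \<open>t\<^sup>T x\<^sup>* = 1/2 \<Sum>\<^sub>l t\<^sup>T W\<^sup>l D\<^sup>-\<^sup>1 b\<close>. The restricted norm bound gives
  \<open>\<bar>t\<^sup>T W\<^sup>l D\<^sup>-\<^sup>1 b\<bar> \<le> \<beta> (1 - \<gamma>)\<^sup>l\<close>, where \<open>\<beta>\<close> is \<open>\<gamma> E\<close> times the argument of the logarithm, hence it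
  suffices to estimate the first \<open>L\<close> terms. Residues \<open>R\<^sub>l\<close>, initially \<open>R\<^sub>0 = D\<^sup>-\<^sup>1 b\<close> and \<open>R\<^sub>l = 0\<close> for
  \<open>l > 0\<close>, represent the truncated sum as \<open>x\<^sub>0 + 1/2 \<Sum>\<^sub>l \<Sum>\<^sub>j\<^sub><\<^sub>L\<^sub>-\<^sub>l t\<^sup>T W\<^sup>j R\<^sub>l\<close>. Pushing \<open>\<rho> = R\<^sub>l(v)\<close> moves
  \<open>t(v) \<rho> / 2\<close> to \<open>x\<^sub>0\<close> and \<open>\<rho> W(\<cdot>,v)\<close> to \<open>R\<^sub>l\<^sub>+\<^sub>1\<close>. Since the columns of \<open>M\<close> are dominated, the \<open>D\<close>-weighted
  mass \<open>\<parallel>b\<parallel>\<^sub>1\<close> does not grow, and since the entries are \<open>\<Omega>(1)\<close>, column \<open>v\<close> has \<open>O(D(v))\<close> entries; hence pushing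
  all residues above \<open>\<theta>\<close> takes time \<open>O(L \<parallel>b\<parallel>\<^sub>1 / \<theta>)\<close>. What remains is \<open>L \<parallel>t\<parallel>\<^sub>1 / 2\<close> times the expectation of
  \<open>Y = \<Sum>\<^sub>j\<^sub><\<^sub>L\<^sub>-\<^sub>l R\<^sub>l(v\<^sub>j)\<close> for a uniform level \<open>l < L\<close> and the walk \<open>v\<^sub>0, v\<^sub>1, \<dots>\<close> with kernel \<open>W\<close> started from
  \<open>t / \<parallel>t\<parallel>\<^sub>1\<close>. As \<open>0 \<le> Y \<le> L \<theta>\<close>, its second moment is at most \<open>L \<theta>\<close> times its mean, and Chebyshev's inequality
  asks for \<open>O(L\<^sup>2 \<theta> \<parallel>t\<parallel>\<^sub>1 / (\<epsilon>\<^sup>2 \<eta>))\<close> walks. The choice of \<open>\<theta>\<close> balances the two phases. If less than one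
  walk is asked for, the remainder is so small that it can be dropped.
\<close>

section \<open>A program logic with expectations\<close>

text \<open>\<open>computes\<close> bounds the time of every run, so walks are cut off after at most
  L steps and each step is charged with the maximal \<open>f_row\<close>; time sits in
  postconditions, and expectations only measure the error. No path space is built: the moments of a
  walk obey recursions in the number of remaining steps, and the second moment is carried through
  the loops as a potential. Residues carry a level because D-weighted mass need not decay under W;
  what ends the pushing is that mass can be pushed at most L times. The time bound leaves no
  additive room for L or for constants. Constants hide in \<open>norm0 b\<close> \<ge> 1. Rounding L
  up is harmless because the argument of the logarithm is at least 2 when \<epsilon> < 1, and
  \<epsilon> \<ge> 1 is answered by 0. Computing L by counting costs O(L), which is paid for by the
  lower bound \<eta> on the target: it forces the norms of t and b to be large relative to
  \<eta>.\<close>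

definition halts :: "problem \<Rightarrow> com list \<times> state \<Rightarrow> state pmf \<Rightarrow> bool" where
  "halts I cfg D \<longleftrightarrow> (\<exists>k. run I k cfg = map_pmf (Pair []) D)"

text \<open>Quantifying over the continuation \<open>K\<close> makes \<open>yields\<close> compositional: the runs of \<open>c\<close> may have different
  lengths, so no fixed number of steps executes just \<open>c\<close>.\<close>

definition yields :: "problem \<Rightarrow> com \<Rightarrow> state \<Rightarrow> state pmf \<Rightarrow> bool" where
  "yields I c s D \<longleftrightarrow> finite (set_pmf D) \<and>
     (\<forall>K E. (\<forall>s'\<in>set_pmf D. halts I (K, s') (E s')) \<longrightarrow> halts I (c # K, s) (bind_pmf D E))"

text \<open>\<open>F\<close> is a post-expectation and \<open>g\<close> bounds its mean as seen from
  the starting state, while \<open>\<Phi>\<close> must hold on every outcome. Running times go into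
  \<open>\<Phi>\<close>, errors into \<open>F\<close>.\<close>

definition triple ::
  "problem \<Rightarrow> com \<Rightarrow> state \<Rightarrow> (state \<Rightarrow> bool) \<Rightarrow> (state \<Rightarrow> real) \<Rightarrow> real \<Rightarrow> bool" where
  "triple I c s \<Phi> F g \<longleftrightarrow> (\<exists>D. yields I c s D \<and> (\<forall>s'\<in>set_pmf D. \<Phi> s') \<and>
     measure_pmf.expectation D F \<le> g)"

lemma run_halted: "run I k ([], s) = return_pmf ([], s)"
  by (induction k) (simp_all add: bind_return_pmf)

lemma run_add: "run I (k + j) cfg = bind_pmf (run I k cfg) (run I j)"
proof (induction k arbitrary: cfg)
  case (Suc k)
  then have "run I (k + j) = (\<lambda>c. bind_pmf (run I k c) (run I j))" by blast
  then show ?case by (simp add: bind_assoc_pmf)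
qed (simp add: bind_return_pmf)

lemma run_halted_mono:
  assumes "run I k cfg = map_pmf (Pair []) D" "k \<le> j"
  shows "run I j cfg = map_pmf (Pair []) D"
proof -
  obtain i where j: "j = k + i" using assms(2) by (auto simp: le_iff_add)
  show ?thesis
    by (simp add: j run_add assms(1) bind_map_pmf run_halted flip: map_pmf_def)
qed

text \<open>The outcomes of the first step may need different numbers of further steps. As the
  support is finite, the maximum serves all of them, and a halted configuration stays put
  meanwhile.\<close>

lemma halts_step:
  assumes "step I (c # K, s) = map_pmf (Pair K') D" "finite (set_pmf D)"
    "\<And>s'. s' \<in> set_pmf D \<Longrightarrow> halts I (K', s') (E s')"
  shows "halts I (c # K, s) (bind_pmf D E)"
proof -
  have "\<forall>s'\<in>set_pmf D. \<exists>k. run I k (K', s') = map_pmf (Pair []) (E s')"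
    using assms(3) by (auto simp: halts_def)
  then obtain k where k: "\<forall>s'\<in>set_pmf D. run I (k s') (K', s') = map_pmf (Pair []) (E s')"
    by metis
  define m where "m = Max (k ` set_pmf D)"
  have "run I m (K', s') = map_pmf (Pair []) (E s')" if "s' \<in> set_pmf D" for s'
  proof (rule run_halted_mono)
    show "run I (k s') (K', s') = map_pmf (Pair []) (E s')" using k that by blast
    show "k s' \<le> m" using assms(2) that by (simp add: m_def)
  qed
  then have "run I (Suc m) (c # K, s) = bind_pmf D (\<lambda>s'. map_pmf (Pair []) (E s'))"
    unfolding run.simps assms(1) bind_map_pmf by (intro bind_pmf_cong) auto
  then show ?thesis
    unfolding halts_def by (intro exI[of _ "Suc m"]) (simp add: map_bind_pmf)
qed

lemma yields_step:
  assumes "\<And>K. step I (c # K, s) = map_pmf (Pair K) D" "finite (set_pmf D)"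
  shows "yields I c s D"
  unfolding yields_def using halts_step[OF assms(1) assms(2)] assms(2) by blast

text \<open>The hypothesis on \<open>e\<close> covers both \<open>Seq\<close> and an iteration of
  \<open>While\<close>: one step of \<open>e\<close> leaves \<open>c\<close> and \<open>d\<close> on
  top of the stack, possibly in a ticked state.\<close>

lemma yields_bind:
  assumes "yields I c s D" "\<And>s'. s' \<in> set_pmf D \<Longrightarrow> yields I d s' (E s')"
    and "\<And>K. step I (e # K, s0) = return_pmf (c # d # K, s)"
  shows "yields I e s0 (bind_pmf D E)"
  unfolding yields_def
proof (intro conjI allI impI)
  show "finite (set_pmf (bind_pmf D E))"
    using assms(1,2) by (auto simp: yields_def)
  fix K G assume G: "\<forall>s'\<in>set_pmf (bind_pmf D E). halts I (K, s') (G s')"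
  have "halts I (d # K, s') (bind_pmf (E s') G)" if "s' \<in> set_pmf D" for s'
    using assms(2)[OF that] that G by (auto simp: yields_def)
  then have "halts I (c # d # K, s) (bind_pmf D (\<lambda>s'. bind_pmf (E s') G))"
    using assms(1) by (simp add: yields_def)
  then have "halts I (e # K, s0)
      (bind_pmf (return_pmf s) (\<lambda>_. bind_pmf D (\<lambda>s'. bind_pmf (E s') G)))"
    by (intro halts_step) (auto simp: assms(3))
  then show "halts I (e # K, s0) (bind_pmf (bind_pmf D E) G)"
    by (simp add: bind_return_pmf bind_assoc_pmf)
qed

lemma yields_goto:
  assumes "yields I c s D" and "\<And>K. step I (e # K, s0) = return_pmf (c # K, s)"
  shows "yields I e s0 D"
  unfolding yields_def
proof (intro conjI allI impI)
  show "finite (set_pmf D)"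
    using assms(1) by (simp add: yields_def)
  fix K G assume "\<forall>s'\<in>set_pmf D. halts I (K, s') (G s')"
  then have "halts I (c # K, s) (bind_pmf D G)"
    using assms(1) by (simp add: yields_def)
  then have "halts I (e # K, s0) (bind_pmf (return_pmf s) (\<lambda>_. bind_pmf D G))"
    by (intro halts_step) (auto simp: assms(2))
  then show "halts I (e # K, s0) (bind_pmf D G)"
    by (simp add: bind_return_pmf)
qed

lemma expectation_bind_finite:
  fixes F :: "'b \<Rightarrow> real"
  assumes "finite (set_pmf D)" "\<And>x. x \<in> set_pmf D \<Longrightarrow> finite (set_pmf (E x))"
  shows "measure_pmf.expectation (bind_pmf D E) F =
    measure_pmf.expectation D (\<lambda>x. measure_pmf.expectation (E x) F)"
  by (simp add: pmf_expectation_bind[OF assms(1,2)] integral_measure_pmf_real[OF assms(1)]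
      mult.commute)

lemma expectation_mono_finite:
  fixes F G :: "'b \<Rightarrow> real"
  assumes "finite (set_pmf D)" "\<And>x. x \<in> set_pmf D \<Longrightarrow> F x \<le> G x"
  shows "measure_pmf.expectation D F \<le> measure_pmf.expectation D G"
  by (simp add: integral_measure_pmf_real[OF assms(1)] sum_mono mult_right_mono assms(2))

text \<open>Tower property: the bound \<open>G\<close> for \<open>d\<close> at an intermediate state
  is itself the quantity whose mean is bounded for \<open>c\<close>.\<close>

lemma triple_bind:
  assumes "triple I c s \<Phi> G g" "\<And>s'. \<Phi> s' \<Longrightarrow> triple I d s' \<Psi> F (G s')"
    and "\<And>K. step I (e # K, s0) = return_pmf (c # d # K, s)"
  shows "triple I e s0 \<Psi> F g"
proof -
  obtain D where D: "yields I c s D" "\<forall>s'\<in>set_pmf D. \<Phi> s'" "measure_pmf.expectation D G \<le> g"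
    using assms(1) by (auto simp: triple_def)
  have "\<forall>s'\<in>set_pmf D. \<exists>E. yields I d s' E \<and> (\<forall>s''\<in>set_pmf E. \<Psi> s'') \<and>
      measure_pmf.expectation E F \<le> G s'"
    using D(2) assms(2) by (auto simp: triple_def)
  then obtain E where E: "\<forall>s'\<in>set_pmf D. yields I d s' (E s') \<and> (\<forall>s''\<in>set_pmf (E s'). \<Psi> s'') \<and>
      measure_pmf.expectation (E s') F \<le> G s'"
    by metis
  have fin: "finite (set_pmf D)" "\<And>x. x \<in> set_pmf D \<Longrightarrow> finite (set_pmf (E x))"
    using D(1) E by (auto simp: yields_def)
  have "measure_pmf.expectation (bind_pmf D E) F \<le> measure_pmf.expectation D G"
    using E by (subst expectation_bind_finite) (auto intro!: expectation_mono_finite fin)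
  moreover have "yields I e s0 (bind_pmf D E)"
    using yields_bind[OF D(1) _ assms(3)] E by blast
  ultimately show ?thesis
    unfolding triple_def using E D(3) by (intro exI[of _ "bind_pmf D E"]) auto
qed

lemma triple_Seq:
  assumes "triple I c s \<Phi> G g" "\<And>s'. \<Phi> s' \<Longrightarrow> triple I d s' \<Psi> F (G s')"
  shows "triple I (Seq c d) s \<Psi> F g"
  using triple_bind[OF assms] by simp

lemma triple_weaken:
  assumes "triple I c s \<Phi> G g" "\<And>s'. \<Phi> s' \<Longrightarrow> \<Psi> s'" "\<And>s'. \<Phi> s' \<Longrightarrow> F s' \<le> G s'" "g \<le> g'"
  shows "triple I c s \<Psi> F g'"
proof -
  obtain D where D: "yields I c s D" "\<forall>s'\<in>set_pmf D. \<Phi> s'" "measure_pmf.expectation D G \<le> g"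
    using assms(1) by (auto simp: triple_def)
  have "measure_pmf.expectation D F \<le> measure_pmf.expectation D G"
    using D(1,2) assms(3) by (intro expectation_mono_finite) (auto simp: yields_def)
  then show ?thesis
    unfolding triple_def using D assms(2,4) by (intro exI[of _ D]) auto
qed

abbreviation hoare :: "problem \<Rightarrow> com \<Rightarrow> state \<Rightarrow> (state \<Rightarrow> bool) \<Rightarrow> bool" where
  "hoare I c s \<Phi> \<equiv> triple I c s \<Phi> (\<lambda>_. 0) 0"

lemma triple_const:
  assumes "hoare I c s \<Phi>"
  shows "triple I c s \<Phi> (\<lambda>_. g) g"
  using assms by (auto simp: triple_def)

lemma triple_Seq_hoare:
  assumes "hoare I c s \<Phi>" "\<And>s'. \<Phi> s' \<Longrightarrow> triple I d s' \<Psi> F g"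
  shows "triple I (Seq c d) s \<Psi> F g"
  using triple_Seq[OF triple_const[OF assms(1)]] assms(2) by blast

lemma triple_step:
  assumes "\<And>K. step I (c # K, s) = map_pmf (\<lambda>x. (K, f x)) D" "finite (set_pmf D)"
    "\<And>x. x \<in> set_pmf D \<Longrightarrow> \<Phi> (f x)" "measure_pmf.expectation D (\<lambda>x. F (f x)) \<le> g"
  shows "triple I c s \<Phi> F g"
  unfolding triple_def
proof (intro exI conjI)
  show "yields I c s (map_pmf f D)"
    using assms(2) by (intro yields_step) (simp_all add: assms(1) map_pmf_comp)
  show "\<forall>s'\<in>set_pmf (map_pmf f D). \<Phi> s'"
    using assms(3) by auto
  show "measure_pmf.expectation (map_pmf f D) F \<le> g"
    using assms(4) by simp
qed

lemma triple_step_det: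
  assumes "\<And>K. step I (c # K, s) = return_pmf (K, s')" "\<Phi> s'" "F s' \<le> g"
  shows "triple I c s \<Phi> F g"
  by (rule triple_step[where D = "return_pmf ()" and f = "\<lambda>_. s'"]) (simp_all add: assms)

lemma triple_Seq_det:
  assumes "\<And>K. step I (c # K, s) = return_pmf (K, s')" "triple I d s' \<Phi> F g"
  shows "triple I (Seq c d) s \<Phi> F g"
proof (rule triple_Seq_hoare[where \<Phi> = "\<lambda>x. x = s'"])
  show "hoare I c s (\<lambda>x. x = s')"
    by (rule triple_step_det[OF assms(1)]) auto
qed (use assms(2) in auto)

lemma triple_goto:
  assumes "\<And>K. step I (e # K, s0) = return_pmf (c # K, s)" "triple I c s \<Phi> F g"
  shows "triple I e s0 \<Phi> F g"
  using assms(2) yields_goto[OF _ assms(1)] unfolding triple_def by blast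

lemma triple_Cond:
  assumes "bval s b \<Longrightarrow> triple I c (tick (1 + bcost b) s) \<Phi> F g"
    "\<not> bval s b \<Longrightarrow> triple I d (tick (1 + bcost b) s) \<Phi> F g"
  shows "triple I (Cond b c d) s \<Phi> F g"
  by (cases "bval s b")
    (rule triple_goto[OF _ assms(1)] triple_goto[OF _ assms(2)]; simp)+

text \<open>The potential \<open>F\<close> is a supermartingale along the iterations of the loop.\<close>

lemma triple_While:
  fixes V :: "state \<Rightarrow> nat"
  assumes "Inv s"
    and body: "\<And>s. Inv s \<Longrightarrow> bval s b \<Longrightarrow>
      triple I c (tick (1 + bcost b) s) (\<lambda>s'. Inv s' \<and> V s' < V s) F (F s)"
    and exit: "\<And>s. Inv s \<Longrightarrow> \<not> bval s b \<Longrightarrow>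
      \<Phi> (tick (1 + bcost b) s) \<and> G (tick (1 + bcost b) s) \<le> F s"
  shows "triple I (While b c) s \<Phi> G (F s)"
  using assms(1)
proof (induction "V s" arbitrary: s rule: less_induct)
  case less
  show ?case
  proof (cases "bval s b")
    case True
    show ?thesis
    proof (rule triple_bind[OF body[OF less.prems True]])
      fix s' assume "Inv s' \<and> V s' < V s"
      then show "triple I (While b c) s' \<Phi> G (F s')" using less.hyps by blast
    qed (use True in auto)
  next
    case False
    then show ?thesis
      using exit[OF less.prems False] by (intro triple_step_det[where s' = "tick (1 + bcost b) s"]) auto
  qed
qed

lemma hoare_While:
  fixes V :: "state \<Rightarrow> nat"
  assumes "Inv s"
    and "\<And>s. Inv s \<Longrightarrow> bval s b \<Longrightarrow>
      hoare I c (tick (1 + bcost b) s) (\<lambda>s'. Inv s' \<and> V s' < V s)"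
    and "\<And>s. Inv s \<Longrightarrow> \<not> bval s b \<Longrightarrow> \<Phi> (tick (1 + bcost b) s)"
  shows "hoare I (While b c) s \<Phi>"
  using triple_While[of Inv s b I c V "\<lambda>_. 0" \<Phi> "\<lambda>_. 0"] assms by auto

text \<open>With \<open>F\<close> the indicator of a wrong output, its mean is the failure
  probability. The empty continuation turns \<open>yields\<close> into an actual run.\<close>

lemma triple_computes:
  assumes "triple I P (initial_state n ps) (\<lambda>s. real (clock s) \<le> T)
    (\<lambda>s. of_bool (\<not> good (result s))) (1 - \<pi>)"
  shows "computes P I n ps T \<pi> good"
proof -
  obtain D where D: "yields I P (initial_state n ps) D" "\<forall>s'\<in>set_pmf D. real (clock s') \<le> T"
      "measure_pmf.expectation D (\<lambda>s. of_bool (\<not> good (result s)) :: real) \<le> 1 - \<pi>"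
    using assms by (auto simp: triple_def)
  have "halts I ([P], initial_state n ps) (bind_pmf D return_pmf)"
    using D(1) unfolding yields_def
    by (elim conjE allE[of _ "[]"] allE[of _ return_pmf] mp) (auto simp: halts_def intro!: exI[of _ 0])
  then obtain k where k: "run I k ([P], initial_state n ps) = map_pmf (Pair []) D"
    by (auto simp: halts_def bind_return_pmf')
  have "(\<lambda>s. of_bool (\<not> good (result s)) :: real) = indicator (- {s. good (result s)})"
    by (auto simp: fun_eq_iff)
  then have "measure_pmf.prob D (- {s. good (result s)}) \<le> 1 - \<pi>"
    using D(3) by simp
  then have "\<pi> \<le> measure_pmf.prob D {s. good (result s)}"
    using measure_pmf.prob_compl[of "{s. good (result s)}" D] by (simp add: Compl_eq_Diff_UNIV)
  moreover have "Pair [] -` {(K, s). good (result s)} = {s. good (result s)}"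
    by auto
  ultimately show ?thesis
    unfolding computes_def Let_def by (intro exI[of _ k]) (use D(2) k in auto)
qed

section \<open>Substochastic kernels\<close>

definition kernel_apply :: "nat \<Rightarrow> (nat \<Rightarrow> nat \<Rightarrow> real) \<Rightarrow> (nat \<Rightarrow> real) \<Rightarrow> nat \<Rightarrow> real" where
  "kernel_apply n W f i = (\<Sum>j<n. W i j * f j)"

text \<open>For substochastic \<open>W\<close>: the expected sum of \<open>f\<close> over the first
  \<open>m\<close> positions of the walk started at \<open>i\<close>, where missing row mass is the
  probability of termination.\<close>

primrec walk_sum :: "nat \<Rightarrow> (nat \<Rightarrow> nat \<Rightarrow> real) \<Rightarrow> (nat \<Rightarrow> real) \<Rightarrow> nat \<Rightarrow> nat \<Rightarrow> real" where
  "walk_sum n W f 0 i = 0"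
| "walk_sum n W f (Suc m) i = f i + kernel_apply n W (walk_sum n W f m) i"

text \<open>Expected number of visits to \<open>v\<close> among the first \<open>m\<close>
  positions, for initial weights \<open>t\<close>.\<close>

primrec occupation :: "nat \<Rightarrow> (nat \<Rightarrow> nat \<Rightarrow> real) \<Rightarrow> (nat \<Rightarrow> real) \<Rightarrow> nat \<Rightarrow> nat \<Rightarrow> real" where
  "occupation n W t 0 v = 0"
| "occupation n W t (Suc m) v = t v + (\<Sum>u<n. occupation n W t m u * W u v)"

text \<open>Second moment of the sum whose mean is \<open>walk_sum\<close>: square f i + S, where S
  is the sum from the next position on, and take means.\<close>

primrec walk_sum_sq :: "nat \<Rightarrow> (nat \<Rightarrow> nat \<Rightarrow> real) \<Rightarrow> (nat \<Rightarrow> real) \<Rightarrow> nat \<Rightarrow> nat \<Rightarrow> real" where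
  "walk_sum_sq n W f 0 i = 0"
| "walk_sum_sq n W f (Suc m) i = (f i)\<^sup>2 + 2 * f i * kernel_apply n W (walk_sum n W f m) i
     + kernel_apply n W (walk_sum_sq n W f m) i"

lemma kernel_apply_add:
  "kernel_apply n W (\<lambda>i. f i + g i) i = kernel_apply n W f i + kernel_apply n W g i"
  by (simp add: kernel_apply_def distrib_left sum.distrib)

text \<open>Peels the iteration at the function instead of at the walk, the form needed by
  inductions that generalise \<open>f\<close>.\<close>

lemma walk_sum_Suc_right:
  "walk_sum n W f (Suc m) i = f i + walk_sum n W (kernel_apply n W f) m i"
proof (induction m arbitrary: i)
  case (Suc m)
  have "walk_sum n W f (Suc (Suc m)) i = f i + kernel_apply n W (walk_sum n W f (Suc m)) i"
    by simp
  also have "walk_sum n W f (Suc m) = (\<lambda>j. f j + walk_sum n W (kernel_apply n W f) m j)"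
    using Suc.IH by blast
  finally show ?case by (simp add: kernel_apply_add)
qed (simp add: kernel_apply_def)

lemma walk_sum_eq_sum_powers:
  "walk_sum n W f m i = (\<Sum>l<m. ((kernel_apply n W ^^ l) f) i)"
proof (induction m arbitrary: f)
  case (Suc m)
  have "walk_sum n W f (Suc m) i = f i + (\<Sum>l<m. ((kernel_apply n W ^^ l) (kernel_apply n W f)) i)"
    by (simp only: walk_sum_Suc_right Suc.IH)
  also have "\<dots> = (\<Sum>l<Suc m. ((kernel_apply n W ^^ l) f) i)"
    by (simp only: sum.lessThan_Suc_shift funpow_Suc_right o_apply funpow_0)
  finally show ?case .
qed simp

text \<open>Adjointness: applying the kernel to \<open>f\<close> against running the walk from
  \<open>t\<close>. Sampling sees the left side, the bookkeeping of pushes the right side, where the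
  weights do not depend on \<open>f\<close>.\<close>

lemma sum_walk_sum_eq_occupation:
  "(\<Sum>v<n. t v * walk_sum n W f m v) = (\<Sum>v<n. occupation n W t m v * f v)"
proof (induction m arbitrary: f)
  case (Suc m)
  have "(\<Sum>v<n. t v * walk_sum n W f (Suc m) v) =
      (\<Sum>v<n. t v * f v) + (\<Sum>v<n. occupation n W t m v * kernel_apply n W f v)"
    by (simp only: walk_sum_Suc_right distrib_left sum.distrib Suc.IH)
  also have "(\<Sum>v<n. occupation n W t m v * kernel_apply n W f v) =
      (\<Sum>v<n. (\<Sum>u<n. occupation n W t m u * W u v) * f v)"
    unfolding kernel_apply_def sum_distrib_left sum_distrib_right
    by (subst sum.swap) (simp add: mult.assoc)
  finally show ?case by (simp add: distrib_right sum.distrib)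
qed simp

context
  fixes n :: nat and W :: "nat \<Rightarrow> nat \<Rightarrow> real"
  assumes W_nonneg: "\<And>i j. i < n \<Longrightarrow> j < n \<Longrightarrow> 0 \<le> W i j"
begin

lemma kernel_apply_mono:
  assumes "\<And>j. j < n \<Longrightarrow> f j \<le> g j" "i < n"
  shows "kernel_apply n W f i \<le> kernel_apply n W g i"
  unfolding kernel_apply_def using assms W_nonneg by (intro sum_mono mult_left_mono) auto

lemma kernel_apply_nonneg:
  assumes "\<And>j. j < n \<Longrightarrow> 0 \<le> f j" "i < n"
  shows "0 \<le> kernel_apply n W f i"
  unfolding kernel_apply_def using assms W_nonneg by (intro sum_nonneg mult_nonneg_nonneg) auto

lemma kernel_apply_cmult: "kernel_apply n W (\<lambda>j. c * f j) i = c * kernel_apply n W f i"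
  by (simp add: kernel_apply_def sum_distrib_left mult.left_commute)

lemma kernel_powers_nonneg:
  assumes "\<And>j. j < n \<Longrightarrow> 0 \<le> f j" "i < n"
  shows "0 \<le> (kernel_apply n W ^^ l) f i"
  using assms(2) by (induction l arbitrary: i) (auto simp: assms(1) intro: kernel_apply_nonneg)

lemma walk_sum_nonneg:
  assumes "\<And>j. j < n \<Longrightarrow> 0 \<le> f j" "i < n"
  shows "0 \<le> walk_sum n W f m i"
  unfolding walk_sum_eq_sum_powers using assms by (intro sum_nonneg kernel_powers_nonneg) auto

context
  assumes W_row: "\<And>i. i < n \<Longrightarrow> (\<Sum>j<n. W i j) \<le> 1"
begin

lemma kernel_apply_le:
  assumes "\<And>j. j < n \<Longrightarrow> f j \<le> \<theta>" "0 \<le> \<theta>" "i < n"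
  shows "kernel_apply n W f i \<le> \<theta>"
proof -
  have "kernel_apply n W f i \<le> kernel_apply n W (\<lambda>_. \<theta>) i"
    using assms by (intro kernel_apply_mono) auto
  also have "\<dots> = (\<Sum>j<n. W i j) * \<theta>"
    by (simp add: kernel_apply_def sum_distrib_right)
  also have "\<dots> \<le> 1 * \<theta>"
    using W_row assms by (intro mult_right_mono) auto
  finally show ?thesis by simp
qed

lemma walk_sum_le:
  assumes "\<And>j. j < n \<Longrightarrow> f j \<le> \<theta>" "0 \<le> \<theta>" "i < n"
  shows "walk_sum n W f m i \<le> real m * \<theta>"
  using assms(3)
proof (induction m arbitrary: i)
  case (Suc m)
  have "kernel_apply n W (walk_sum n W f m) i \<le> real m * \<theta>"
    using Suc assms(2) by (intro kernel_apply_le) auto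
  then show ?case using assms(1)[OF Suc.prems] by (simp add: distrib_right)
qed simp

text \<open>Along a path the sum lies between 0 and m \<theta>, so its square is at most m \<theta>
  times the sum. In place of paths, the estimate is carried through the recursions.\<close>

lemma walk_sum_sq_le:
  assumes f: "\<And>j. j < n \<Longrightarrow> 0 \<le> f j" "\<And>j. j < n \<Longrightarrow> f j \<le> \<theta>" and "0 \<le> \<theta>" "i < n"
  shows "walk_sum_sq n W f m i \<le> real m * \<theta> * walk_sum n W f m i"
  using assms(4)
proof (induction m arbitrary: i)
  case (Suc m)
  define k where "k = kernel_apply n W (walk_sum n W f m) i"
  have fi: "0 \<le> f i" "f i \<le> \<theta>" using f Suc.prems by auto
  have k0: "0 \<le> k" unfolding k_def using f Suc.prems by (intro kernel_apply_nonneg walk_sum_nonneg) auto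
  have k1: "k \<le> real m * \<theta>" unfolding k_def
    using f assms(3) Suc.prems by (intro kernel_apply_le walk_sum_le) auto
  have "kernel_apply n W (walk_sum_sq n W f m) i \<le>
      kernel_apply n W (\<lambda>j. real m * \<theta> * walk_sum n W f m j) i"
    using Suc by (intro kernel_apply_mono) auto
  also have "\<dots> = real m * \<theta> * k"
    by (simp only: kernel_apply_cmult k_def)
  finally have "walk_sum_sq n W f (Suc m) i \<le> (f i)\<^sup>2 + f i * k + f i * k + real m * \<theta> * k"
    by (simp add: k_def)
  \<comment> \<open>The two halves of the cross term are bounded differently, once by k \<le> m
    \<theta> and once by f i \<le> \<theta>, so that the four products factor as (m + 1) \<theta> (f
    i + k).\<close>
  also have "\<dots> \<le> \<theta> * f i + f i * (real m * \<theta>) + \<theta> * k + real m * \<theta> * k"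
    unfolding power2_eq_square
    by (intro add_mono mult_right_mono mult_left_mono order_refl) (use fi k0 k1 in auto)
  also have "\<dots> = real (Suc m) * \<theta> * walk_sum n W f (Suc m) i"
    by (simp add: k_def algebra_simps)
  finally show ?case .
qed simp

end

end

section \<open>The lazy walk of an RCDDZ matrix\<close>

definition lazy_walk :: "real mat \<Rightarrow> nat \<Rightarrow> nat \<Rightarrow> real" where
  "lazy_walk M i j = of_bool (i = j) - M $$ (i,j) / (2 * M $$ (i,i))"

lemma RCDDZ_diag_pos: "RCDDZ M \<Longrightarrow> j < dim_row M \<Longrightarrow> 0 < M $$ (j,j)"
  unfolding RCDDZ_def RDD_def by blast

lemma RCDDZ_square: "RCDDZ M \<Longrightarrow> M \<in> carrier_mat (dim_row M) (dim_row M)"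
  unfolding RCDDZ_def RDD_def by (metis carrier_matI square_mat.elims(2))

lemma RCDDZ_off_diag: "RCDDZ M \<Longrightarrow> i < dim_row M \<Longrightarrow> j < dim_row M \<Longrightarrow> i \<noteq> j \<Longrightarrow> M $$ (i,j) \<le> 0"
  unfolding RCDDZ_def by blast

text \<open>Off-diagonal entries are nonpositive, so diagonal dominance of a row is nonnegativity of
  its plain sum.\<close>

lemma RCDDZ_row_sum:
  assumes "RCDDZ M" "i < dim_row M"
  shows "0 \<le> (\<Sum>j<dim_row M. M $$ (i,j))"
proof -
  have "(\<Sum>j\<in>{..<dim_row M} - {i}. \<bar>M $$ (i,j)\<bar>) = - (\<Sum>j\<in>{..<dim_row M} - {i}. M $$ (i,j))"
    unfolding sum_negf[symmetric] using assms RCDDZ_off_diag[OF assms(1)] by (intro sum.cong) auto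
  moreover have "(\<Sum>j\<in>{..<dim_row M} - {i}. \<bar>M $$ (i,j)\<bar>) \<le> M $$ (i,i)"
    using assms unfolding RCDDZ_def RDD_def by blast
  ultimately show ?thesis
    using assms(2) by (simp add: sum.remove[of _ i])
qed

text \<open>Lets column statements be read off from row statements.\<close>

lemma RCDDZ_transpose:
  assumes "RCDDZ M"
  shows "RCDDZ (transpose_mat M)"
proof -
  have n: "dim_col M = dim_row M" using carrier_matD(2)[OF RCDDZ_square[OF assms]] .
  have "\<forall>j<dim_row M. \<forall>k<dim_row M. j \<noteq> k \<longrightarrow> transpose_mat M $$ (j,k) \<le> 0"
    using RCDDZ_off_diag[OF assms] n by auto
  then show ?thesis
    using assms unfolding RCDDZ_def by (simp only: index_transpose_mat transpose_transpose n simp_thms)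
qed

lemma RCDDZ_col_sum:
  assumes "RCDDZ M" "j < dim_row M"
  shows "0 \<le> (\<Sum>i<dim_row M. M $$ (i,j))"
proof -
  have "dim_col M = dim_row M" using carrier_matD(2)[OF RCDDZ_square[OF assms(1)]] .
  then show ?thesis
    using RCDDZ_row_sum[OF RCDDZ_transpose[OF assms(1)], of j] assms(2) by simp
qed

lemma lazy_walk_nonneg:
  assumes "RCDDZ M" "i < dim_row M" "j < dim_row M"
  shows "0 \<le> lazy_walk M i j"
  using RCDDZ_off_diag[OF assms] RCDDZ_diag_pos[OF assms(1,2)]
  by (cases "i = j") (auto simp: lazy_walk_def divide_le_0_iff)

lemma lazy_walk_row_sum:
  assumes "RCDDZ M" "i < dim_row M"
  shows "(\<Sum>j<dim_row M. lazy_walk M i j) \<le> 1"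
proof -
  have "(\<Sum>j<dim_row M. lazy_walk M i j) = 1 - (\<Sum>j<dim_row M. M $$ (i,j)) / (2 * M $$ (i,i))"
    using assms(2) by (simp add: lazy_walk_def sum_subtractf sum_divide_distrib of_bool_def)
  then show ?thesis
    using RCDDZ_row_sum[OF assms] RCDDZ_diag_pos[OF assms] by simp
qed

text \<open>The weight M(i,i) cancels the denominator in the kernel and leaves M(j,j) minus half a
  column sum. This is why pushing does not increase D-weighted mass.\<close>

lemma lazy_walk_col_sum:
  assumes "RCDDZ M" "j < dim_row M"
  shows "(\<Sum>i<dim_row M. lazy_walk M i j * M $$ (i,i)) \<le> M $$ (j,j)"
proof -
  have "(\<Sum>i<dim_row M. lazy_walk M i j * M $$ (i,i)) =
      (\<Sum>i<dim_row M. (if i = j then M $$ (i,i) else 0) - M $$ (i,j) / 2)"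
    using RCDDZ_diag_pos[OF assms(1)]
    by (intro sum.cong) (force simp: lazy_walk_def field_simps)+
  also have "\<dots> = M $$ (j,j) - (\<Sum>i<dim_row M. M $$ (i,j)) / 2"
    using assms(2) by (simp add: sum_subtractf sum_divide_distrib)
  finally show ?thesis using RCDDZ_col_sum[OF assms] by simp
qed

section \<open>Matrix expressions in coordinates\<close>

lemma A_tr_carrier [simp]: "M \<in> carrier_mat n n \<Longrightarrow> A_tr M \<in> carrier_mat n n"
  by (auto simp: A_tr_def)

lemma diag_powr_carrier [simp]: "M \<in> carrier_mat n n \<Longrightarrow> diag_powr M a \<in> carrier_mat n n"
  by (auto simp: diag_powr_def)

lemma A_tr_nth:
  assumes "M \<in> carrier_mat n n" "i < n" "j < n"
  shows "A_tr M $$ (i,j) = (if i = j then 0 else - M $$ (i,j))"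
  using assms by (auto simp: A_tr_def mat_diag_def)

lemma diag_powr_mult_nth:
  assumes "M \<in> carrier_mat n n" "A \<in> carrier_mat n n" "i < n" "j < n"
  shows "(diag_powr M a * A) $$ (i,j) = M $$ (i,i) powr a * A $$ (i,j)"
proof -
  have "diag_powr M a * A = Matrix.mat n n (\<lambda>(i,j). M $$ (i,i) powr a * A $$ (i,j))"
    unfolding diag_powr_def using mat_diag_mult_left[OF assms(2)] assms(1) by auto
  then show ?thesis using assms by simp
qed

lemma mult_diag_powr_nth:
  assumes "M \<in> carrier_mat n n" "A \<in> carrier_mat n n" "i < n" "j < n"
  shows "(A * diag_powr M a) $$ (i,j) = A $$ (i,j) * M $$ (j,j) powr a"
proof -
  have "A * diag_powr M a = Matrix.mat n n (\<lambda>(i,j). A $$ (i,j) * M $$ (j,j) powr a)"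
    unfolding diag_powr_def using mat_diag_mult_right[OF assms(2)] assms(1) by auto
  then show ?thesis using assms by simp
qed

lemma half_one_plus_nth:
  assumes "S \<in> carrier_mat n n" "i < n" "j < n"
  shows "((1/2) \<cdot>\<^sub>m (1\<^sub>m n + S)) $$ (i,j) = (of_bool (i = j) + S $$ (i,j)) / (2::real)"
  using assms by auto

lemma lazy_walk_mat:
  assumes "M \<in> carrier_mat n n" "\<And>i. i < n \<Longrightarrow> 0 < M $$ (i,i)" "i < n" "j < n"
  shows "((1/2) \<cdot>\<^sub>m (1\<^sub>m n + diag_powr M (-1) * A_tr M)) $$ (i,j) = lazy_walk M i j"
proof -
  have eq: "((1/2) \<cdot>\<^sub>m (1\<^sub>m n + diag_powr M (-1) * A_tr M)) $$ (i,j) =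
      (of_bool (i = j) + M $$ (i,i) powr (-1) * A_tr M $$ (i,j)) / 2"
    using assms by (subst half_one_plus_nth)
      (auto intro!: mult_carrier_mat[of _ n n] simp: diag_powr_mult_nth[of M n])
  have inv: "M $$ (i,i) powr (-1) = 1 / M $$ (i,i)"
    using assms(2)[OF assms(3)] by (simp add: powr_minus divide_inverse)
  show ?thesis
    unfolding eq inv A_tr_nth[OF assms(1,3,4)] lazy_walk_def
    using assms(2)[OF assms(3)] by (cases "i = j") simp_all
qed

lemma mult_mat_vec_eq_sum:
  assumes "A \<in> carrier_mat m n" "x \<in> carrier_vec n" "i < m"
  shows "(A *\<^sub>v x) $ i = (\<Sum>j<n. A $$ (i,j) * x $ j)"
  using assms by (auto simp: scalar_prod_def atLeast0LessThan intro!: sum.cong)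

lemma pow_mat_mult_vec:
  assumes A: "A \<in> carrier_mat n n" and "x \<in> carrier_vec n" "i < n"
    and W: "\<And>i j. i < n \<Longrightarrow> j < n \<Longrightarrow> A $$ (i,j) = W i j"
    and f: "\<And>i. i < n \<Longrightarrow> x $ i = f i"
  shows "((A ^\<^sub>m l) *\<^sub>v x) $ i = (kernel_apply n W ^^ l) f i"
  using assms(2) f
proof (induction l arbitrary: x f)
  case 0
  then show ?case using A assms(3) by simp
next
  case (Suc l)
  have "((A ^\<^sub>m Suc l) *\<^sub>v x) = (A ^\<^sub>m l) *\<^sub>v (A *\<^sub>v x)"
    unfolding pow_mat.simps using A Suc.prems(1) by (intro assoc_mult_mat_vec[of _ n n _ n]) auto
  moreover have "((A ^\<^sub>m l) *\<^sub>v (A *\<^sub>v x)) $ i = (kernel_apply n W ^^ l) (kernel_apply n W f) i"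
  proof (rule Suc.IH)
    show "A *\<^sub>v x \<in> carrier_vec n" using A Suc.prems(1) by simp
    show "(A *\<^sub>v x) $ j = kernel_apply n W f j" if "j < n" for j
      using that A Suc.prems W
      by (simp only: mult_mat_vec_eq_sum[of A n n] kernel_apply_def) (auto intro!: sum.cong)
  qed
  ultimately show ?case by (simp add: funpow_swap1)
qed

lemma diag_powr_mult_vec:
  assumes "M \<in> carrier_mat n n" "x \<in> carrier_vec n" "i < n"
  shows "(diag_powr M a *\<^sub>v x) $ i = M $$ (i,i) powr a * x $ i"
proof -
  have "(diag_powr M a *\<^sub>v x) $ i = (\<Sum>j<n. diag_powr M a $$ (i,j) * x $ j)"
    using assms by (intro mult_mat_vec_eq_sum[of _ n]) auto
  also have "\<dots> = (\<Sum>j<n. if i = j then M $$ (i,i) powr a * x $ i else 0)"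
    using assms by (intro sum.cong) (auto simp: diag_powr_def mat_diag_def)
  finally show ?thesis using assms(3) by simp
qed

text \<open>The \<open>l\<close>-th summand of the series defining \<^const>\<open>x_star\<close>, up to the factor \<open>1/2\<close>.\<close>

definition x_term :: "real mat \<Rightarrow> real Matrix.vec \<Rightarrow> nat \<Rightarrow> nat \<Rightarrow> real" where
  "x_term M b l = (kernel_apply (dim_row M) (lazy_walk M) ^^ l) (\<lambda>i. b $ i / M $$ (i,i))"

lemma x_star_nth:
  assumes "M \<in> carrier_mat n n" "b \<in> carrier_vec n" "\<And>i. i < n \<Longrightarrow> 0 < M $$ (i,i)" "i < n"
  shows "x_star M b $ i = 1/2 * (\<Sum>l. x_term M b l i)"
proof -
  have n: "dim_row M = n" using assms(1) by auto
  have "((((1/2) \<cdot>\<^sub>m (1\<^sub>m n + diag_powr M (-1) * A_tr M)) ^\<^sub>m l) *\<^sub>v (diag_powr M (-1) *\<^sub>v b)) $ i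
      = x_term M b l i" for l
    unfolding x_term_def n
  proof (rule pow_mat_mult_vec)
    show "(diag_powr M (-1) *\<^sub>v b) $ j = b $ j / M $$ (j,j)" if "j < n" for j
      using that assms(3)[OF that] assms(1,2)
      by (simp add: diag_powr_mult_vec[of M n] powr_minus divide_inverse mult.commute)
    show "(1/2) \<cdot>\<^sub>m (1\<^sub>m n + diag_powr M (-1) * A_tr M) \<in> carrier_mat n n"
      using assms(1) by (simp add: mult_carrier_mat[of _ n n])
    show "diag_powr M (-1) *\<^sub>v b \<in> carrier_vec n"
      using assms(1,2) by (simp add: mult_mat_vec_carrier[of _ n n])
  qed (use assms lazy_walk_mat[OF assms(1,3)] in blast)+
  then show ?thesis using assms(4) by (simp add: x_star_def n)
qed

section \<open>Truncation error\<close>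

lemma lp_norm_infinity: "lp_norm \<infinity> x = Max ((\<lambda>i. \<bar>x $ i\<bar>) ` {..<dim_vec x})"
  by (simp add: lp_norm_def)

lemma abs_nth_le_lp_norm:
  assumes "1 \<le> p" "i < dim_vec x"
  shows "\<bar>x $ i\<bar> \<le> lp_norm p x"
proof (cases p)
  case (real r)
  then have r: "1 \<le> r" using assms(1) by simp
  have "\<bar>x $ i\<bar> = (\<bar>x $ i\<bar> powr r) powr (1 / r)"
    using r by (simp add: powr_powr)
  also have "\<dots> \<le> (\<Sum>i<dim_vec x. \<bar>x $ i\<bar> powr r) powr (1 / r)"
    using assms(2) r by (intro powr_mono2 member_le_sum) auto
  finally show ?thesis by (simp add: lp_norm_def real)
next
  case PInf
  then show ?thesis using assms(2) by (auto simp: lp_norm_def intro!: Max_ge)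
qed (use assms in auto)

text \<open>Crude but uniform in \<open>p\<close>, so that one bound serves whichever exponent comes
  close to \<open>gamma_max\<close>.\<close>

lemma lp_norm_le:
  assumes "1 \<le> p" "0 < dim_vec x" "\<And>i. i < dim_vec x \<Longrightarrow> \<bar>x $ i\<bar> \<le> m"
  shows "lp_norm p x \<le> real (norm0 x) * m"
proof -
  define A where "A = {i. i < dim_vec x \<and> x $ i \<noteq> 0}"
  have A: "finite A" "A \<subseteq> {..<dim_vec x}" "norm0 x = card A" by (auto simp: A_def norm0_def)
  have m: "0 \<le> m" using assms(3)[OF assms(2)] by linarith
  show ?thesis
  proof (cases p)
    case (real r)
    then have r: "1 \<le> r" using assms(1) by simp
    have "(\<Sum>i<dim_vec x. \<bar>x $ i\<bar> powr r) = (\<Sum>i\<in>A. \<bar>x $ i\<bar> powr r)"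
      using A by (intro sum.mono_neutral_right) (auto simp: A_def)
    also have "\<dots> \<le> (\<Sum>i\<in>A. m powr r)"
      using r A(2) assms(3) by (intro sum_mono powr_mono2) auto
    finally have "(\<Sum>i<dim_vec x. \<bar>x $ i\<bar> powr r) powr (1 / r) \<le> (card A * m powr r) powr (1 / r)"
      using r by (intro powr_mono2 sum_nonneg) auto
    also have "\<dots> = real (card A) powr (1 / r) * m"
      using r m by (simp add: powr_mult powr_powr)
    \<comment> \<open>The exponent is at most 1 and a nonzero cardinality is at least 1; the base 0
      is a separate case.\<close>
    also have "real (card A) powr (1 / r) \<le> real (card A)"
    proof (cases "card A = 0")
      case False
      then show ?thesis using powr_mono[of "1 / r" 1 "real (card A)"] r by simp
    qed simp
    finally show ?thesis
      using m by (simp add: lp_norm_def real A(3) mult_right_mono)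
  next
    case PInf
    have "\<bar>x $ i\<bar> \<le> real (card A) * m" if "i < dim_vec x" for i
    proof (cases "x $ i = 0")
      case False
      then have "1 \<le> card A" using that A(1) by (auto simp: Suc_le_eq card_gt_0_iff A_def)
      then have "1 * m \<le> real (card A) * m" using m by (intro mult_right_mono) auto
      then show ?thesis using assms(3)[OF that] by simp
    qed (use m in simp)
    then show ?thesis
      using assms(2) by (auto simp: PInf lp_norm_infinity A(3) intro!: Max.boundedI)
  qed (use assms in auto)
qed

lemma lp_norm_nonneg: "1 \<le> p \<Longrightarrow> 0 < dim_vec x \<Longrightarrow> 0 \<le> lp_norm p x"
  using abs_nth_le_lp_norm[of p 0 x] by linarith

lemma norm0_le_dim: "norm0 x \<le> dim_vec x"
  unfolding norm0_def 
  using card_mono[of "{..<dim_vec x}" "{i. i < dim_vec x \<and> x $ i \<noteq> 0}"] by auto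

text \<open>Serves boundedness: a supremum of reals is an upper bound only for a set that is
  bounded. The constant is irrelevant and may depend on \<open>T\<close> and
  \<open>n\<close>.\<close>

lemma lp_norm_mult_mat_vec_le:
  assumes T: "T \<in> carrier_mat n n" and x: "x \<in> carrier_vec n" and "1 \<le> p" "0 < n"
  shows "lp_norm p (T *\<^sub>v x) \<le> real n * (\<Sum>i<n. \<Sum>j<n. \<bar>T $$ (i,j)\<bar>) * lp_norm p x"
proof -
  define K where "K = (\<Sum>i<n. \<Sum>j<n. \<bar>T $$ (i,j)\<bar>)"
  have nn: "0 \<le> lp_norm p x" using assms by (intro lp_norm_nonneg) auto
  have "\<bar>(T *\<^sub>v x) $ i\<bar> \<le> K * lp_norm p x" if i: "i < n" for i
  proof -
    have "\<bar>(T *\<^sub>v x) $ i\<bar> \<le> (\<Sum>j<n. \<bar>T $$ (i,j)\<bar> * \<bar>x $ j\<bar>)"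
      unfolding mult_mat_vec_eq_sum[OF T x i] abs_mult[symmetric] by (rule sum_abs)
    also have "\<dots> \<le> (\<Sum>j<n. \<bar>T $$ (i,j)\<bar> * lp_norm p x)"
      using assms by (intro sum_mono mult_left_mono abs_nth_le_lp_norm) auto
    also have "\<dots> = (\<Sum>j<n. \<bar>T $$ (i,j)\<bar>) * lp_norm p x"
      by (simp add: sum_distrib_right)
    also have "\<dots> \<le> K * lp_norm p x"
      unfolding K_def using nn i
      by (intro mult_right_mono member_le_sum[of i "{..<n}" "\<lambda>i. \<Sum>j<n. \<bar>T $$ (i,j)\<bar>"]) (auto intro: sum_nonneg)
    finally show ?thesis .
  qed
  then have "lp_norm p (T *\<^sub>v x) \<le> real (norm0 (T *\<^sub>v x)) * (K * lp_norm p x)"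
    using assms by (intro lp_norm_le) auto
  also have "\<dots> \<le> real n * (K * lp_norm p x)"
    using norm0_le_dim[of "T *\<^sub>v x"] T nn
    by (intro mult_right_mono) (auto simp: K_def intro!: mult_nonneg_nonneg sum_nonneg)
  finally show ?thesis by (simp add: K_def)
qed

lemma restricted_norm_upper:
  assumes T: "T \<in> carrier_mat n n" and V: "V \<subseteq> carrier_vec n" and x: "x \<in> V" "x \<noteq> 0\<^sub>v n"
    and "1 \<le> p"
  shows "0 < lp_norm p x" "lp_norm p (T *\<^sub>v x) / lp_norm p x \<le> restricted_norm p T V"
proof -
  have pos: "0 < lp_norm p y" if y: "y \<in> V" "y \<noteq> 0\<^sub>v n" for y
  proof -
    have "y \<in> carrier_vec n" using y V by blast
    then obtain i where "i < n" "y $ i \<noteq> 0" using y(2) by (metis carrier_vecD eq_vecI index_zero_vec)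
    then show ?thesis
      using abs_nth_le_lp_norm[OF assms(5), of i y] \<open>y \<in> carrier_vec n\<close> by auto
  qed
  show "0 < lp_norm p x" using pos x by blast
  have n: "0 < n" using x V by (metis carrier_vecD eq_vecI gr_zeroI index_zero_vec(2) not_less_zero subsetD)
  have d: "dim_col T = n" using T by auto
  show "lp_norm p (T *\<^sub>v x) / lp_norm p x \<le> restricted_norm p T V"
    unfolding restricted_norm_def d
  proof (rule cSUP_upper)
    show "bdd_above ((\<lambda>x. lp_norm p (T *\<^sub>v x) / lp_norm p x) ` (V - {0\<^sub>v n}))"
    proof (rule bdd_aboveI2)
      fix y assume "y \<in> V - {0\<^sub>v n}"
      then show "lp_norm p (T *\<^sub>v y) / lp_norm p y \<le> real n * (\<Sum>i<n. \<Sum>j<n. \<bar>T $$ (i,j)\<bar>)"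
        using lp_norm_mult_mat_vec_le[OF T _ assms(5) n, of y] pos[of y] V
        by (auto simp: divide_le_eq)
    qed
  qed (use x in auto)
qed

lemma x_term_0: "x_term M b 0 i = b $ i / M $$ (i,i)"
  by (simp add: x_term_def)

lemma x_term_Suc: "x_term M b (Suc l) i = (\<Sum>j<dim_row M. lazy_walk M i j * x_term M b l j)"
  by (simp add: x_term_def kernel_apply_def)

text \<open>The kernel as I - D^-1 M / 2, the form that shows its effect on the range of D^-1
  M.\<close>

lemma x_term_Suc':
  assumes "i < dim_row M"
  shows "x_term M b (Suc l) i =
    x_term M b l i - (\<Sum>j<dim_row M. M $$ (i,j) * x_term M b l j) / (2 * M $$ (i,i))"
proof -
  have "x_term M b (Suc l) i = (\<Sum>j<dim_row M. (if i = j then x_term M b l j else 0)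
      - M $$ (i,j) * x_term M b l j / (2 * M $$ (i,i)))"
    unfolding x_term_Suc by (intro sum.cong) (auto simp: lazy_walk_def algebra_simps)
  then show ?thesis using assms by (simp add: sum_subtractf sum_divide_distrib)
qed

text \<open>The range of D^-1 M contains D^-1 b and is invariant under the kernel, which subtracts
  D^-1 M x / 2. After rescaling, vectors of this range are the ones that the restricted norm in
  \<open>gamma_max\<close> controls.\<close>

lemma x_term_in_range:
  assumes M: "M \<in> carrier_mat n n" and pos: "\<And>i. i < n \<Longrightarrow> 0 < M $$ (i,i)" and b: "b \<in> mat_range M"
  shows "\<exists>z. \<forall>i<n. x_term M b l i = (\<Sum>j<n. M $$ (i,j) * z j) / M $$ (i,i)"
proof (induction l)
  case 0
  obtain z where z: "z \<in> carrier_vec n" "b = M *\<^sub>v z" using b M by (auto simp: mat_range_def)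
  then show ?case
    using M by (intro exI[of _ "\<lambda>j. z $ j"]) (auto simp: x_term_0 mult_mat_vec_eq_sum[of M n n] simp del: index_mult_mat_vec)
next
  case (Suc l)
  have n: "dim_row M = n" using M by auto
  obtain z where z: "\<forall>i<n. x_term M b l i = (\<Sum>j<n. M $$ (i,j) * z j) / M $$ (i,i)"
    using Suc by blast
  \<comment> \<open>If x = D^-1 M z, then x - D^-1 M x / 2 is the image of z - x / 2.\<close>
  have "x_term M b (Suc l) i = (\<Sum>j<n. M $$ (i,j) * (z j - x_term M b l j / 2)) / M $$ (i,i)"
    if "i < n" for i
  proof -
    have "x_term M b (Suc l) i = (\<Sum>j<n. M $$ (i,j) * z j) / M $$ (i,i)
        - (\<Sum>j<n. M $$ (i,j) * x_term M b l j) / (2 * M $$ (i,i))"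
      using x_term_Suc'[of i M b l] z that n by simp
    then show ?thesis
      using pos[OF that]
      by (simp add: right_diff_distrib sum_subtractf diff_divide_distrib sum_divide_distrib[symmetric])
  qed
  then show ?case by (intro exI[of _ "\<lambda>j. z j - x_term M b l j / 2"]) blast
qed

lemma conjugate_exponents:
  fixes p q :: ereal
  assumes "1 \<le> p" "1 \<le> q" "1/p + 1/q = 1"
  shows "real_of_ereal (1/p) + real_of_ereal (1/q) = 1" "0 \<le> real_of_ereal (1/p)" "0 \<le> real_of_ereal (1/q)"
  using assms by (cases p; cases q; auto simp: one_ereal_def divide_ereal_def split: if_splits)+

section \<open>Conjugation by powers of the diagonal part\<close>

context
  fixes M :: "real mat" and n :: nat and p q :: ereal
  assumes M: "M \<in> carrier_mat n n" and diag_pos: "\<And>i. i < n \<Longrightarrow> 0 < M $$ (i,i)"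
    and pq: "1 \<le> p" "1 \<le> q" "1/p + 1/q = 1"
begin

text \<open>This is D^(1/p) W^l D^-1 b. Conjugation by D^(1/p) turns the kernel into the matrix of
  \<open>gamma_max\<close>, because 1/p - 1 = -1/q.\<close>

definition scaled_term :: "real Matrix.vec \<Rightarrow> nat \<Rightarrow> real Matrix.vec" where
  "scaled_term b l = Matrix.vec n (\<lambda>i. M $$ (i,i) powr real_of_ereal (1/p) * x_term M b l i)"

lemma dim_row_M: "dim_row M = n" using M by auto

lemma scaled_A_carrier: "scaled_A M p q \<in> carrier_mat n n"
  unfolding scaled_A_def using M by (intro mult_carrier_mat[of _ n n]) auto

lemma scaled_A_nth:
  assumes "i < n" "j < n"
  shows "scaled_A M p q $$ (i,j) * M $$ (j,j) powr real_of_ereal (1/p) =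
    (if i = j then 0 else - M $$ (i,j) * (M $$ (i,i) powr real_of_ereal (1/p) / M $$ (i,i)))"
proof -
  define a where "a = real_of_ereal (1/p)"
  define a' where "a' = real_of_ereal (1/q)"
  have a: "- a' = a - 1" using conjugate_exponents[OF pq] by (simp add: a_def a'_def)
  have "scaled_A M p q $$ (i,j) = M $$ (i,i) powr (- a') * A_tr M $$ (i,j) * M $$ (j,j) powr (- a)"
    unfolding scaled_A_def a_def a'_def using M assms
    by (subst mult_diag_powr_nth[of M n]) (auto simp: diag_powr_mult_nth[of M n] intro!: mult_carrier_mat[of _ n n])
  moreover have "M $$ (j,j) powr (- a) * M $$ (j,j) powr a = 1"
    using diag_pos[OF assms(2)] by (simp add: powr_minus field_simps)
  moreover have "M $$ (i,i) powr (- a') = M $$ (i,i) powr a / M $$ (i,i)"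
    unfolding a using diag_pos[OF assms(1)] by (simp add: powr_diff)
  ultimately show ?thesis
    unfolding a_def[symmetric] A_tr_nth[OF M assms] by simp
qed

lemma scaled_term_Suc:
  "((1/2) \<cdot>\<^sub>m (1\<^sub>m n + scaled_A M p q)) *\<^sub>v scaled_term b l = scaled_term b (Suc l)"
proof (rule eq_vecI)
  fix i assume "i < dim_vec (scaled_term b (Suc l))"
  then have i: "i < n" by (simp add: scaled_term_def)
  define T where "T = (1/2) \<cdot>\<^sub>m (1\<^sub>m n + scaled_A M p q)"
  have T: "T \<in> carrier_mat n n" using scaled_A_carrier by (simp add: T_def)
  have "(T *\<^sub>v scaled_term b l) $ i = (\<Sum>j<n. T $$ (i,j) * scaled_term b l $ j)"
    using T i by (intro mult_mat_vec_eq_sum) (auto simp: scaled_term_def)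
  also have "\<dots> = (\<Sum>j<n. M $$ (i,i) powr real_of_ereal (1/p) * (lazy_walk M i j * x_term M b l j))"
  proof (intro sum.cong refl)
    fix j assume "j \<in> {..<n}"
    then have j: "j < n" by simp
    have "T $$ (i,j) * M $$ (j,j) powr real_of_ereal (1/p) =
        (of_bool (i = j) * M $$ (j,j) powr real_of_ereal (1/p)
          + scaled_A M p q $$ (i,j) * M $$ (j,j) powr real_of_ereal (1/p)) / 2"
      unfolding T_def half_one_plus_nth[OF scaled_A_carrier i j] by (simp add: algebra_simps)
    also have "\<dots> = M $$ (i,i) powr real_of_ereal (1/p) * lazy_walk M i j"
      unfolding scaled_A_nth[OF i j] using diag_pos[OF i] by (simp add: lazy_walk_def)
    finally show "T $$ (i,j) * scaled_term b l $ j =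
        M $$ (i,i) powr real_of_ereal (1/p) * (lazy_walk M i j * x_term M b l j)"
      using j by (simp add: scaled_term_def)
  qed
  also have "\<dots> = scaled_term b (Suc l) $ i"
    using i by (simp add: scaled_term_def x_term_Suc dim_row_M sum_distrib_left)
  finally show "(T *\<^sub>v scaled_term b l) $ i = scaled_term b (Suc l) $ i" .
qed (use scaled_A_carrier in \<open>auto simp: scaled_term_def\<close>)

text \<open>In matrix form, I - \<open>scaled_A\<close> is D^(-1/q) M D^(-1/p), so D^(1/p) D^-1 M z
  is its value at D^(1/p) z, the vector \<open>w\<close> below.\<close>

lemma scaled_term_in_range:
  assumes "b \<in> mat_range M"
  shows "scaled_term b l \<in> mat_range (1\<^sub>m n - scaled_A M p q)"
proof -
  obtain z where z: "\<forall>i<n. x_term M b l i = (\<Sum>j<n. M $$ (i,j) * z j) / M $$ (i,i)"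
    using x_term_in_range[OF M diag_pos assms] by blast
  define w where "w = Matrix.vec n (\<lambda>j. M $$ (j,j) powr real_of_ereal (1/p) * z j)"
  define R where "R = 1\<^sub>m n - scaled_A M p q"
  have R: "R \<in> carrier_mat n n" unfolding R_def using scaled_A_carrier by (intro minus_carrier_mat)
  have "scaled_term b l = R *\<^sub>v w"
  proof (rule eq_vecI)
    fix i assume "i < dim_vec (R *\<^sub>v w)"
    then have i: "i < n" using R by simp
    have "(R *\<^sub>v w) $ i = (\<Sum>j<n. R $$ (i,j) * w $ j)"
      using R i by (intro mult_mat_vec_eq_sum) (auto simp: w_def)
    also have "\<dots> = (\<Sum>j<n. M $$ (i,i) powr real_of_ereal (1/p) / M $$ (i,i) * (M $$ (i,j) * z j))"
    proof (intro sum.cong refl)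
      fix j assume "j \<in> {..<n}"
      then have j: "j < n" by simp
      have "R $$ (i,j) * M $$ (j,j) powr real_of_ereal (1/p) =
          of_bool (i = j) * M $$ (j,j) powr real_of_ereal (1/p)
            - scaled_A M p q $$ (i,j) * M $$ (j,j) powr real_of_ereal (1/p)"
        using i j scaled_A_carrier by (simp add: R_def algebra_simps)
      also have "\<dots> = M $$ (i,i) powr real_of_ereal (1/p) / M $$ (i,i) * M $$ (i,j)"
        unfolding scaled_A_nth[OF i j] using diag_pos[OF i] by simp
      finally have "R $$ (i,j) * M $$ (j,j) powr real_of_ereal (1/p) * z j =
          M $$ (i,i) powr real_of_ereal (1/p) / M $$ (i,i) * M $$ (i,j) * z j"
        by simp
      then show "R $$ (i,j) * w $ j =
          M $$ (i,i) powr real_of_ereal (1/p) / M $$ (i,i) * (M $$ (i,j) * z j)"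
        using j by (simp add: w_def mult.assoc)
    qed
    also have "\<dots> = scaled_term b l $ i"
      using i z by (simp add: scaled_term_def sum_distrib_left sum_divide_distrib)
    finally show "scaled_term b l $ i = (R *\<^sub>v w) $ i" by simp
  qed (use R in \<open>auto simp: scaled_term_def\<close>)
  then show ?thesis unfolding mat_range_def R_def[symmetric] using R by (auto simp: w_def)
qed

lemma scaled_term_norm_le:
  assumes b: "b \<in> mat_range M" "b \<noteq> 0\<^sub>v n"
  defines "\<rho> \<equiv> restricted_norm p ((1/2) \<cdot>\<^sub>m (1\<^sub>m n + scaled_A M p q)) (mat_range (1\<^sub>m n - scaled_A M p q))"
  shows "0 \<le> \<rho>" "lp_norm p (scaled_term b l) \<le> \<rho> ^ l * lp_norm p (scaled_term b 0)"
proof -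
  have bc: "b \<in> carrier_vec n" using b(1) M by (auto simp: mat_range_def)
  have n: "0 < n" using b(2) bc by (cases n) auto
  have T: "(1/2) \<cdot>\<^sub>m (1\<^sub>m n + scaled_A M p q) \<in> carrier_mat n n" using scaled_A_carrier by simp
  have V: "mat_range (1\<^sub>m n - scaled_A M p q) \<subseteq> carrier_vec n"
    unfolding mat_range_def using mult_mat_vec_carrier[OF minus_carrier_mat[OF scaled_A_carrier]]
      carrier_matD(2)[OF scaled_A_carrier] by auto
  have up: "lp_norm p (scaled_term b (Suc l)) \<le> \<rho> * lp_norm p (scaled_term b l)"
    if "scaled_term b l \<noteq> 0\<^sub>v n" for l
    using restricted_norm_upper[OF T V scaled_term_in_range[OF b(1), of l] that pq(1)]
    by (simp add: scaled_term_Suc \<rho>_def pos_divide_le_eq)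
  \<comment> \<open>As \<open>b\<close> is nonzero, the supremum defining \<rho> ranges over a
    nonempty set; this yields 0 \<le> \<rho>.\<close>
  have s0: "scaled_term b 0 \<noteq> 0\<^sub>v n"
  proof
    assume eq: "scaled_term b 0 = 0\<^sub>v n"
    have "b $ i = 0" if "i < n" for i
    proof -
      have "scaled_term b 0 $ i = 0" using eq that by simp
      then show ?thesis using diag_pos[OF that] that by (auto simp: scaled_term_def x_term_0)
    qed
    then show False using b(2) bc by (metis carrier_vecD eq_vecI index_zero_vec)
  qed
  have nn: "0 \<le> lp_norm p (scaled_term b l)" for l
    using n pq by (intro lp_norm_nonneg) (auto simp: scaled_term_def)
  show \<rho>: "0 \<le> \<rho>"
  proof -
    have "0 \<le> lp_norm p (scaled_term b (Suc 0)) / lp_norm p (scaled_term b 0)"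
      using nn by simp
    also have "\<dots> \<le> \<rho>"
      using restricted_norm_upper(2)[OF T V scaled_term_in_range[OF b(1), of 0] s0 pq(1)]
      by (simp only: scaled_term_Suc \<rho>_def)
    finally show ?thesis .
  qed
  show "lp_norm p (scaled_term b l) \<le> \<rho> ^ l * lp_norm p (scaled_term b 0)"
  proof (induction l)
    case (Suc l)
    show ?case
    proof (cases "scaled_term b l = 0\<^sub>v n")
      \<comment> \<open>The supremum omits the zero vector, so a vanishing term is treated apart:
        its successor vanishes too.\<close>
      case True
      have "scaled_term b (Suc l) = 0\<^sub>v n"
        unfolding scaled_term_Suc[symmetric] True using T
        by (intro eq_vecI) (auto simp: mult_mat_vec_eq_sum[of _ n n] simp del: index_mult_mat_vec)
      then have "lp_norm p (scaled_term b (Suc l)) \<le> 0"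
        using lp_norm_le[of p "0\<^sub>v n" 0] n pq by simp
      also have "0 \<le> \<rho> ^ Suc l * lp_norm p (scaled_term b 0)" using \<rho> nn by simp
      finally show ?thesis .
    next
      case False
      have "lp_norm p (scaled_term b (Suc l)) \<le> \<rho> * lp_norm p (scaled_term b l)" by (rule up[OF False])
      also have "\<dots> \<le> \<rho> * (\<rho> ^ l * lp_norm p (scaled_term b 0))"
        using Suc.IH \<rho> by (intro mult_left_mono)
      finally show ?thesis by simp
    qed
  qed simp
qed

lemma diag_le_d_max: "i < n \<Longrightarrow> M $$ (i,i) \<le> d_max M"
  unfolding d_max_def dim_row_M by (intro Max_ge) auto

lemma scaled_term_0_norm_le:
  assumes b: "b \<in> carrier_vec n" and n: "0 < n"
  shows "lp_norm p (scaled_term b 0) \<le>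
    d_max M powr real_of_ereal (1/p) * real (norm0 b) * lp_norm \<infinity> (diag_powr M (-1) *\<^sub>v b)"
proof -
  define bi where "bi = lp_norm \<infinity> (diag_powr M (-1) *\<^sub>v b)"
  have bi: "\<bar>b $ i\<bar> / M $$ (i,i) \<le> bi" if "i < n" for i
    using abs_nth_le_lp_norm[of \<infinity> i "diag_powr M (-1) *\<^sub>v b"] that diag_pos[OF that] M b
    unfolding bi_def
    by (simp add: diag_powr_mult_vec[OF M b] abs_mult powr_minus divide_inverse mult.commute
        mult_mat_vec_carrier[of _ n n] carrier_matD[OF diag_powr_carrier[OF M]] del: index_mult_mat_vec)
  have "lp_norm p (scaled_term b 0) \<le>
      real (norm0 (scaled_term b 0)) * (d_max M powr real_of_ereal (1/p) * bi)"
  proof (rule lp_norm_le)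
    fix i assume "i < dim_vec (scaled_term b 0)"
    then have i: "i < n" by (simp add: scaled_term_def)
    have "\<bar>scaled_term b 0 $ i\<bar> = M $$ (i,i) powr real_of_ereal (1/p) * (\<bar>b $ i\<bar> / M $$ (i,i))"
      using i diag_pos[OF i] by (simp add: scaled_term_def x_term_0 abs_mult)
    also have "\<dots> \<le> d_max M powr real_of_ereal (1/p) * bi"
      using i bi[OF i] diag_pos[OF i] diag_le_d_max[OF i] conjugate_exponents[OF pq]
      by (intro mult_mono powr_mono2) auto
    finally show "\<bar>scaled_term b 0 $ i\<bar> \<le> d_max M powr real_of_ereal (1/p) * bi" .
  qed (use n pq in \<open>auto simp: scaled_term_def\<close>)
  also have "norm0 (scaled_term b 0) = norm0 b"
  proof -
    have "(scaled_term b 0 $ i \<noteq> 0) = (b $ i \<noteq> 0)" if "i < n" for i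
      using that diag_pos[OF that] by (auto simp: scaled_term_def x_term_0)
    moreover have "dim_vec (scaled_term b 0) = n" "dim_vec b = n" using b by (auto simp: scaled_term_def)
    ultimately have "{i. i < dim_vec (scaled_term b 0) \<and> scaled_term b 0 $ i \<noteq> 0} = {i. i < dim_vec b \<and> b $ i \<noteq> 0}"
      by auto
    then show ?thesis by (simp only: norm0_def)
  qed
  finally show ?thesis by (simp add: bi_def mult.commute mult.left_commute)
qed

text \<open>Every summand is split as t x = d^(1/q) (t / d) (d^(1/p) x), where d is the diagonal
  entry. The power of \<open>d_max\<close> that remains here and the one in
  \<open>scaled_term_0_norm_le\<close> multiply to \<open>d_max\<close>.\<close>

lemma inner_scaled_term_le:
  assumes t: "t \<in> carrier_vec n" and n: "0 < n"
  shows "\<bar>\<Sum>i<n. t $ i * x_term M b l i\<bar> \<le>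
    d_max M powr real_of_ereal (1/q) * real (norm0 t) * lp_norm \<infinity> (diag_powr M (-1) *\<^sub>v t)
      * lp_norm p (scaled_term b l)"
proof -
  define ti where "ti = lp_norm \<infinity> (diag_powr M (-1) *\<^sub>v t)"
  define A where "A = {i. i < n \<and> t $ i \<noteq> 0}"
  have ti: "\<bar>t $ i\<bar> / M $$ (i,i) \<le> ti" if "i < n" for i
    using abs_nth_le_lp_norm[of \<infinity> i "diag_powr M (-1) *\<^sub>v t"] that diag_pos[OF that] M t
    unfolding ti_def
    by (simp add: diag_powr_mult_vec[OF M t] abs_mult powr_minus divide_inverse mult.commute
        mult_mat_vec_carrier[of _ n n] carrier_matD[OF diag_powr_carrier[OF M]] del: index_mult_mat_vec)
  have bnd: "\<bar>t $ i * x_term M b l i\<bar> \<le> d_max M powr real_of_ereal (1/q) * ti * lp_norm p (scaled_term b l)"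
    if i: "i < n" for i
  proof -
    have "M $$ (i,i) powr real_of_ereal (1/q) * M $$ (i,i) powr real_of_ereal (1/p) = M $$ (i,i)"
      using conjugate_exponents[OF pq] diag_pos[OF i] by (simp add: powr_add[symmetric] add.commute)
    then have "\<bar>t $ i * x_term M b l i\<bar> =
        M $$ (i,i) powr real_of_ereal (1/q) * (\<bar>t $ i\<bar> / M $$ (i,i)) * \<bar>scaled_term b l $ i\<bar>"
      using i diag_pos[OF i] by (simp add: scaled_term_def abs_mult field_simps)
    also have "\<dots> \<le> d_max M powr real_of_ereal (1/q) * ti * lp_norm p (scaled_term b l)"
      using i ti[OF i] diag_pos[OF i] diag_le_d_max[OF i] conjugate_exponents[OF pq] pq
        order_trans[OF _ ti[OF i]]
      by (intro mult_mono powr_mono2 abs_nth_le_lp_norm mult_nonneg_nonneg) (auto simp: scaled_term_def)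
    finally show ?thesis .
  qed
  have "\<bar>\<Sum>i<n. t $ i * x_term M b l i\<bar> = \<bar>\<Sum>i\<in>A. t $ i * x_term M b l i\<bar>"
    by (intro arg_cong[where f = abs] sum.mono_neutral_right) (auto simp: A_def)
  also have "\<dots> \<le> (\<Sum>i\<in>A. \<bar>t $ i * x_term M b l i\<bar>)" by (rule sum_abs)
  also have "\<dots> \<le> (\<Sum>i\<in>A. d_max M powr real_of_ereal (1/q) * ti * lp_norm p (scaled_term b l))"
    using bnd by (intro sum_mono) (auto simp: A_def)
  also have "\<dots> = real (norm0 t) * (d_max M powr real_of_ereal (1/q) * ti * lp_norm p (scaled_term b l))"
    using t by (simp add: A_def norm0_def)
  finally show ?thesis by (simp add: ti_def mult_ac)
qed

end

text \<open>No Hoelder inequality is needed: estimating one factor in the 1-norm and the other in the maximum norm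
  loses nothing compared with the product of support sizes in the bound.\<close>

lemma gamma_bound:
  assumes M: "M \<in> carrier_mat n n" and pos: "\<And>i. i < n \<Longrightarrow> 0 < M $$ (i,i)"
    and b: "b \<in> mat_range M" "b \<noteq> 0\<^sub>v n" and t: "t \<in> carrier_vec n"
    and g: "0 < \<gamma>" "\<gamma> \<le> gamma_max M"
  shows "\<gamma> \<le> 1" "\<bar>\<Sum>i<n. t $ i * x_term M b l i\<bar> \<le> (1 - \<gamma>) ^ l *
    (d_max M * real (norm0 t) * lp_norm \<infinity> (diag_powr M (-1) *\<^sub>v t)
      * real (norm0 b) * lp_norm \<infinity> (diag_powr M (-1) *\<^sub>v b))" (is "?lhs \<le> _ * ?B")
proof -
  have bc: "b \<in> carrier_vec n" using b(1) M by (auto simp: mat_range_def)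
  have n: "0 < n" using b(2) bc by (cases n) auto
  have dim: "dim_row M = n" using M by auto
  define \<rho> where "\<rho> p q = restricted_norm p ((1/2) \<cdot>\<^sub>m (1\<^sub>m n + scaled_A M p q))
      (mat_range (1\<^sub>m n - scaled_A M p q))" for p q
  have nn: "0 \<le> \<rho> p q" if "1 \<le> p" "1 \<le> q" "1/p + 1/q = 1" for p q
    unfolding \<rho>_def by (rule scaled_term_norm_le(1)[OF M pos that b])
  define G where "G = {1 - \<rho> p q | p q. 1 \<le> p \<and> 1 \<le> q \<and> 1/p + 1/q = 1}"
  have gm: "gamma_max M = Sup G" by (simp add: gamma_max_def G_def \<rho>_def dim)
  have bdd: "bdd_above G" unfolding G_def using nn by (intro bdd_aboveI[of _ 1]) auto
  have "(1::ereal) \<le> 1 \<and> (1::ereal) \<le> \<infinity> \<and> 1/1 + 1/(\<infinity>::ereal) = 1" by (simp add: one_ereal_def)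
  then have ne: "G \<noteq> {}" unfolding G_def by blast
  have "Sup G \<le> 1" using ne nn by (intro cSup_least) (auto simp: G_def)
  then show g1: "\<gamma> \<le> 1" using g gm by simp
  \<comment> \<open>Attainment of the supremum is avoided: every g' < \<gamma> is beaten by some
    pair \<open>p\<close>, \<open>q\<close>, and g' tends to \<gamma> from the left at the
    end.\<close>
  have *: "?lhs \<le> (1 - g') ^ l * ?B" if g': "g' < \<gamma>" for g'
  proof -
    obtain p q where pq: "1 \<le> p" "1 \<le> q" "1/p + 1/q = 1" and less: "g' < 1 - \<rho> p q"
      using g' g gm less_cSup_iff[OF ne bdd, of g'] unfolding G_def by auto
    have r: "0 \<le> \<rho> p q" "\<rho> p q ^ l \<le> (1 - g') ^ l" using nn[OF pq] less by (auto intro: power_mono)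
    define st where "st = scaled_term M n p b"
    let ?t = "real (norm0 t) * lp_norm \<infinity> (diag_powr M (-1) *\<^sub>v t)"
    let ?b = "real (norm0 b) * lp_norm \<infinity> (diag_powr M (-1) *\<^sub>v b)"
    have nn': "0 \<le> ?t" "0 \<le> ?b"
      using n M bc t by (auto intro!: mult_nonneg_nonneg lp_norm_nonneg simp: carrier_matD[OF diag_powr_carrier[OF M]])
    have stn: "0 \<le> lp_norm p (st 0)" "0 \<le> lp_norm p (st l)"
      unfolding st_def using n pq by (auto intro!: lp_norm_nonneg simp: scaled_term_def[OF M pos pq])
    have d: "d_max M powr real_of_ereal (1/q) * d_max M powr real_of_ereal (1/p) = d_max M"
      using conjugate_exponents[OF pq] pos[OF n] diag_le_d_max[OF M pos pq n]
      by (simp add: powr_add[symmetric] add.commute)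
    have "?lhs \<le> d_max M powr real_of_ereal (1/q) * ?t * lp_norm p (st l)"
      using inner_scaled_term_le[OF M pos pq t n] by (simp add: st_def mult_ac)
    also have "lp_norm p (st l) \<le> \<rho> p q ^ l * lp_norm p (st 0)"
      unfolding st_def \<rho>_def by (rule scaled_term_norm_le(2)[OF M pos pq b])
    also have "\<dots> \<le> (1 - g') ^ l * (d_max M powr real_of_ereal (1/p) * ?b)"
      using r stn scaled_term_0_norm_le[OF M pos pq bc n] less
      by (intro mult_mono) (auto simp: st_def mult_ac)
    finally have "?lhs \<le> d_max M powr real_of_ereal (1/q) * ?t *
        ((1 - g') ^ l * (d_max M powr real_of_ereal (1/p) * ?b))"
      using nn' by (simp add: mult_left_mono)
    also have "\<dots> = (1 - g') ^ l *
        ((d_max M powr real_of_ereal (1/q) * d_max M powr real_of_ereal (1/p)) * ?t * ?b)"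
      by (simp add: mult_ac)
    finally show ?thesis unfolding d by (simp add: mult_ac)
  qed
  have "((\<lambda>g'. (1 - g') ^ l * ?B) \<longlongrightarrow> (1 - \<gamma>) ^ l * ?B) (at_left \<gamma>)"
    by (intro tendsto_intros)
  then show "?lhs \<le> (1 - \<gamma>) ^ l * ?B"
    by (rule tendsto_lowerbound)
      (use * in \<open>auto simp: eventually_at_filter intro!: always_eventually trivial_limit_at_left_real\<close>)
qed

lemma lp_norm_1: "lp_norm 1 x = (\<Sum>i<dim_vec x. \<bar>x $ i\<bar>)"
  by (simp add: lp_norm_def one_ereal_def sum_nonneg)

section \<open>The system, its target value and the truncation of the series\<close>

locale rcddz_system =
  fixes n :: nat and M :: "real mat" and b t :: "real Matrix.vec" and \<gamma> :: real
  assumes M: "M \<in> carrier_mat n n" and rcddz: "RCDDZ M"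
    and b: "b \<in> carrier_vec n" and t: "t \<in> carrier_vec n"
    and b_range: "b \<in> mat_range M" and b_nz: "b \<noteq> 0\<^sub>v n" and t_nz: "t \<noteq> 0\<^sub>v n"
    and b_nonneg: "\<And>i. i < n \<Longrightarrow> 0 \<le> b $ i" and t_nonneg: "\<And>i. i < n \<Longrightarrow> 0 \<le> t $ i"
    and \<gamma>_pos: "0 < \<gamma>" and \<gamma>_le: "\<gamma> \<le> gamma_max M"
begin

definition d :: "nat \<Rightarrow> real" where "d i = M $$ (i,i)"

abbreviation W :: "nat \<Rightarrow> nat \<Rightarrow> real" where "W \<equiv> lazy_walk M"

text \<open>The \<beta> of the overview; by \<open>log_arg_of_eq\<close> the argument of the
  logarithm is bt / (\<gamma> E).\<close>

definition bt :: real where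
  "bt = d_max M * real (norm0 t) * lp_norm \<infinity> (diag_powr M (-1) *\<^sub>v t)
      * real (norm0 b) * lp_norm \<infinity> (diag_powr M (-1) *\<^sub>v b)"

definition target :: real where "target = scalar_prod t (x_star M b)"

definition truncated :: "nat \<Rightarrow> real" where
  "truncated L = 1/2 * (\<Sum>v<n. t $ v * walk_sum n W (\<lambda>i. b $ i / d i) L v)"

lemma dim_M: "dim_row M = n" using M by auto

lemma d_pos: "i < n \<Longrightarrow> 0 < d i"
  using RCDDZ_diag_pos[OF rcddz] by (simp add: dim_M d_def)

lemma W_nonneg: "i < n \<Longrightarrow> j < n \<Longrightarrow> 0 \<le> W i j"
  using lazy_walk_nonneg[OF rcddz] by (simp add: dim_M)

lemma W_row: "i < n \<Longrightarrow> (\<Sum>j<n. W i j) \<le> 1"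
  using lazy_walk_row_sum[OF rcddz] by (simp add: dim_M)

lemma W_col: "j < n \<Longrightarrow> (\<Sum>i<n. W i j * d i) \<le> d j"
  using lazy_walk_col_sum[OF rcddz] by (simp add: dim_M d_def)

lemma n_pos: "0 < n"
  using b b_nz by (cases n) auto

lemma norm1_t: "lp_norm 1 t = (\<Sum>v<n. t $ v)"
  using t t_nonneg by (auto simp: lp_norm_1 intro!: sum.cong)

lemma norm1_b: "lp_norm 1 b = (\<Sum>v<n. b $ v)"
  using b b_nonneg by (auto simp: lp_norm_1 intro!: sum.cong)

lemma ex_nonzero:
  assumes "x \<in> carrier_vec n" "x \<noteq> 0\<^sub>v n"
  shows "\<exists>i<n. x $ i \<noteq> (0::real)"
  using assms by (metis carrier_vecD eq_vecI index_zero_vec)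

lemma norm1_t_pos: "0 < lp_norm 1 t"
proof -
  obtain i where "i < n" "t $ i \<noteq> 0" using ex_nonzero[OF t t_nz] by blast
  then show ?thesis using t_nonneg[of i] t abs_nth_le_lp_norm[of 1 i t] by simp
qed

lemma norm1_b_pos: "0 < lp_norm 1 b"
proof -
  obtain i where "i < n" "b $ i \<noteq> 0" using ex_nonzero[OF b b_nz] by blast
  then show ?thesis using b_nonneg[of i] b abs_nth_le_lp_norm[of 1 i b] by simp
qed

lemma norm0_pos:
  assumes "x \<in> carrier_vec n" "x \<noteq> 0\<^sub>v n"
  shows "1 \<le> norm0 x"
proof -
  obtain i where "i < n" "x $ i \<noteq> 0" using ex_nonzero[OF assms] by blast
  then have "{i. i < dim_vec x \<and> x $ i \<noteq> 0} \<noteq> {}" using assms(1) by auto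
  then show ?thesis by (simp add: norm0_def Suc_le_eq card_gt_0_iff)
qed

lemma \<gamma>_le_1: "\<gamma> \<le> 1"
  using gamma_bound(1)[OF M _ b_range b_nz t \<gamma>_pos \<gamma>_le] d_pos by (simp add: d_def)

lemma x_term_eq: "x_term M b l = (kernel_apply n W ^^ l) (\<lambda>i. b $ i / d i)"
  by (simp add: x_term_def dim_M d_def)

lemma x_term_nonneg: "i < n \<Longrightarrow> 0 \<le> x_term M b l i"
  unfolding x_term_eq using W_nonneg b_nonneg d_pos
  by (intro kernel_powers_nonneg divide_nonneg_pos) auto

lemma inner_x_term_nonneg: "0 \<le> (\<Sum>i<n. t $ i * x_term M b l i)"
  using t_nonneg x_term_nonneg by (intro sum_nonneg mult_nonneg_nonneg) auto

lemma inner_x_term_le: "(\<Sum>i<n. t $ i * x_term M b l i) \<le> bt * (1 - \<gamma>) ^ l"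
  using gamma_bound(2)[OF M _ b_range b_nz t \<gamma>_pos \<gamma>_le, of l] d_pos
  by (simp add: bt_def d_def mult_ac)

text \<open>\<open>gamma_bound\<close> admits any test vector in place of \<open>t\<close>; the unit
  vector at \<open>i\<close> turns it into geometric decay of one coordinate.\<close>

lemma summable_x_term:
  assumes "i < n"
  shows "summable (\<lambda>l. x_term M b l i)"
proof -
  define e :: "real Matrix.vec" where "e = unit_vec n i"
  have e: "e \<in> carrier_vec n" by (simp add: e_def)
  define K where "K = d_max M * real (norm0 e) * lp_norm \<infinity> (diag_powr M (-1) *\<^sub>v e)
      * real (norm0 b) * lp_norm \<infinity> (diag_powr M (-1) *\<^sub>v b)"
  have le: "x_term M b l i \<le> K * (1 - \<gamma>) ^ l" for l
  proof -
    have "(\<Sum>j<n. e $ j * x_term M b l j) = (\<Sum>j<n. if j = i then x_term M b l j else 0)"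
      by (intro sum.cong) (auto simp: e_def unit_vec_def)
    then show ?thesis
      using gamma_bound(2)[OF M _ b_range b_nz e \<gamma>_pos \<gamma>_le, of l] d_pos assms
      by (simp add: K_def d_def mult_ac)
  qed
  have "summable (\<lambda>l. K * (1 - \<gamma>) ^ l)"
    using \<gamma>_pos \<gamma>_le_1 by (intro summable_mult summable_geometric) auto
  then show ?thesis
  proof (rule summable_comparison_test'[where N = 0])
    show "norm (x_term M b l i) \<le> K * (1 - \<gamma>) ^ l" for l
      using le[of l] x_term_nonneg[OF assms, of l] by simp
  qed
qed

lemma target_sums: "(\<lambda>l. 1/2 * (\<Sum>i<n. t $ i * x_term M b l i)) sums target"
proof -
  have "(\<lambda>l. 1/2 * (\<Sum>i<n. t $ i * x_term M b l i)) sums (1/2 * (\<Sum>i<n. t $ i * (\<Sum>l. x_term M b l i)))"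
    by (intro sums_mult sums_sum summable_sums summable_x_term) auto
  moreover have "target = (\<Sum>i<n. t $ i * (1/2 * (\<Sum>l. x_term M b l i)))"
  proof -
    have "dim_vec (x_star M b) = n" by (simp add: x_star_def dim_M Let_def)
    then show ?thesis
      unfolding target_def scalar_prod_def atLeast0LessThan
      using x_star_nth[OF M b] d_pos by (intro sum.cong) (auto simp: d_def)
  qed
  ultimately show ?thesis by (simp add: sum_distrib_left mult_ac)
qed

lemma truncated_eq: "truncated L = (\<Sum>l<L. 1/2 * (\<Sum>i<n. t $ i * x_term M b l i))"
  unfolding truncated_def walk_sum_eq_sum_powers sum_distrib_left x_term_eq by (rule sum.swap)

lemma truncated_le_target: "truncated L \<le> target"
  unfolding truncated_eq sums_unique[OF target_sums]
  using sums_summable[OF target_sums] inner_x_term_nonneg by (intro sum_le_suminf) auto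

lemma bt_nonneg: "0 \<le> bt"
  using inner_x_term_le[of 0] inner_x_term_nonneg[of 0] by simp

lemma tail_le: "target - truncated L \<le> bt * (1 - \<gamma>) ^ L / (2 * \<gamma>)"
proof -
  let ?f = "\<lambda>l. 1/2 * (\<Sum>i<n. t $ i * x_term M b l i)"
  have f: "(\<lambda>l. ?f (l + L)) sums (target - truncated L)"
    unfolding truncated_eq by (rule sums_split_initial_segment[OF target_sums])
  have g: "(\<lambda>l. bt * (1 - \<gamma>) ^ L / 2 * (1 - \<gamma>) ^ l) sums (bt * (1 - \<gamma>) ^ L / 2 * (1 / (1 - (1 - \<gamma>))))"
    using \<gamma>_pos \<gamma>_le_1 by (intro sums_mult geometric_sums) auto
  have "?f (l + L) \<le> bt * (1 - \<gamma>) ^ L / 2 * (1 - \<gamma>) ^ l" for l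
    using inner_x_term_le[of "l + L"] by (simp add: power_add mult_ac)
  then have "target - truncated L \<le> bt * (1 - \<gamma>) ^ L / 2 * (1 / (1 - (1 - \<gamma>)))"
    by (rule sums_le[OF _ f g])
  then show ?thesis by (simp add: mult.commute)
qed

text \<open>The tail bound with no terms summed. It is what makes the argument of the logarithm at
  least 2 in \<open>log_arg_of_ge_2\<close>.\<close>

lemma target_le: "target \<le> bt / (2 * \<gamma>)"
  using tail_le[of 0] by (simp add: truncated_eq)

text \<open>\<open>\<Lambda>\<close> is any upper bound for the argument of the logarithm, as the
  program knows only such bounds. Then (1 - \<gamma>)^L \<le> exp (- \<gamma> L) \<le> 1 /
  \<Lambda>, and the factor 1/2 of the series leaves half of \<open>E\<close> to the sampling
  error.\<close>

lemma tail_small: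
  assumes "0 < E" "bt / (\<gamma> * E) \<le> \<Lambda>" "0 < \<Lambda>" "ln \<Lambda> / \<gamma> \<le> real L"
  shows "target - truncated L \<le> E / 2"
proof -
  have "(1 - \<gamma>) ^ L \<le> exp (- \<gamma>) ^ L"
    using \<gamma>_le_1 exp_ge_add_one_self[of "- \<gamma>"] by (intro power_mono) auto
  also have "\<dots> = exp (- (\<gamma> * real L))" by (simp add: exp_of_nat_mult[symmetric] mult.commute)
  also have "\<dots> \<le> exp (- ln \<Lambda>)" using assms(4) \<gamma>_pos by (simp add: field_simps)
  also have "\<dots> = 1 / \<Lambda>" using assms(3) by (simp add: exp_minus divide_inverse)
  finally have "bt * (1 - \<gamma>) ^ L / (2 * \<gamma>) \<le> bt * (1 / \<Lambda>) / (2 * \<gamma>)"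
    using bt_nonneg \<gamma>_pos by (intro divide_right_mono mult_left_mono) auto
  also have "\<dots> \<le> E / 2"
    using assms \<gamma>_pos by (simp add: field_simps)
  finally show ?thesis using tail_le[of L] by linarith
qed

text \<open>Each entry of D^-1 b is at most \<open>lp_norm 1 b / c\<close>, and the kernel does not
  raise the maximum. It is read backwards in \<open>length_le_time\<close>: a target of at least
  \<eta> forces large norms of \<open>t\<close> and \<open>b\<close>.\<close>

lemma truncated_le:
  assumes "0 < c" "\<And>i. i < n \<Longrightarrow> c \<le> d i"
  shows "truncated L \<le> 1/2 * real L * lp_norm 1 t * lp_norm 1 b / c"
proof -
  have bd: "b $ i / d i \<le> lp_norm 1 b / c" if "i < n" for i
    using assms that b_nonneg abs_nth_le_lp_norm[of 1 i b] b norm1_b_pos by (intro frac_le) auto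
  have ws: "walk_sum n W (\<lambda>i. b $ i / d i) L v \<le> real L * (lp_norm 1 b / c)" if "v < n" for v
    using that bd norm1_b_pos assms(1) W_nonneg W_row by (intro walk_sum_le) auto
  have "(\<Sum>v<n. t $ v * walk_sum n W (\<lambda>i. b $ i / d i) L v) \<le> (\<Sum>v<n. t $ v * (real L * (lp_norm 1 b / c)))"
    using ws t_nonneg by (intro sum_mono mult_left_mono) auto
  also have "\<dots> = lp_norm 1 t * (real L * (lp_norm 1 b / c))"
    unfolding norm1_t by (simp only: sum_distrib_right)
  finally show ?thesis unfolding truncated_def by (simp add: mult_ac)
qed

end

section \<open>Loading the instance\<close>

text \<open>Memory layout. Natural arrays: 3 support of \<open>b\<close>, 4 current column, 5 and 6 vertices and levels on the
  stack, 7 stack pointer, 8 column counter, 9 \<open>L\<close>, 10 level, 11 vertex, 12 number of samples, 13 position of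
  the walk plus one, 14 remaining steps, 15 a dummy written by \<open>block []\<close>. Real arrays: 0 parameters, 1 output, 2 residues (\<open>R\<^sub>l(v)\<close> in
  cell \<open>l n + v\<close>), 3 and 4 values for the lists, 5 \<open>\<theta>\<close>, 6 \<open>\<parallel>b\<parallel>\<^sub>1\<close>, 7 pushed residue, 8 targeted number of
  samples, 9 diagonal entry, 10 entry of \<open>t\<close>, 11 sum of the samples, 12 real length bound.\<close>

abbreviation nv :: "nat \<Rightarrow> nexp" where "nv a \<equiv> NGet a (NConst 0)"
abbreviation rv :: "nat \<Rightarrow> rexp" where "rv a \<equiv> RGet a (NConst 0)"
abbreviation setn :: "nat \<Rightarrow> nexp \<Rightarrow> com" where "setn a e \<equiv> SetN a (NConst 0) e"
abbreviation setr :: "nat \<Rightarrow> rexp \<Rightarrow> com" where "setr a e \<equiv> SetR a (NConst 0) e"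
abbreviation succ :: "nexp \<Rightarrow> nexp" where "succ e \<equiv> NAdd e (NConst 1)"
abbreviation par :: "nat \<Rightarrow> rexp" where "par i \<equiv> RGet 0 (NConst i)"

fun block :: "com list \<Rightarrow> com" where
  "block [] = setn 15 (NConst 0)"
| "block [c] = c"
| "block (c # d # cs) = Seq c (block (d # cs))"

definition load_body :: com where
  "load_body = block
    [GetDiag 9 (NConst 0) (NGet 3 (succ (nv 7))),
     SetR 2 (NGet 3 (succ (nv 7))) (RDiv (RGet 3 (succ (nv 7))) (rv 9)),
     setr 6 (RAdd (rv 6) (RGet 3 (succ (nv 7)))),
     SetN 5 (nv 7) (NGet 3 (succ (nv 7))),
     setn 7 (succ (nv 7))]"

definition load_b :: com where
  "load_b = Seq (ScanB 3) (While (NLess (nv 7) (nv 3)) load_body)"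

text \<open>The new state is an explicit record update, so that the simplifier can evaluate the next
  expression in it. The following rules have the same purpose.\<close>

lemma exec_SetN_Seq:
  assumes "triple I d (s\<lparr>nmem := (nmem s)(a := (nmem s a)(nval s i := nval s e)),
    clock := clock s + (1 + ncost i + ncost e)\<rparr>) \<Phi> F g"
  shows "triple I (Seq (SetN a i e) d) s \<Phi> F g"
  by (rule triple_Seq_det[OF step.simps(2)]) (use assms in \<open>simp add: tick_def put_n_def\<close>)

lemma exec_SetR_Seq:
  assumes "triple I d (s\<lparr>rmem := (rmem s)(a := (rmem s a)(nval s i := rval s e)),
    clock := clock s + (1 + ncost i + rcost e)\<rparr>) \<Phi> F g"
  shows "triple I (Seq (SetR a i e) d) s \<Phi> F g"
  by (rule triple_Seq_det[OF step.simps(3)]) (use assms in \<open>simp add: tick_def put_r_def\<close>)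

lemma exec_GetDiag_Seq:
  assumes "triple I d (s\<lparr>rmem := (rmem s)(a := (rmem s a)(nval s i :=
      (if nval s e < dim_row (sysM I) then sysM I $$ (nval s e, nval s e) else 0))),
    clock := clock s + (1 + ncost i + ncost e)\<rparr>) \<Phi> F g"
  shows "triple I (Seq (GetDiag a i e) d) s \<Phi> F g"
  by (rule triple_Seq_det[OF step.simps(8)]) (use assms in \<open>simp add: tick_def put_r_def\<close>)

lemma exec_GetT_Seq:
  assumes "triple I d (s\<lparr>rmem := (rmem s)(a := (rmem s a)(nval s i :=
      (if nval s e < dim_vec (syst I) then syst I $ nval s e else 0))),
    clock := clock s + (1 + ncost i + ncost e)\<rparr>) \<Phi> F g"
  shows "triple I (Seq (GetT a i e) d) s \<Phi> F g"
  by (rule triple_Seq_det[OF step.simps(10)]) (use assms in \<open>simp add: tick_def put_r_def\<close>)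

lemma exec_ReadCol_Seq:
  assumes "triple I d (tick (1 + ncost e + length (col_list I (nval s e)))
    (put_list a (col_list I (nval s e)) s)) \<Phi> F g"
  shows "triple I (Seq (ReadCol a e) d) s \<Phi> F g"
  by (rule triple_Seq_det[OF step.simps(12) assms])

lemma exec_ScanB_Seq:
  assumes "triple I d (tick (1 + length (b_list I)) (put_list a (b_list I) s)) \<Phi> F g"
  shows "triple I (Seq (ScanB a) d) s \<Phi> F g"
  by (rule triple_Seq_det[OF step.simps(13) assms])

lemma exec_SetN:
  assumes "\<Phi> (s\<lparr>nmem := (nmem s)(a := (nmem s a)(nval s i := nval s e)),
      clock := clock s + (1 + ncost i + ncost e)\<rparr>)"
    "F (s\<lparr>nmem := (nmem s)(a := (nmem s a)(nval s i := nval s e)),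
      clock := clock s + (1 + ncost i + ncost e)\<rparr>) \<le> g"
  shows "triple I (SetN a i e) s \<Phi> F g"
  by (rule triple_step_det[OF step.simps(2)]) (use assms in \<open>simp_all add: tick_def put_n_def\<close>)

lemma exec_SetR:
  assumes "\<Phi> (s\<lparr>rmem := (rmem s)(a := (rmem s a)(nval s i := rval s e)),
      clock := clock s + (1 + ncost i + rcost e)\<rparr>)"
    "F (s\<lparr>rmem := (rmem s)(a := (rmem s a)(nval s i := rval s e)),
      clock := clock s + (1 + ncost i + rcost e)\<rparr>) \<le> g"
  shows "triple I (SetR a i e) s \<Phi> F g"
  by (rule triple_step_det[OF step.simps(3)]) (use assms in \<open>simp_all add: tick_def put_r_def\<close>)

lemmas exec_seq = exec_SetN_Seq exec_SetR_Seq exec_GetDiag_Seq exec_GetT_Seq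

lemma tick_eq: "tick k s = s\<lparr>clock := clock s + k\<rparr>"
  by (simp add: tick_def)

lemma tick_sel [simp]:
  "nmem (tick k s) = nmem s" "rmem (tick k s) = rmem s" "clock (tick k s) = clock s + k"
  by (simp_all add: tick_def)

lemma put_list_sel [simp]:
  "rmem (put_list a xs s) = (rmem s)(a := (\<lambda>k. if 1 \<le> k \<and> k \<le> length xs then snd (xs ! (k - 1)) else rmem s a k))"
  "nmem (put_list a xs s) = (nmem s)(a := (\<lambda>k. if k = 0 then length xs
                                else if k \<le> length xs then fst (xs ! (k - 1)) else nmem s a k))"
  "clock (put_list a xs s) = clock s"
  by (simp_all add: put_list_def)

locale rcddz_instance = rcddz_system +
  fixes I :: problem and c :: real
  assumes wf: "well_formed n I" and sys: "sysM I = M" "sysb I = b" "syst I = t"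
    and c_pos: "0 < c" and entries: "\<And>x. x \<in> elements_mat M \<Longrightarrow> x \<noteq> 0 \<Longrightarrow> c \<le> \<bar>x\<bar>"
begin

lemma dims: "dim_row M = n" "dim_col M = n" "dim_vec b = n" "dim_vec t = n"
  using M b t by auto

lemma b_nz_list: "distinct (b_nz I)" "set (b_nz I) = {i. i < n \<and> b $ i \<noteq> 0}"
  using wf by (auto simp: well_formed_def sys)

lemma length_b_nz: "length (b_nz I) = norm0 b"
  using distinct_card[OF b_nz_list(1)] b by (simp add: b_nz_list(2) norm0_def)

lemma col_nz:
  assumes "v < n"
  shows "distinct (col_nz I v)" "set (col_nz I v) = {i. i < n \<and> M $$ (i,v) \<noteq> 0}"
  using wf assms by (auto simp: well_formed_def sys)

text \<open>The stack pointer doubles as loop counter, since a support vertex goes on the stack as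
  soon as it is loaded. Array 6 keeps its initial zeros, which are the right levels, and at level 0
  the residue of \<open>v\<close> sits in cell \<open>v\<close> itself.\<close>

definition load_inv :: "(nat \<Rightarrow> real) \<Rightarrow> state \<Rightarrow> bool" where
  "load_inv ps s \<longleftrightarrow>
    nmem s 7 0 \<le> norm0 b \<and> nmem s 0 0 = n \<and> rmem s 0 = ps \<and>
    nmem s 3 0 = norm0 b \<and> (\<forall>k<norm0 b. nmem s 3 (Suc k) = b_nz I ! k \<and> rmem s 3 (Suc k) = b $ (b_nz I ! k)) \<and>
    (\<forall>a. rmem s 2 a = (if a \<in> set (take (nmem s 7 0) (b_nz I)) then b $ a / d a else 0)) \<and>
    rmem s 6 0 = (\<Sum>k<nmem s 7 0. b $ (b_nz I ! k)) \<and>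
    (\<forall>i<nmem s 7 0. nmem s 5 i = b_nz I ! i) \<and> nmem s 6 = (\<lambda>_. 0) \<and>
    nmem s 9 0 = 0 \<and> nmem s 12 0 = 0 \<and> rmem s 1 0 = 0 \<and> rmem s 11 0 = 0 \<and>
    clock s \<le> 20 + norm0 b + 60 * nmem s 7 0"

lemma load_body:
  assumes "load_inv ps s" "bval s (NLess (nv 7) (nv 3))"
  shows "hoare I load_body (tick (1 + bcost (NLess (nv 7) (nv 3))) s)
    (\<lambda>s'. load_inv ps s' \<and> norm0 b - nmem s' 7 0 < norm0 b - nmem s 7 0)"
proof -
  define k where "k = nmem s 7 0"
  have k: "k < norm0 b" using assms by (simp add: load_inv_def k_def)
  define v where "v = b_nz I ! k"
  have "v \<in> set (b_nz I)" using k by (simp add: v_def length_b_nz)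
  then have v: "v < n" by (simp add: b_nz_list)
  have tk: "set (take (Suc k) (b_nz I)) = insert v (set (take k (b_nz I)))"
    using k by (simp add: take_Suc_conv_app_nth length_b_nz v_def)
  have s3: "nmem s 3 (Suc k) = v" "rmem s 3 (Suc k) = b $ v"
    using assms(1) k by (auto simp: load_inv_def v_def)
  show ?thesis
    unfolding load_body_def block.simps tick_eq
    apply ((rule exec_seq, simp add: dims k_def[symmetric] s3 v sys d_def[symmetric])+)
    apply (rule exec_SetN)
    using assms(1) k v tk s3
    apply (auto simp: load_inv_def k_def[symmetric] less_Suc_eq v_def[symmetric])
    done
qed

definition loaded :: "(nat \<Rightarrow> real) \<Rightarrow> state \<Rightarrow> bool" where
  "loaded ps s \<longleftrightarrow> nmem s 7 0 = norm0 b \<and> nmem s 0 0 = n \<and> rmem s 0 = ps \<and>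
    (\<forall>a. rmem s 2 a = (if a < n then b $ a / d a else 0)) \<and> rmem s 6 0 = lp_norm 1 b \<and>
    (\<forall>v<n. b $ v \<noteq> 0 \<longrightarrow> (\<exists>i<norm0 b. nmem s 5 i = v)) \<and> (\<forall>i<norm0 b. nmem s 5 i < n) \<and>
    nmem s 6 = (\<lambda>_. 0) \<and>
    nmem s 9 0 = 0 \<and> nmem s 12 0 = 0 \<and> rmem s 1 0 = 0 \<and> rmem s 11 0 = 0 \<and>
    clock s \<le> 30 + 61 * norm0 b"

lemma load_b:
  assumes "nmem s = (\<lambda>a i. if a = 0 \<and> i = 0 then n else 0)" "rmem s = (\<lambda>a i. if a = 0 then ps i else 0)"
    "clock s \<le> 10"
  shows "hoare I load_b s (loaded ps)"
  unfolding load_b_def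
proof (rule exec_ScanB_Seq, rule hoare_While[where Inv = "load_inv ps" and V = "\<lambda>s. norm0 b - nmem s 7 0"])
  show "load_inv ps (tick (1 + length (b_list I)) (put_list 3 (b_list I) s))"
    using assms by (auto simp: load_inv_def b_list_def length_b_nz sys tick_eq)
next
  fix s assume s: "load_inv ps s" "\<not> bval s (NLess (nv 7) (nv 3))"
  then have k: "nmem s 7 0 = norm0 b" by (simp add: load_inv_def)
  have "(\<Sum>k<norm0 b. b $ (b_nz I ! k)) = sum_list (map (($) b) (b_nz I))"
    by (simp add: sum_list_sum_nth length_b_nz atLeast0LessThan)
  also have "\<dots> = sum (($) b) (set (b_nz I))" using b_nz_list(1) by (rule sum_list_distinct_conv_sum_set)
  also have "\<dots> = lp_norm 1 b"
    unfolding norm1_b b_nz_list by (intro sum.mono_neutral_left) auto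
  finally have norm: "(\<Sum>k<norm0 b. b $ (b_nz I ! k)) = lp_norm 1 b" .
  have ex: "\<exists>i<norm0 b. b_nz I ! i = v" if "v < n" "b $ v \<noteq> 0" for v
    using that b_nz_list(2) by (metis (mono_tags, lifting) in_set_conv_nth length_b_nz mem_Collect_eq)
  have lt: "b_nz I ! i < n" if "i < norm0 b" for i
    using that b_nz_list(2) nth_mem[of i "b_nz I"] by (simp add: length_b_nz)
  have *: "nmem s 5 i = b_nz I ! i" if "i < norm0 b" for i
    using s(1) k that by (simp add: load_inv_def)
  have ex': "\<exists>i<norm0 b. nmem s 5 i = v" if "v < n" "b $ v \<noteq> 0" for v
    using ex[OF that] * by metis
  show "loaded ps (tick (1 + bcost (NLess (nv 7) (nv 3))) s)"
    using s(1) k norm ex' lt *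
    by (auto simp: load_inv_def loaded_def tick_eq length_b_nz b_nz_list(2))
qed (rule load_body)

end

text \<open>The machine has no rounding of reals to naturals, so the first natural number above the
  real bound is found by counting, in time O(L); \<open>length_le_time\<close> pays for
  this.\<close>

definition set_length :: com where
  "set_length = Seq
    (setr 12 (RDiv (RLn (RMul (RMul (RMul (RMul (RMul
        (RDiv (RNat (NConst 1)) (RMul (par 1) (RMul (par 0) (par 2)))) (par 5)) (par 6)) (par 7)) (par 8)) (par 9)))
      (par 1)))
    (While (BNot (RLess (rv 12) (RNat (nv 9)))) (setn 9 (succ (nv 9))))"

text \<open>The threshold solves L B / \<theta> = L^3 \<theta> T f / (\<epsilon>^2 \<eta>), where T
  and B are the 1-norms of \<open>t\<close> and \<open>b\<close> and f is \<open>f_row\<close>: up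
  to constants, pushing costs the left side and sampling the right side. The 32 is explained by
  \<open>chebyshev_estimate\<close>.\<close>

definition set_params :: com where
  "set_params = Seq
    (setr 5 (RDiv (RMul (par 0) (RSqrt (RDiv (RMul (par 2) (rv 6)) (RMul (par 3) (par 4))))) (RNat (nv 9))))
    (setr 8 (RDiv (RMul (RMul (RMul (RNat (NConst 32)) (RMul (RNat (nv 9)) (RNat (nv 9)))) (rv 5)) (par 3))
       (RMul (RMul (par 0) (par 0)) (par 2))))"

lemma set_length:
  fixes s :: state
  defines "x \<equiv> ln (log_arg (rmem s 0 1) (rmem s 0 0 * rmem s 0 2) (rmem s 0 5) (rmem s 0 6) (rmem s 0 7)
    (rmem s 0 8) (rmem s 0 9)) / rmem s 0 1"
  assumes "0 \<le> x" "nmem s 9 0 = 0"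
  shows "hoare I set_length s (\<lambda>s'. nmem s' = (nmem s)(9 := (nmem s 9)(0 := Suc (nat \<lfloor>x\<rfloor>))) \<and>
    rmem s' = (rmem s)(12 := (rmem s 12)(0 := x)) \<and> clock s' \<le> clock s + 70 + 20 * Suc (nat \<lfloor>x\<rfloor>))"
proof -
  define L where "L = Suc (nat \<lfloor>x\<rfloor>)"
  define Inv where "Inv s' \<longleftrightarrow> (\<exists>k\<le>L. nmem s' = (nmem s)(9 := (nmem s 9)(0 := k)) \<and>
    rmem s' = (rmem s)(12 := (rmem s 12)(0 := x)) \<and> clock s' \<le> clock s + 60 + 20 * k)" for s' :: state
  have less: "k < L" if "real k \<le> x" for k
    using that le_nat_floor[of k x] by (simp add: L_def)
  have ge: "L \<le> k" if "x < real k" for k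
    using that assms(2) by (simp add: L_def Suc_le_eq floor_less_iff nat_less_iff)
  have x: "ln (1 / (rmem s 0 1 * (rmem s 0 0 * rmem s 0 2)) * rmem s 0 5 * rmem s 0 6 * rmem s 0 7 *
      rmem s 0 8 * rmem s 0 9) / rmem s 0 1 = x"
    by (simp add: x_def log_arg_def)
  have upd: "(nmem s)(9 := (nmem s 9)(0 := 0)) = nmem s"
    using assms(3) by (auto simp: fun_eq_iff)
  show ?thesis
    unfolding set_length_def
    apply (rule exec_SetR_Seq)
    apply (rule hoare_While[where Inv = Inv and V = "\<lambda>s'. L - nmem s' 9 0"])
    subgoal using x upd by (auto simp: Inv_def intro!: exI[of _ 0])
    subgoal for s' unfolding tick_eq by (rule exec_SetN) (auto simp: Inv_def not_less intro!: diff_less_mono2 Suc_leI exI[of _ "Suc _"] dest: less)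
    subgoal for s' using ge by (auto simp: Inv_def tick_eq L_def[symmetric] dest!: order.antisym)
    done
qed

lemma set_params:
  fixes s :: state
  defines "L \<equiv> real (nmem s 9 0)"
  defines "\<theta> \<equiv> rmem s 0 0 * sqrt (rmem s 0 2 * rmem s 6 0 / (rmem s 0 3 * rmem s 0 4)) / L"
  defines "N \<equiv> 32 * (L * L) * \<theta> * rmem s 0 3 / (rmem s 0 0 * rmem s 0 0 * rmem s 0 2)"
  shows "hoare I set_params s (\<lambda>s'. nmem s' = nmem s \<and> clock s' \<le> clock s + 80 \<and>
    rmem s' = (rmem s)(5 := (rmem s 5)(0 := \<theta>), 8 := (rmem s 8)(0 := N)))"
  unfolding set_params_def
  by (rule exec_SetR_Seq, rule exec_SetR) (simp_all add: N_def \<theta>_def L_def)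

section \<open>The push phase\<close>

text \<open>Every entry of the column goes on the stack, whatever its residue; the threshold is
  tested when it is popped, so duplicates and outdated entries do no harm.\<close>

definition spread_body :: com where
  "spread_body = block
    [setn 8 (succ (nv 8)),
     GetDiag 9 (NConst 0) (NGet 4 (nv 8)),
     SetR 2 (NAdd (NMul (succ (nv 10)) (nv 0)) (NGet 4 (nv 8)))
       (RSub (RGet 2 (NAdd (NMul (succ (nv 10)) (nv 0)) (NGet 4 (nv 8))))
         (RDiv (RMul (rv 7) (RGet 4 (nv 8))) (RMul (RNat (NConst 2)) (rv 9)))),
     SetN 5 (nv 7) (NGet 4 (nv 8)),
     SetN 6 (nv 7) (succ (nv 10)),
     setn 7 (succ (nv 7))]"

text \<open>As W = I - D^-1 M / 2, the identity part is moved to the next level here, and the loop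
  over the column subtracts the rest without singling out the diagonal.\<close>

definition push_prep :: com where
  "push_prep = block
    [SetR 2 (NAdd (NMul (nv 10) (nv 0)) (nv 11)) (RNat (NConst 0)),
     SetR 2 (NAdd (NMul (succ (nv 10)) (nv 0)) (nv 11))
       (RAdd (RGet 2 (NAdd (NMul (succ (nv 10)) (nv 0)) (nv 11))) (rv 7)),
     GetT 10 (NConst 0) (nv 11),
     setr 1 (RAdd (rv 1) (RDiv (RMul (rv 10) (rv 7)) (RNat (NConst 2)))),
     setn 8 (NConst 0)]"

definition push :: com where
  "push = Seq push_prep (Seq (ReadCol 4 (nv 11)) (While (NLess (nv 8) (nv 4)) spread_body))"

definition pop :: com where
  "pop = block
    [setn 7 (NSub (nv 7) (NConst 1)),
     setn 11 (NGet 5 (nv 7)),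
     setn 10 (NGet 6 (nv 7)),
     setr 7 (RGet 2 (NAdd (NMul (nv 10) (nv 0)) (nv 11)))]"

text \<open>Level \<open>L\<close> receives residues, but they are never pushed and have weight \<open>0\<close> in all sums below.\<close>

definition push_loop :: com where
  "push_loop = While (NLess (NConst 0) (nv 7))
    (Seq pop (Cond (BAnd (NLess (nv 10) (nv 9)) (RLess (rv 5) (rv 7))) push (block [])))"

lemma flat_index_inject:
  fixes u v n :: nat
  assumes "u < n" "v < n"
  shows "l * n + u = k * n + v \<longleftrightarrow> l = k \<and> u = v"
proof
  assume eq: "l * n + u = k * n + v"
  have "(l * n + u) div n = l" "(k * n + v) div n = k" using assms by auto
  then show "l = k \<and> u = v" using eq by auto
qed simp

context rcddz_instance
begin

definition res :: "state \<Rightarrow> nat \<Rightarrow> nat \<Rightarrow> real" where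
  "res s l v = rmem s 2 (l * n + v)"

definition same_frame :: "state \<Rightarrow> state \<Rightarrow> bool" where
  "same_frame s0 s \<longleftrightarrow> nmem s 0 = nmem s0 0 \<and> rmem s 0 = rmem s0 0 \<and> nmem s 9 0 = nmem s0 9 0 \<and>
    rmem s 5 0 = rmem s0 5 0 \<and> rmem s 8 0 = rmem s0 8 0 \<and> rmem s 11 0 = rmem s0 11 0 \<and>
    nmem s 12 0 = nmem s0 12 0"

lemma res_cong: "rmem s 2 = rmem s' 2 \<Longrightarrow> res s = res s'"
  by (simp add: res_def fun_eq_iff)

lemma res_tick [simp]: "res (tick k s) = res s"
  by (rule res_cong) simp

lemma same_frame_tick [simp]:
  "same_frame (tick k s) s' \<longleftrightarrow> same_frame s s'" "same_frame s (tick k s') \<longleftrightarrow> same_frame s s'"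
  by (simp_all add: same_frame_def)

lemma same_frame_trans: "same_frame s0 s1 \<Longrightarrow> same_frame s1 s2 \<Longrightarrow> same_frame s0 s2"
  by (simp add: same_frame_def)

definition spread_inv :: "state \<Rightarrow> nat \<Rightarrow> nat \<Rightarrow> real \<Rightarrow> state \<Rightarrow> bool" where
  "spread_inv s0 l v \<rho> s \<longleftrightarrow> (\<exists>k\<le>length (col_nz I v). nmem s 8 0 = k \<and>
    same_frame s0 s \<and> nmem s 0 0 = n \<and> nmem s 10 0 = l \<and> rmem s 7 0 = \<rho> \<and> rmem s 1 0 = rmem s0 1 0 \<and>
    nmem s 4 0 = length (col_nz I v) \<and>
    (\<forall>j<length (col_nz I v). nmem s 4 (Suc j) = col_nz I v ! j \<and> rmem s 4 (Suc j) = M $$ (col_nz I v ! j, v)) \<and>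
    nmem s 7 0 = nmem s0 7 0 + k \<and>
    (\<forall>i<nmem s0 7 0. nmem s 5 i = nmem s0 5 i \<and> nmem s 6 i = nmem s0 6 i) \<and>
    (\<forall>j<k. nmem s 5 (nmem s0 7 0 + j) = col_nz I v ! j \<and> nmem s 6 (nmem s0 7 0 + j) = Suc l) \<and>
    (\<forall>l' u. u < n \<longrightarrow> res s l' u = res s0 l' u -
      (if l' = Suc l \<and> u \<in> set (take k (col_nz I v)) then \<rho> * M $$ (u,v) / (2 * d u) else 0)) \<and>
    clock s0 \<le> clock s \<and> clock s \<le> clock s0 + 100 * k)"

lemma spread_body:
  assumes "spread_inv s0 l v \<rho> s" "bval s (NLess (nv 8) (nv 4))" "v < n"
  shows "hoare I spread_body (tick (1 + bcost (NLess (nv 8) (nv 4))) s)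
    (\<lambda>s'. spread_inv s0 l v \<rho> s' \<and> length (col_nz I v) - nmem s' 8 0 < length (col_nz I v) - nmem s 8 0)"
proof -
  define k where "k = nmem s 8 0"
  have k: "k < length (col_nz I v)" using assms by (auto simp: spread_inv_def k_def)
  define u where "u = col_nz I v ! k"
  have "u \<in> set (col_nz I v)" using k by (simp add: u_def)
  then have u: "u < n" by (simp add: col_nz[OF assms(3)])
  have tk: "set (take (Suc k) (col_nz I v)) = insert u (set (take k (col_nz I v)))"
    using k by (simp add: take_Suc_conv_app_nth u_def)
  \<comment> \<open>The listing has no repetitions, so the residue of \<open>u\<close> at level
    \<open>Suc l\<close> is still the one from before the loop.\<close>
  have nt: "u \<notin> set (take k (col_nz I v))"
    using distinct_take[OF col_nz(1)[OF assms(3)], of "Suc k"] k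
    by (simp add: take_Suc_conv_app_nth u_def)
  have s: "nmem s 4 (Suc k) = u" "rmem s 4 (Suc k) = M $$ (u,v)" "nmem s 0 0 = n" "nmem s 10 0 = l"
    "rmem s 7 0 = \<rho>" "nmem s 7 0 = nmem s0 7 0 + k" "nmem s 4 0 = length (col_nz I v)"
    "rmem s 1 0 = rmem s0 1 0"
    using assms(1) k unfolding spread_inv_def u_def k_def by blast+
  have fr: "same_frame s0 s" "clock s0 \<le> clock s" "clock s \<le> clock s0 + 100 * k"
    using assms(1) unfolding spread_inv_def k_def by blast+
  have old: "\<And>i. i < nmem s0 7 0 \<Longrightarrow> nmem s 5 i = nmem s0 5 i \<and> nmem s 6 i = nmem s0 6 i"
    "\<And>j. j < k \<Longrightarrow> nmem s 5 (nmem s0 7 0 + j) = col_nz I v ! j \<and> nmem s 6 (nmem s0 7 0 + j) = Suc l"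
    "\<And>j. j < length (col_nz I v) \<Longrightarrow> nmem s 4 (Suc j) = col_nz I v ! j \<and> rmem s 4 (Suc j) = M $$ (col_nz I v ! j, v)"
    using assms(1) unfolding spread_inv_def k_def by blast+
  have oldres: "rmem s 2 (l' * n + u') = rmem s0 2 (l' * n + u') -
      (if l' = Suc l \<and> u' \<in> set (take k (col_nz I v)) then \<rho> * M $$ (u',v) / (2 * d u') else 0)"
    if "u' < n" for l' u'
    using assms(1) that unfolding spread_inv_def k_def res_def by blast
  have s0n: "nmem s0 0 0 = n" using fr(1) s(3) by (simp add: same_frame_def)
  \<comment> \<open>\<open>n + l * n + u\<close> is what the simplifier makes of the address of
    \<open>u\<close> at level \<open>Suc l\<close>.\<close>
  have fl: "l' * n + u' = n + l * n + u \<longleftrightarrow> l' = Suc l \<and> u' = u" if "u' < n" for l' u'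
    using flat_index_inject[OF that u, of l' "Suc l"] by simp
  have u': "rmem s 2 (n + l * n + u) = rmem s0 2 (n + l * n + u)"
    using oldres[OF u, of "Suc l"] nt by simp
  show ?thesis
    unfolding spread_body_def block.simps tick_eq
    apply ((rule exec_seq, simp add: dims k_def[symmetric] s u sys d_def[symmetric])+)
    apply (rule exec_SetN)
    subgoal
      apply (intro conjI)
      subgoal
        unfolding spread_inv_def res_def
        apply (intro exI[of _ "Suc k"] conjI allI impI)
        using fr k
        apply (simp_all add: s s(8)[unfolded One_nat_def] s0n old same_frame_def fl tk oldres u' u_def[symmetric] nt)
        apply (auto simp: less_Suc_eq old u_def)
        done
      subgoal using k by (simp add: k_def[symmetric])
      done
    subgoal by simp
    done
qed

definition pushed :: "nat \<Rightarrow> nat \<Rightarrow> real \<Rightarrow> state \<Rightarrow> state \<Rightarrow> bool" where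
  "pushed l v \<rho> s s' \<longleftrightarrow> same_frame s s' \<and> rmem s' 1 0 = rmem s 1 0 + t $ v * \<rho> / 2 \<and>
    nmem s' 7 0 = nmem s 7 0 + length (col_nz I v) \<and>
    (\<forall>i<nmem s 7 0. nmem s' 5 i = nmem s 5 i \<and> nmem s' 6 i = nmem s 6 i) \<and>
    (\<forall>j<length (col_nz I v). nmem s' 5 (nmem s 7 0 + j) = col_nz I v ! j \<and> nmem s' 6 (nmem s 7 0 + j) = Suc l) \<and>
    (\<forall>l' u. u < n \<longrightarrow> res s' l' u = res s l' u - (if l' = l \<and> u = v then \<rho> else 0)
      + (if l' = Suc l then \<rho> * W u v else 0)) \<and>
    clock s \<le> clock s' \<and> clock s' \<le> clock s + 100 + 110 * length (col_nz I v)"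

definition prepared :: "nat \<Rightarrow> nat \<Rightarrow> real \<Rightarrow> state \<Rightarrow> state \<Rightarrow> bool" where
  "prepared l v \<rho> s s' \<longleftrightarrow> same_frame s s' \<and> nmem s' 0 0 = n \<and> nmem s' 10 0 = l \<and> nmem s' 11 0 = v \<and>
    rmem s' 7 0 = \<rho> \<and> nmem s' 8 0 = 0 \<and> rmem s' 1 0 = rmem s 1 0 + t $ v * \<rho> / 2 \<and>
    nmem s' 7 = nmem s 7 \<and> nmem s' 5 = nmem s 5 \<and> nmem s' 6 = nmem s 6 \<and>
    (\<forall>l' u. u < n \<longrightarrow> res s' l' u = res s l' u - (if l' = l \<and> u = v then \<rho> else 0)
      + (if l' = Suc l \<and> u = v then \<rho> else 0)) \<and>
    clock s \<le> clock s' \<and> clock s' \<le> clock s + 80"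

lemma preparedD:
  assumes "prepared l v \<rho> s s'"
  shows "same_frame s s'" "nmem s' 0 0 = n" "nmem s' 10 0 = l" "nmem s' 11 0 = v"
    "rmem s' 7 0 = \<rho>" "nmem s' 8 0 = 0" "rmem s' 1 0 = rmem s 1 0 + t $ v * \<rho> / 2"
    "nmem s' 7 = nmem s 7" "nmem s' 5 = nmem s 5" "nmem s' 6 = nmem s 6"
    "\<And>l' u. u < n \<Longrightarrow> res s' l' u = res s l' u - (if l' = l \<and> u = v then \<rho> else 0)
      + (if l' = Suc l \<and> u = v then \<rho> else 0)"
    "clock s \<le> clock s'" "clock s' \<le> clock s + 80"
  using assms unfolding prepared_def by blast+

lemma pushedD:
  assumes "pushed l v \<rho> s s'"
  shows "same_frame s s'" "rmem s' 1 0 = rmem s 1 0 + t $ v * \<rho> / 2"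
    "nmem s' 7 0 = nmem s 7 0 + length (col_nz I v)"
    "\<And>i. i < nmem s 7 0 \<Longrightarrow> nmem s' 5 i = nmem s 5 i \<and> nmem s' 6 i = nmem s 6 i"
    "\<And>j. j < length (col_nz I v) \<Longrightarrow> nmem s' 5 (nmem s 7 0 + j) = col_nz I v ! j \<and> nmem s' 6 (nmem s 7 0 + j) = Suc l"
    "\<And>l' u. u < n \<Longrightarrow> res s' l' u = res s l' u - (if l' = l \<and> u = v then \<rho> else 0)
      + (if l' = Suc l then \<rho> * W u v else 0)"
    "clock s \<le> clock s'" "clock s' \<le> clock s + 100 + 110 * length (col_nz I v)"
  using assms unfolding pushed_def by blast+

lemma push_prep:
  assumes "nmem s 0 0 = n" "nmem s 10 0 = l" "nmem s 11 0 = v" "rmem s 7 0 = \<rho>" "res s l v = \<rho>" "v < n"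
  shows "hoare I push_prep s (prepared l v \<rho> s)"
proof -
  have fl: "l' * n + u' = n + l * n + v \<longleftrightarrow> l' = Suc l \<and> u' = v"
    "l' * n + u' = l * n + v \<longleftrightarrow> l' = l \<and> u' = v" if "u' < n" for l' u'
    using flat_index_inject[OF that assms(6), of l' "Suc l"] flat_index_inject[OF that assms(6), of l' l] by simp_all
  have ne: "n + l * n + v \<noteq> l * n + v" using n_pos by simp
  have r: "rmem s 2 (l * n + v) = \<rho>" using assms(5) by (simp add: res_def)
  show ?thesis
    unfolding push_prep_def block.simps
    apply ((rule exec_seq, simp add: dims assms(1-4,6) sys gr_implies_not0[OF n_pos])+)
    apply (rule exec_SetN)
    subgoal
      unfolding prepared_def res_def
      apply (intro conjI allI impI)
      apply (simp_all add: assms same_frame_def fl ne r)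
      done
    subgoal by simp
    done
qed

lemma push:
  assumes "nmem s 0 0 = n" "nmem s 10 0 = l" "nmem s 11 0 = v" "rmem s 7 0 = \<rho>" "res s l v = \<rho>" "v < n"
  shows "hoare I push s (pushed l v \<rho> s)"
  unfolding push_def
proof (rule triple_Seq_hoare[OF push_prep[OF assms]], rule exec_ReadCol_Seq)
  fix s1 assume s1: "prepared l v \<rho> s s1"
  define xs where "xs = col_list I (nval s1 (nv 11))"
  define s2 where "s2 = tick (1 + ncost (nv 11) + length xs) (put_list 4 xs s1)"
  have xs: "xs = map (\<lambda>i. (i, M $$ (i,v))) (col_nz I v)"
    using s1 assms(6) by (simp add: xs_def col_list_def sys dims prepared_def)
  have f12: "same_frame s1 s2" by (simp add: s2_def same_frame_def tick_eq)
  have r12: "res s2 = res s1" by (simp add: s2_def res_def tick_eq fun_eq_iff)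
  have i2: "spread_inv s2 l v \<rho> s2"
    unfolding spread_inv_def
    by (intro exI[of _ 0]) (simp add: s2_def xs same_frame_def preparedD[OF s1])
  have "hoare I (While (NLess (nv 8) (nv 4)) spread_body) s2 (pushed l v \<rho> s)"
  proof (rule hoare_While[where Inv = "spread_inv s2 l v \<rho>"
        and V = "\<lambda>s'. length (col_nz I v) - nmem s' 8 0"])
    show "spread_inv s2 l v \<rho> s2" by (rule i2)
  next
    fix s' assume "spread_inv s2 l v \<rho> s'" "bval s' (NLess (nv 8) (nv 4))"
    then show "hoare I spread_body (tick (1 + bcost (NLess (nv 8) (nv 4))) s')
       (\<lambda>s''. spread_inv s2 l v \<rho> s'' \<and>
         length (col_nz I v) - nmem s'' 8 0 < length (col_nz I v) - nmem s' 8 0)"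
      using assms(6) by (rule spread_body)
  next
    fix s' assume s': "spread_inv s2 l v \<rho> s'" "\<not> bval s' (NLess (nv 8) (nv 4))"
    then have k: "nmem s' 8 0 = length (col_nz I v)"
      unfolding spread_inv_def by auto
    have fr: "same_frame s2 s'" "clock s2 \<le> clock s'" "clock s' \<le> clock s2 + 100 * length (col_nz I v)" "rmem s' 1 0 = rmem s2 1 0"
      "nmem s' 7 0 = nmem s2 7 0 + length (col_nz I v)"
      using s'(1) unfolding spread_inv_def k by blast+
    have old: "\<And>i. i < nmem s2 7 0 \<Longrightarrow> nmem s' 5 i = nmem s2 5 i \<and> nmem s' 6 i = nmem s2 6 i"
      "\<And>j. j < length (col_nz I v) \<Longrightarrow> nmem s' 5 (nmem s2 7 0 + j) = col_nz I v ! j \<and> nmem s' 6 (nmem s2 7 0 + j) = Suc l"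
      using s'(1) unfolding spread_inv_def k by blast+
    have oldres: "res s' l' u = res s2 l' u -
        (if l' = Suc l \<and> u \<in> set (col_nz I v) then \<rho> * M $$ (u,v) / (2 * d u) else 0)"
      if "u < n" for l' u
    proof -
      have "res s' l' u = res s2 l' u - (if l' = Suc l \<and> u \<in> set (take (length (col_nz I v)) (col_nz I v))
          then \<rho> * M $$ (u,v) / (2 * d u) else 0)"
        using s'(1) that unfolding spread_inv_def k by blast
      then show ?thesis by simp
    qed
    have newres: "res s' l' u = res s l' u - (if l' = l \<and> u = v then \<rho> else 0)
      + (if l' = Suc l then \<rho> * W u v else 0)" if u: "u < n" for l' u
    proof -
      \<comment> \<open>Outside the listed support the entry of \<open>M\<close> is 0, so the
        restriction can go; together with the identity part from \<open>push_prep\<close>, level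
        \<open>Suc l\<close> gains exactly \<rho> W u v.\<close>
      have "(if l' = Suc l \<and> u \<in> set (col_nz I v) then \<rho> * M $$ (u,v) / (2 * d u) else 0) =
          (if l' = Suc l then \<rho> * M $$ (u,v) / (2 * d u) else 0)"
        using u by (auto simp: col_nz[OF assms(6)])
      moreover have "res s1 l' u = res s l' u - (if l' = l \<and> u = v then \<rho> else 0)
          + (if l' = Suc l \<and> u = v then \<rho> else 0)"
        by (rule preparedD(11)[OF s1 u])
      ultimately show ?thesis
        unfolding oldres[OF u] r12 by (simp add: lazy_walk_def d_def algebra_simps)
    qed
    have fr': "same_frame s s'" using preparedD(1)[OF s1] f12 fr(1) same_frame_trans by blast
    have c2: "clock s2 = clock s1 + 3 + length (col_nz I v)" by (simp add: s2_def xs tick_eq)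
    have m2: "nmem s2 7 = nmem s 7" "nmem s2 5 = nmem s 5" "nmem s2 6 = nmem s 6"
        "rmem s2 1 0 = rmem s 1 0 + t $ v * \<rho> / 2" "clock s1 \<le> clock s + 80" "clock s \<le> clock s1"
      using preparedD[OF s1] by (simp_all add: s2_def xs)
    show "pushed l v \<rho> s (tick (1 + bcost (NLess (nv 8) (nv 4))) s')"
      unfolding pushed_def
      apply (intro conjI allI impI)
      using fr' fr old newres m2 c2 s'(1)
      apply (simp_all del: One_nat_def)
      done
  qed
  then show "hoare I (While (NLess (nv 8) (nv 4)) spread_body)
      (tick (1 + ncost (nv 11) + length (col_list I (nval s1 (nv 11)))) (put_list 4 (col_list I (nval s1 (nv 11))) s1))
      (pushed l v \<rho> s)"
    unfolding s2_def xs_def .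
qed

text \<open>Effect of a push on an arbitrary linear functional of the residues, for use with
  \<open>remaining\<close> and \<open>potential\<close>. The condition l < L keeps level
  \<open>Suc l\<close> inside the sum.\<close>

lemma weighted_push:
  assumes "l < L" "v < n"
    and "\<And>l' u. u < n \<Longrightarrow> R' l' u = R l' u - (if l' = l \<and> u = v then \<rho> else 0) + (if l' = Suc l then \<rho> * W u v else 0)"
  shows "(\<Sum>l'\<le>L. \<Sum>u<n. w l' u * R' l' u) =
    (\<Sum>l'\<le>L. \<Sum>u<n. w l' u * R l' u) - \<rho> * w l v + \<rho> * (\<Sum>u<n. w (Suc l) u * W u v)"
proof -
  have "(\<Sum>l'\<le>L. \<Sum>u<n. w l' u * R' l' u) = (\<Sum>l'\<le>L. \<Sum>u<n. w l' u * R l' u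
      - (if l' = l then if u = v then \<rho> * w l v else 0 else 0) + (if l' = Suc l then \<rho> * (w (Suc l) u * W u v) else 0))"
    by (intro sum.cong refl) (auto simp: assms(3) algebra_simps)
  also have "\<dots> = (\<Sum>l'\<le>L. (\<Sum>u<n. w l' u * R l' u) - (if l' = l then \<rho> * w l v else 0)
      + (if l' = Suc l then \<rho> * (\<Sum>u<n. w (Suc l) u * W u v) else 0))"
    using assms(2) by (intro sum.cong refl) (auto simp: sum.distrib sum_subtractf sum_distrib_left)
  also have "\<dots> = (\<Sum>l'\<le>L. \<Sum>u<n. w l' u * R l' u) - \<rho> * w l v + \<rho> * (\<Sum>u<n. w (Suc l) u * W u v)"
    using assms(1) by (simp add: sum.distrib sum_subtractf)
  finally show ?thesis .
qed

text \<open>Nonzero entries have absolute value at least \<open>c\<close>, and column dominance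
  bounds the absolute column sum by 2 d v. This charges the reading of a column to the D-weight of
  its vertex.\<close>

lemma col_nz_length: 
  assumes "v < n"
  shows "c * real (length (col_nz I v)) \<le> 2 * d v" "1 \<le> length (col_nz I v)"
proof -
  have len: "length (col_nz I v) = card {i. i < n \<and> M $$ (i,v) \<noteq> 0}"
    using distinct_card[OF col_nz(1)[OF assms]] col_nz(2)[OF assms] by simp
  have "c \<le> \<bar>M $$ (i,v)\<bar>" if "i < n" "M $$ (i,v) \<noteq> 0" for i
    using entries[OF elements_matI[OF M that(1) assms refl]] that(2) .
  then have "c * real (length (col_nz I v)) \<le> (\<Sum>i | i < n \<and> M $$ (i,v) \<noteq> 0. \<bar>M $$ (i,v)\<bar>)"
    unfolding len using sum_bounded_below[of "{i. i < n \<and> M $$ (i,v) \<noteq> 0}" c "\<lambda>i. \<bar>M $$ (i,v)\<bar>"]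
    by (simp add: mult.commute)
  also have "\<dots> \<le> (\<Sum>i<n. \<bar>M $$ (i,v)\<bar>)" by (intro sum_mono2) auto
  also have "\<dots> = d v + (\<Sum>i\<in>{..<n} - {v}. \<bar>M $$ (i,v)\<bar>)"
    using assms d_pos[OF assms] by (simp add: sum.remove[of _ v] d_def)
  also have "(\<Sum>i\<in>{..<n} - {v}. \<bar>M $$ (i,v)\<bar>) \<le> d v"
  proof -
    have "RDD (transpose_mat M)" using rcddz unfolding RCDDZ_def by blast
    then have "(\<Sum>i\<in>{..<n} - {v}. \<bar>transpose_mat M $$ (v,i)\<bar>) \<le> transpose_mat M $$ (v,v)"
      unfolding RDD_def using assms dims by (metis index_transpose_mat(2))
    moreover have "(\<Sum>i\<in>{..<n} - {v}. \<bar>transpose_mat M $$ (v,i)\<bar>) = (\<Sum>i\<in>{..<n} - {v}. \<bar>M $$ (i,v)\<bar>)"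
      using assms dims by (intro sum.cong) auto
    ultimately show ?thesis using assms dims by (simp add: d_def)
  qed
  finally show "c * real (length (col_nz I v)) \<le> 2 * d v" by simp
  have "v \<in> set (col_nz I v)" using d_pos[OF assms] assms by (simp add: col_nz[OF assms] d_def)
  then show "1 \<le> length (col_nz I v)" by (cases "col_nz I v") auto
qed

text \<open>D-weighted mass at level \<open>l\<close> counts L - l times, as often as it can still
  be pushed before it comes to rest at level L.\<close>

definition potential :: "nat \<Rightarrow> (nat \<Rightarrow> nat \<Rightarrow> real) \<Rightarrow> real" where
  "potential L R = (\<Sum>l\<le>L. \<Sum>v<n. (real (L - l) * d v) * R l v)"

text \<open>Twice the part of the truncated sum that the residues still represent: a residue at
  level \<open>l\<close> has L - l terms of the series ahead of it.\<close>

definition remaining :: "nat \<Rightarrow> (nat \<Rightarrow> nat \<Rightarrow> real) \<Rightarrow> real" where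
  "remaining L R = (\<Sum>l\<le>L. \<Sum>v<n. occupation n W (($) t) (L - l) v * R l v)"

text \<open>By the recursion of \<open>occupation\<close>, the weight at (l, v) is t v plus the
  weights one level up, averaged with column \<open>v\<close> of the kernel. A push settles the
  first part and hands on the second unchanged.\<close>

lemma remaining_push:
  assumes "l < L" "v < n"
    and "\<And>l' u. u < n \<Longrightarrow> R' l' u = R l' u - (if l' = l \<and> u = v then \<rho> else 0) + (if l' = Suc l then \<rho> * W u v else 0)"
  shows "remaining L R' = remaining L R - t $ v * \<rho>"
proof -
  have "L - l = Suc (L - Suc l)" using assms(1) by simp
  then have "occupation n W (($) t) (L - l) v = t $ v + (\<Sum>u<n. occupation n W (($) t) (L - Suc l) u * W u v)"
    by simp
  then have "\<rho> * occupation n W (($) t) (L - l) v =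
      t $ v * \<rho> + \<rho> * (\<Sum>u<n. occupation n W (($) t) (L - Suc l) u * W u v)"
    by (simp only: distrib_left mult.commute)
  moreover have "remaining L R' = remaining L R - \<rho> * occupation n W (($) t) (L - l) v
      + \<rho> * (\<Sum>u<n. occupation n W (($) t) (L - Suc l) u * W u v)"
    unfolding remaining_def by (rule weighted_push[OF assms(1,2)]) (rule assms(3))
  ultimately show ?thesis by linarith
qed

text \<open>D-weighted mass does not grow by \<open>W_col\<close> and counts once less on the next
  level, so at least the pushed amount is lost.\<close>

lemma potential_push:
  assumes "l < L" "v < n" "0 \<le> \<rho>"
    and "\<And>l' u. u < n \<Longrightarrow> R' l' u = R l' u - (if l' = l \<and> u = v then \<rho> else 0) + (if l' = Suc l then \<rho> * W u v else 0)"
  shows "potential L R' \<le> potential L R - d v * \<rho>"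
proof -
  have "(\<Sum>u<n. real (L - Suc l) * d u * W u v) = real (L - Suc l) * (\<Sum>u<n. W u v * d u)"
    by (simp add: sum_distrib_left mult_ac)
  also have "\<dots> \<le> real (L - Suc l) * d v" using W_col[OF assms(2)] by (intro mult_left_mono) auto
  finally have "\<rho> * (\<Sum>u<n. real (L - Suc l) * d u * W u v) \<le> \<rho> * (real (L - Suc l) * d v)"
    using assms(3) by (intro mult_left_mono)
  moreover have "\<rho> * (real (L - l) * d v) = d v * \<rho> + \<rho> * (real (L - Suc l) * d v)"
  proof -
    have "real (L - l) = 1 + real (L - Suc l)" using assms(1) by simp
    then show ?thesis by (simp only: distrib_left distrib_right mult_1 mult.commute)
  qed
  moreover have "potential L R' = potential L R - \<rho> * (real (L - l) * d v)
      + \<rho> * (\<Sum>u<n. real (L - Suc l) * d u * W u v)"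
    unfolding potential_def by (rule weighted_push[OF assms(1,2)]) (rule assms(4))
  ultimately show ?thesis by linarith
qed

lemma potential_nonneg:
  assumes "\<And>l v. v < n \<Longrightarrow> 0 \<le> R l v"
  shows "0 \<le> potential L R"
  unfolding potential_def using assms d_pos
  by (intro sum_nonneg mult_nonneg_nonneg) (auto intro: less_imp_le)

text \<open>Popping costs at most \<open>100\<close>. Pushing at \<open>v\<close> costs at most \<open>310\<close> per entry of column \<open>v\<close>, pushes onto the stack
  included, hence at most \<open>620 d(v) / c\<close>, and it lowers the potential by at least \<open>\<theta> d(v)\<close>.\<close>

definition push_inv :: "nat \<Rightarrow> real \<Rightarrow> real \<Rightarrow> state \<Rightarrow> state \<Rightarrow> bool" where
  "push_inv L \<theta> K s0 s \<longleftrightarrow> same_frame s0 s \<and> nmem s 0 0 = n \<and> nmem s 9 0 = L \<and> rmem s 5 0 = \<theta> \<and>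
    (\<forall>i<nmem s 7 0. nmem s 5 i < n) \<and> (\<forall>l v. v < n \<longrightarrow> 0 \<le> res s l v) \<and>
    (\<forall>l v. l < L \<longrightarrow> v < n \<longrightarrow> \<theta> < res s l v \<longrightarrow> (\<exists>i<nmem s 7 0. nmem s 5 i = v \<and> nmem s 6 i = l)) \<and>
    rmem s 1 0 + 1/2 * remaining L (res s) = truncated L \<and>
    real (clock s) + 100 * real (nmem s 7 0) + 620 / (c * \<theta>) * potential L (res s) \<le> K \<and> 0 \<le> rmem s 1 0"

lemma push_invD:
  assumes "push_inv L \<theta> K s0 s"
  shows "same_frame s0 s" "nmem s 0 0 = n" "nmem s 9 0 = L" "rmem s 5 0 = \<theta>"
    "\<And>i. i < nmem s 7 0 \<Longrightarrow> nmem s 5 i < n" "\<And>l v. v < n \<Longrightarrow> 0 \<le> res s l v"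
    "\<And>l v. l < L \<Longrightarrow> v < n \<Longrightarrow> \<theta> < res s l v \<Longrightarrow> \<exists>i<nmem s 7 0. nmem s 5 i = v \<and> nmem s 6 i = l"
    "rmem s 1 0 + 1/2 * remaining L (res s) = truncated L"
    "real (clock s) + 100 * real (nmem s 7 0) + 620 / (c * \<theta>) * potential L (res s) \<le> K" "0 \<le> rmem s 1 0"
  using assms unfolding push_inv_def by blast+

lemma push_invI:
  assumes "push_inv L \<theta> K s0 s" "same_frame s s'"
    "\<And>i. i < nmem s' 7 0 \<Longrightarrow> nmem s' 5 i < n" "\<And>l v. v < n \<Longrightarrow> 0 \<le> res s' l v"
    "\<And>l v. l < L \<Longrightarrow> v < n \<Longrightarrow> \<theta> < res s' l v \<Longrightarrow> \<exists>i<nmem s' 7 0. nmem s' 5 i = v \<and> nmem s' 6 i = l"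
    "rmem s' 1 0 + 1/2 * remaining L (res s') = truncated L"
    "real (clock s') + 100 * real (nmem s' 7 0) + 620 / (c * \<theta>) * potential L (res s') \<le> K" "0 \<le> rmem s' 1 0"
  shows "push_inv L \<theta> K s0 s'"
proof -
  have "nmem s' 0 0 = n" "nmem s' 9 0 = L" "rmem s' 5 0 = \<theta>"
    using assms(2) push_invD(2-4)[OF assms(1)] by (simp_all add: same_frame_def)
  then show ?thesis
    unfolding push_inv_def using same_frame_trans[OF push_invD(1)[OF assms(1)] assms(2)] assms(3-8) by blast
qed

definition popped :: "state \<Rightarrow> state \<Rightarrow> bool" where
  "popped s s1 \<longleftrightarrow> same_frame s s1 \<and> nmem s1 7 0 = nmem s 7 0 - 1 \<and> nmem s1 5 = nmem s 5 \<and> nmem s1 6 = nmem s 6 \<and>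
    nmem s1 11 0 = nmem s 5 (nmem s 7 0 - 1) \<and> nmem s1 10 0 = nmem s 6 (nmem s 7 0 - 1) \<and>
    rmem s1 7 0 = res s (nmem s 6 (nmem s 7 0 - 1)) (nmem s 5 (nmem s 7 0 - 1)) \<and>
    rmem s1 2 = rmem s 2 \<and> rmem s1 1 = rmem s 1 \<and> clock s \<le> clock s1 \<and> clock s1 \<le> clock s + 50"

lemma poppedD:
  assumes "popped s s1"
  shows "same_frame s s1" "nmem s1 7 0 = nmem s 7 0 - 1" "nmem s1 5 = nmem s 5" "nmem s1 6 = nmem s 6"
    "nmem s1 11 0 = nmem s 5 (nmem s 7 0 - 1)" "nmem s1 10 0 = nmem s 6 (nmem s 7 0 - 1)"
    "rmem s1 7 0 = res s (nmem s 6 (nmem s 7 0 - 1)) (nmem s 5 (nmem s 7 0 - 1))"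
    "rmem s1 2 = rmem s 2" "rmem s1 1 = rmem s 1" "clock s \<le> clock s1" "clock s1 \<le> clock s + 50"
  using assms unfolding popped_def by blast+

lemma pop:
  assumes "nmem s 0 0 = n"
  shows "hoare I pop s (popped s)"
  unfolding pop_def block.simps
  apply ((rule exec_seq, simp add: assms)+)
  apply (rule exec_SetR)
  apply (simp_all add: popped_def same_frame_def assms res_def)
  done

lemma push_inv_clock:
  assumes "push_inv L \<theta> K s0 s" "0 < \<theta>"
  shows "real (clock s) \<le> K"
proof -
  have "0 \<le> 620 / (c * \<theta>) * potential L (res s)"
    using assms(2) c_pos push_invD(6)[OF assms(1)] by (intro mult_nonneg_nonneg potential_nonneg) auto
  then show ?thesis using push_invD(9)[OF assms(1)] by linarith
qed

text \<open>The popped entry may be dropped: its residue does not exceed the threshold or its level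
  is not below \<open>L\<close>, so the remaining entries still cover all residues that must be
  pushed.\<close>

lemma push_body_skip:
  assumes inv: "push_inv L \<theta> K s0 s" and sp: "0 < nmem s 7 0"
    and s1: "popped (tick 5 s) s1" and no: "\<not> (nmem s1 10 0 < L \<and> \<theta> < rmem s1 7 0)"
    and s': "same_frame s1 s'" "nmem s' 7 = nmem s1 7" "nmem s' 5 = nmem s1 5" "nmem s' 6 = nmem s1 6"
      "rmem s' 2 = rmem s1 2" "rmem s' 1 = rmem s1 1" "clock s' \<le> clock s1 + 40"
  shows "push_inv L \<theta> K s0 s'"
proof -
  note p = poppedD[OF s1, unfolded tick_sel res_tick same_frame_tick]
  have res: "res s' = res s" using p(8) s'(5) by (intro res_cong) simp
  define k where "k = nmem s 7 0 - 1"
  have k: "nmem s 7 0 = Suc k" using sp by (simp add: k_def)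
  have st: "nmem s' 7 0 = k" "nmem s' 5 = nmem s 5" "nmem s' 6 = nmem s 6" "rmem s' 1 = rmem s 1"
    using p s' by (simp_all add: k_def)
  \<comment> \<open>Loop test 5, pop 50, the rest 40: covered by the 100 that the popped entry
    releases.\<close>
  have ck: "real (clock s') \<le> real (clock s) + 95" using p(11) s'(7) by linarith
  have no': "\<not> (nmem s 6 k < L \<and> \<theta> < res s (nmem s 6 k) (nmem s 5 k))"
    using no p by (simp add: k_def)
  note inv' = push_invD[OF inv, unfolded k]
  show ?thesis
  proof (rule push_invI[OF inv], unfold res st)
    show "same_frame s s'" by (rule same_frame_trans[OF p(1) s'(1)])
    show "\<exists>i<k. nmem s 5 i = v \<and> nmem s 6 i = l" if h: "l < L" "v < n" "\<theta> < res s l v" for l v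
    proof -
      obtain i where i: "i < Suc k" "nmem s 5 i = v" "nmem s 6 i = l" using inv'(7)[OF h] by blast
      then have "i \<noteq> k" using no' h by blast
      then show ?thesis using i by (metis less_SucE)
    qed
    show "nmem s 5 i < n" if "i < k" for i using inv'(5)[of i] that by simp
    show "real (clock s') + 100 * real k + 620 / (c * \<theta>) * potential L (res s) \<le> K"
      using inv'(9) ck by simp
  qed (use inv' in blast)+
qed

lemma push_body_push:
  assumes inv: "push_inv L \<theta> K s0 s" and sp: "0 < nmem s 7 0" and "0 < \<theta>"
    and s1: "popped (tick 5 s) s1" and yes: "nmem s1 10 0 < L" "\<theta> < rmem s1 7 0"
    and s': "pushed (nmem s1 10 0) (nmem s1 11 0) (rmem s1 7 0) (tick k1 s1) s'" "k1 \<le> 30"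
  shows "push_inv L \<theta> K s0 s'"
proof -
  define k where "k = nmem s 7 0 - 1"
  have k: "nmem s 7 0 = Suc k" using sp by (simp add: k_def)
  define l where "l = nmem s1 10 0"
  define v where "v = nmem s1 11 0"
  define \<rho> where "\<rho> = rmem s1 7 0"
  define cols where "cols = col_nz I v"
  note q = poppedD[OF s1, unfolded tick_sel res_tick same_frame_tick]
  note inv' = push_invD[OF inv, unfolded k]
  have lv: "l = nmem s 6 k" "v = nmem s 5 k" "\<rho> = res s l v"
    unfolding l_def v_def \<rho>_def k_def using q by simp_all
  have v: "v < n" using inv'(5)[of k] lv by simp
  have l: "l < L" and \<rho>: "\<theta> < \<rho>" using yes by (simp_all add: l_def \<rho>_def)
  have res1: "res s1 = res s" by (rule res_cong[OF q(8)])
  have p: "pushed l v \<rho> (tick k1 s1) s'" using s'(1) by (simp add: l_def v_def \<rho>_def)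
  note p = pushedD[OF p, unfolded tick_sel res_tick same_frame_tick res1 cols_def[symmetric] q(2,3,4,9) k_def[symmetric]]
  have fr: "same_frame s s'" by (rule same_frame_trans[OF q(1) p(1)])
  note st = p(3,2) and old = p(4) and new = p(5) and res = p(6)
  have ck: "real (clock s') \<le> real (clock s) + 185 + 110 * real (length cols)"
    using p(8) q(11) s'(2) by linarith
  have cols: "set cols = {i. i < n \<and> M $$ (i,v) \<noteq> 0}" using col_nz[OF v] by (simp add: cols_def)
  have "nmem s' 5 i < n" if i: "i < nmem s' 7 0" for i
  proof (cases "i < k")
    case True
    then show ?thesis using old[of i] inv'(5)[of i] by simp
  next
    case False
    then obtain j where j: "i = k + j" by (metis le_iff_add not_less)
    then have "j < length cols" using i st by simp
    then show ?thesis using new[of j] nth_mem[of j cols] cols j by auto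
  qed
  moreover have "0 \<le> res s' l' u" if u: "u < n" for l' u
  proof -
    have "0 \<le> res s l' u" by (rule inv'(6)[OF u])
    moreover have "0 \<le> \<rho> * W u v" using W_nonneg[OF u v] \<rho> assms(3) by simp
    ultimately show ?thesis unfolding res[OF u] using lv(3) by auto
  qed
  moreover have "\<exists>i<nmem s' 7 0. nmem s' 5 i = u \<and> nmem s' 6 i = l'"
    if h: "l' < L" "u < n" "\<theta> < res s' l' u" for l' u
  proof (cases "l' = Suc l \<and> u \<in> set cols")
    case True
    then obtain j where "j < length cols" "cols ! j = u" by (auto simp: in_set_conv_nth)
    then show ?thesis using new[of j] st True by (intro exI[of _ "k + j"]) auto
  next
    case False
    \<comment> \<open>The pushed residue is now 0: \<rho> was all of it, and level \<open>l\<close>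
      receives nothing.\<close>
    have ne: "\<not> (l' = l \<and> u = v)"
      using h(3) assms(3) unfolding res[OF h(2)] lv(3) by auto
    \<comment> \<open>The diagonal entry belongs to the column, so a vertex outside
      \<open>cols\<close> differs from \<open>v\<close>, and both parts of its \<open>W u v\<close>
      vanish.\<close>
    have vc: "v \<in> set cols" using d_pos[OF v] v by (simp add: cols d_def)
    have "l' = Suc l \<Longrightarrow> W u v = 0"
      using False vc h(2) by (auto simp: cols lazy_walk_def)
    then have "\<theta> < res s l' u" using h(3) ne unfolding res[OF h(2)] by (auto split: if_splits)
    then obtain i where i: "i < Suc k" "nmem s 5 i = u" "nmem s 6 i = l'"
      using inv'(7)[OF h(1,2)] by blast
    then have "i < k" using ne lv by (metis less_SucE)
    then show ?thesis using old[of i] i st by (intro exI[of _ i]) auto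
  qed
  moreover have "rmem s' 1 0 + 1/2 * remaining L (res s') = truncated L"
  proof -
    have "remaining L (res s') = remaining L (res s) - t $ v * \<rho>"
      by (rule remaining_push[OF l v]) (rule res)
    then show ?thesis using inv'(8) st(2) by linarith
  qed
  moreover have "real (clock s') + 100 * real (nmem s' 7 0) + 620 / (c * \<theta>) * potential L (res s') \<le> K"
  proof -
    have len: "c * real (length cols) \<le> 2 * d v" "1 \<le> length cols"
      using col_nz_length[OF v] by (simp_all add: cols_def)
    have "310 * real (length cols) = 310 / c * (c * real (length cols))" using c_pos by simp
    also have "\<dots> \<le> 310 / c * (2 * d v)" using len c_pos by (intro mult_left_mono) auto
    also have "\<dots> = 620 / (c * \<theta>) * (d v * \<theta>)" using assms(3) c_pos by (simp add: field_simps)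
    also have "\<dots> \<le> 620 / (c * \<theta>) * (d v * \<rho>)"
      using \<rho> d_pos[OF v] c_pos assms(3) by (intro mult_left_mono) auto
    finally have cost: "310 * real (length cols) \<le> 620 / (c * \<theta>) * (d v * \<rho>)" .
    have "potential L (res s') \<le> potential L (res s) - d v * \<rho>"
      using \<rho> assms(3) by (intro potential_push[OF l v] res) auto
    then have "620 / (c * \<theta>) * potential L (res s') \<le> 620 / (c * \<theta>) * (potential L (res s) - d v * \<rho>)"
      using assms(3) c_pos by (intro mult_left_mono) auto
    also have "\<dots> = 620 / (c * \<theta>) * potential L (res s) - 620 / (c * \<theta>) * (d v * \<rho>)"
      by (simp add: right_diff_distrib)
    also have "\<dots> \<le> 620 / (c * \<theta>) * potential L (res s) - 310 * real (length cols)"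
      using cost by linarith
    finally have pot: "620 / (c * \<theta>) * potential L (res s') \<le> 620 / (c * \<theta>) * potential L (res s) - 310 * real (length cols)" .
    have "real (nmem s' 7 0) = real k + real (length cols)" using st by simp
    moreover have "1 \<le> real (length cols)" using len(2) by simp
    moreover have "real (clock s) + 100 * (1 + real k) + 620 / (c * \<theta>) * potential L (res s) \<le> K"
      using inv'(9) by simp
    \<comment> \<open>The popped entry releases 100 of the fixed 185; the remaining 85 + 210 per
      column entry are at most 310 per entry because the column is nonempty.\<close>
    ultimately show ?thesis using pot ck by argo
  qed
  moreover have "0 \<le> rmem s' 1 0"
    using inv'(10) st(2) t_nonneg[OF v] \<rho> assms(3) by simp
  ultimately show ?thesis using push_invI[OF inv fr] by blast
qed

lemma push_loop:
  assumes "push_inv L \<theta> K s0 s" "0 < \<theta>"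
  shows "hoare I push_loop s (\<lambda>s'. same_frame s0 s' \<and> nmem s' 0 0 = n \<and>
    (\<forall>l v. l < L \<longrightarrow> v < n \<longrightarrow> 0 \<le> res s' l v \<and> res s' l v \<le> \<theta>) \<and>
    rmem s' 1 0 + 1/2 * remaining L (res s') = truncated L \<and> real (clock s') \<le> K + 5 \<and> 0 \<le> rmem s' 1 0)"
  unfolding push_loop_def
\<comment> \<open>The stack may grow, so the clock itself serves as variant: it increases in every
  iteration and stays below \<open>K\<close>.\<close>
proof (rule hoare_While[where Inv = "push_inv L \<theta> K s0" and V = "\<lambda>s. nat \<lceil>K\<rceil> - clock s"])
  show "push_inv L \<theta> K s0 s" by (rule assms)
next
  fix s assume inv: "push_inv L \<theta> K s0 s" and "bval s (NLess (NConst 0) (nv 7))"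
  then have sp: "0 < nmem s 7 0" by simp
  have bc: "1 + bcost (NLess (NConst 0) (nv 7)) = 5" by simp
  have dec: "nat \<lceil>K\<rceil> - clock s' < nat \<lceil>K\<rceil> - clock s" if "push_inv L \<theta> K s0 s'" "clock s < clock s'" for s'
  proof -
    have "clock s' \<le> nat \<lceil>K\<rceil>" using push_inv_clock[OF that(1) assms(2)] by linarith
    then show ?thesis using that(2) by linarith
  qed
  show "hoare I (Seq pop (Cond (BAnd (NLess (nv 10) (nv 9)) (RLess (rv 5) (rv 7))) push (block [])))
      (tick (1 + bcost (NLess (NConst 0) (nv 7))) s)
      (\<lambda>s'. push_inv L \<theta> K s0 s' \<and> nat \<lceil>K\<rceil> - clock s' < nat \<lceil>K\<rceil> - clock s)"
    unfolding bc
  proof (rule triple_Seq_hoare[OF pop])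
    show "nmem (tick 5 s) 0 0 = n" using push_invD[OF inv] by simp
    fix s1 assume s1: "popped (tick 5 s) s1"
    have reg: "nmem s1 9 0 = L" "rmem s1 5 0 = \<theta>" "nmem s1 0 0 = n" "nmem s1 11 0 < n"
        "rmem s1 7 0 = res s1 (nmem s1 10 0) (nmem s1 11 0)" "clock s < clock s1"
      using poppedD[OF s1] push_invD[OF inv] sp by (simp_all add: same_frame_def res_def)
    have b2: "1 + bcost (BAnd (NLess (nv 10) (nv 9)) (RLess (rv 5) (rv 7))) \<le> 30" by simp
    show "hoare I (Cond (BAnd (NLess (nv 10) (nv 9)) (RLess (rv 5) (rv 7))) push (block [])) s1
        (\<lambda>s'. push_inv L \<theta> K s0 s' \<and> nat \<lceil>K\<rceil> - clock s' < nat \<lceil>K\<rceil> - clock s)"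
      (is "hoare I (Cond ?b _ _) s1 ?Post")
    proof (rule triple_Cond)
      assume yes: "bval s1 ?b"
      have "hoare I push (tick (1 + bcost ?b) s1) (pushed (nmem s1 10 0) (nmem s1 11 0) (rmem s1 7 0) (tick (1 + bcost ?b) s1))"
        by (rule push) (use reg in simp_all)
      then show "hoare I push (tick (1 + bcost ?b) s1) ?Post"
      proof (rule triple_weaken)
        fix s' assume s': "pushed (nmem s1 10 0) (nmem s1 11 0) (rmem s1 7 0) (tick (1 + bcost ?b) s1) s'"
        have "push_inv L \<theta> K s0 s'"
          using push_body_push[OF inv sp assms(2) s1 _ _ s' b2] yes reg by simp
        moreover have "clock s < clock s'" using pushedD(7)[OF s'] reg by simp
        ultimately show "?Post s'" using dec by blast
      qed simp_all
    next
      assume no: "\<not> bval s1 ?b"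
      show "hoare I (block []) (tick (1 + bcost ?b) s1) ?Post"
        unfolding block.simps
      proof (rule exec_SetN)
        let ?s' = "(tick (1 + bcost ?b) s1)\<lparr>nmem := (nmem (tick (1 + bcost ?b) s1))(15 := (nmem (tick (1 + bcost ?b) s1) 15)
             (nval (tick (1 + bcost ?b) s1) (NConst 0) := nval (tick (1 + bcost ?b) s1) (NConst 0))),
           clock := clock (tick (1 + bcost ?b) s1) + (1 + ncost (NConst 0) + ncost (NConst 0))\<rparr>"
        have "push_inv L \<theta> K s0 ?s'"
          using no reg by (intro push_body_skip[OF inv sp s1]) (simp_all add: same_frame_def)
        moreover have "clock s < clock ?s'" using reg by simp
        ultimately show "?Post ?s'" using dec by blast
      qed simp
    qed
  qed
next
  fix s assume inv: "push_inv L \<theta> K s0 s" and "\<not> bval s (NLess (NConst 0) (nv 7))"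
  then have sp: "nmem s 7 0 = 0" by simp
  \<comment> \<open>A larger residue would have an entry on the stack, which is empty.\<close>
  have "res s l v \<le> \<theta>" if "l < L" "v < n" for l v
    using push_invD(7)[OF inv that] sp by (metis not_less not_less_zero)
  then show "same_frame s0 (tick (1 + bcost (NLess (NConst 0) (nv 7))) s) \<and>
      nmem (tick (1 + bcost (NLess (NConst 0) (nv 7))) s) 0 0 = n \<and>
      (\<forall>l v. l < L \<longrightarrow> v < n \<longrightarrow> 0 \<le> res (tick (1 + bcost (NLess (NConst 0) (nv 7))) s) l v \<and>
        res (tick (1 + bcost (NLess (NConst 0) (nv 7))) s) l v \<le> \<theta>) \<and>
      rmem (tick (1 + bcost (NLess (NConst 0) (nv 7))) s) 1 0
        + 1/2 * remaining L (res (tick (1 + bcost (NLess (NConst 0) (nv 7))) s)) = truncated L \<and>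
      real (clock (tick (1 + bcost (NLess (NConst 0) (nv 7))) s)) \<le> K + 5 \<and>
      0 \<le> rmem (tick (1 + bcost (NLess (NConst 0) (nv 7))) s) 1 0"
    using push_invD[OF inv] push_inv_clock[OF inv assms(2)] by (simp del: One_nat_def)
qed

end

section \<open>The sampling phase\<close>

lemma nn_integral_count_space_lessThan:
  fixes f :: "nat \<Rightarrow> real"
  assumes "\<And>u. u < n \<Longrightarrow> 0 \<le> f u"
  shows "(\<integral>\<^sup>+ u. ennreal (if u < n then f u else 0) \<partial>count_space UNIV) = ennreal (\<Sum>u<n. f u)"
proof -
  have "(\<integral>\<^sup>+ u. ennreal (if u < n then f u else 0) \<partial>count_space UNIV) =
      (\<Sum>u<n. ennreal (if u < n then f u else 0))"
    by (rule nn_integral_count_space') auto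
  also have "\<dots> = (\<Sum>u<n. ennreal (f u))" by (intro sum.cong) auto
  also have "\<dots> = ennreal (\<Sum>u<n. f u)" using assms by (intro sum_ennreal) auto
  finally show ?thesis .
qed

lemma triple_add_const:
  assumes "triple I c s \<Phi> F g"
  shows "triple I c s \<Phi> (\<lambda>s. F s + k) (g + k)"
proof -
  obtain D where D: "yields I c s D" "\<forall>s'\<in>set_pmf D. \<Phi> s'" "measure_pmf.expectation D F \<le> g"
    using assms by (auto simp: triple_def)
  have "finite (set_pmf D)" using D(1) by (simp add: yields_def)
  then have "measure_pmf.expectation D (\<lambda>s. F s + k) = measure_pmf.expectation D F + k"
    by (simp add: integrable_measure_pmf_finite)
  then show ?thesis using D unfolding triple_def by (intro exI[of _ D]) simp
qed

lemma triple_cmult: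
  assumes "triple I c s \<Phi> F g" "0 \<le> k"
  shows "triple I c s \<Phi> (\<lambda>s. k * F s) (k * g)"
proof -
  obtain D where D: "yields I c s D" "\<forall>s'\<in>set_pmf D. \<Phi> s'" "measure_pmf.expectation D F \<le> g"
    using assms by (auto simp: triple_def)
  then have "measure_pmf.expectation D (\<lambda>s. k * F s) \<le> k * g" using assms(2) by (simp add: mult_left_mono)
  then show ?thesis using D unfolding triple_def by blast
qed

text \<open>\<open>h\<close> reads the random outcome back from memory; thus a bound that depends on
  the outcome becomes a function of the state, as \<open>triple_Seq\<close> requires.\<close>

lemma triple_Seq_random:
  assumes "\<And>K. step I (c # K, s) = map_pmf (\<lambda>x. (K, f x)) D" "finite (set_pmf D)" "\<And>x. h (f x) = x"
    "\<And>x. x \<in> set_pmf D \<Longrightarrow> triple I d (f x) \<Psi> F (G x)" "measure_pmf.expectation D G \<le> g"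
  shows "triple I (Seq c d) s \<Psi> F g"
proof (rule triple_Seq)
  show "triple I c s (\<lambda>s'. \<exists>x\<in>set_pmf D. s' = f x) (\<lambda>s'. G (h s')) g"
    by (rule triple_step[OF assms(1,2)]) (use assms(3,5) in auto)
  fix s' assume "\<exists>x\<in>set_pmf D. s' = f x"
  then show "triple I d s' \<Psi> F (G (h s'))" using assms(3,4) by auto
qed

lemma exec_Uniform_Seq:
  assumes "\<And>x. x \<le> nval s e \<Longrightarrow> triple I d (s\<lparr>nmem := (nmem s)(a := (nmem s a)(nval s i := x)),
      clock := clock s + (1 + ncost i + ncost e)\<rparr>) \<Phi> F (G x)"
    and "(\<Sum>x\<le>nval s e. G x) / real (Suc (nval s e)) \<le> g"
  shows "triple I (Seq (Uniform a i e) d) s \<Phi> F g"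
proof (rule triple_Seq_random[OF step.simps(7), where h = "\<lambda>s'. nmem s' a (nval s i)" and G = G])
  show "measure_pmf.expectation (pmf_of_set {..nval s e}) G \<le> g"
    using assms(2) by (subst integral_pmf_of_set) auto
  show "triple I d (tick (1 + ncost i + ncost e) (put_n a (nval s i) x s)) \<Phi> F (G x)"
    if "x \<in> set_pmf (pmf_of_set {..nval s e})" for x
    using assms(1)[of x] that by (simp add: tick_def put_n_def)
qed (auto simp: put_n_def)

lemma exec_SampleT_Seq:
  assumes "finite (set_pmf (sample_t (syst I)))"
    and "\<And>v. v \<in> set_pmf (sample_t (syst I)) \<Longrightarrow> triple I d (s\<lparr>nmem := (nmem s)(a := (nmem s a)(nval s i := v)),
      clock := clock s + (1 + ncost i)\<rparr>) \<Phi> F (G v)"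
    and "measure_pmf.expectation (sample_t (syst I)) G \<le> g"
  shows "triple I (Seq (SampleT a i) d) s \<Phi> F g"
proof (rule triple_Seq_random[OF step.simps(14) assms(1), where h = "\<lambda>s'. nmem s' a (nval s i)" and G = G])
  show "triple I d (tick (1 + ncost i) (put_n a (nval s i) v s)) \<Phi> F (G v)"
    if "v \<in> set_pmf (sample_t (syst I))" for v
    using assms(2)[OF that] by (simp add: tick_def put_n_def)
qed (use assms(3) in \<open>auto simp: put_n_def\<close>)

lemma exec_WalkStep:
  assumes "nval s e < dim_row (sysM I)" "finite (set_pmf (walk_step (sysM I) (nval s e)))"
    and "\<And>x. x \<in> set_pmf (walk_step (sysM I) (nval s e)) \<Longrightarrow>
      \<Phi> (s\<lparr>nmem := (nmem s)(a := (nmem s a)(nval s i := (case x of None \<Rightarrow> 0 | Some u \<Rightarrow> Suc u))),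
        clock := clock s + (1 + ncost i + ncost e + step_time I (nval s e))\<rparr>)"
    and "measure_pmf.expectation (walk_step (sysM I) (nval s e)) (\<lambda>x.
      F (s\<lparr>nmem := (nmem s)(a := (nmem s a)(nval s i := (case x of None \<Rightarrow> 0 | Some u \<Rightarrow> Suc u))),
        clock := clock s + (1 + ncost i + ncost e + step_time I (nval s e))\<rparr>)) \<le> g"
  shows "triple I (WalkStep a i e) s \<Phi> F g"
  by (rule triple_step[where D = "walk_step (sysM I) (nval s e)"
        and f = "\<lambda>x. s\<lparr>nmem := (nmem s)(a := (nmem s a)(nval s i := (case x of None \<Rightarrow> 0 | Some u \<Rightarrow> Suc u))),
        clock := clock s + (1 + ncost i + ncost e + step_time I (nval s e))\<rparr>"])
    (use assms in \<open>simp_all add: tick_def put_n_def\<close>)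

section \<open>The random queries in terms of the kernel\<close>

context rcddz_instance
begin

text \<open>\<open>A_tr M\<close> is nonnegative for RCDDZ matrices, so the absolute values change
  nothing, and the walk that can be simulated has the kernel of the series.\<close>

lemma walk_step_eq:
  assumes v: "v < n"
  shows "walk_step M v = embed_spmf (\<lambda>u. if u < n then W v u else 0)"
proof -
  have "map_mat abs (A_tr M) = A_tr M"
  proof (rule eq_matI)
    fix i j assume "i < dim_row (A_tr M)" "j < dim_col (A_tr M)"
    then have "i < n" "j < n" using A_tr_carrier[OF M] by auto
    then show "map_mat abs (A_tr M) $$ (i,j) = A_tr M $$ (i,j)"
      using A_tr_nth[OF M] RCDDZ_off_diag[OF rcddz] A_tr_carrier[OF M] by (auto simp: dims)
  qed auto
  then have "((1/2) \<cdot>\<^sub>m (1\<^sub>m n + diag_powr M (-1) * map_mat abs (A_tr M))) $$ (v,u) = W v u" if "u < n" for u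
    using lazy_walk_mat[OF M _ v that] d_pos by (simp add: d_def)
  then show ?thesis unfolding walk_step_def dims by (intro arg_cong[where f = embed_spmf]) auto
qed

lemma walk_step_pmf:
  assumes v: "v < n"
  shows "pmf (walk_step M v) (Some u) = (if u < n then W v u else 0)"
    "pmf (walk_step M v) None = 1 - (\<Sum>u<n. W v u)"
proof -
  have eq: "(\<integral>\<^sup>+ u. ennreal (if u < n then W v u else 0) \<partial>count_space UNIV) = ennreal (\<Sum>u<n. W v u)"
    using W_nonneg[OF v] by (rule nn_integral_count_space_lessThan)
  have le: "(\<integral>\<^sup>+ u. ennreal (if u < n then W v u else 0) \<partial>count_space UNIV) \<le> 1"
    unfolding eq using W_row[OF v] by (simp add: ennreal_le_1)
  have nn: "0 \<le> (\<Sum>u<n. W v u)" using W_nonneg[OF v] by (intro sum_nonneg) auto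
  show "pmf (walk_step M v) (Some u) = (if u < n then W v u else 0)"
    unfolding walk_step_eq[OF v] spmf_embed_spmf[OF le] using W_nonneg[OF v] by auto
  show "pmf (walk_step M v) None = 1 - (\<Sum>u<n. W v u)"
    unfolding walk_step_eq[OF v] pmf_embed_spmf_None[OF le] eq using nn by simp
qed

lemma walk_step_support:
  assumes "v < n"
  shows "set_pmf (walk_step M v) \<subseteq> insert None (Some ` {..<n})"
proof
  fix r assume r: "r \<in> set_pmf (walk_step M v)"
  then show "r \<in> insert None (Some ` {..<n})"
    using walk_step_pmf(1)[OF assms] by (cases r) (auto simp: set_pmf_iff split: if_splits)
qed

lemma expectation_walk_step:
  assumes "v < n"
  shows "measure_pmf.expectation (walk_step M v) G =
    (1 - (\<Sum>u<n. W v u)) * G None + (\<Sum>u<n. W v u * G (Some u))"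
proof -
  have "measure_pmf.expectation (walk_step M v) G =
      (\<Sum>r\<in>insert None (Some ` {..<n}). G r * pmf (walk_step M v) r)"
    using walk_step_support[OF assms] by (intro integral_measure_pmf_real) auto
  also have "\<dots> = G None * pmf (walk_step M v) None + (\<Sum>u<n. G (Some u) * pmf (walk_step M v) (Some u))"
    by (subst sum.insert) (auto simp: sum.reindex)
  also have "\<dots> = (1 - (\<Sum>u<n. W v u)) * G None + (\<Sum>u<n. W v u * G (Some u))"
    unfolding walk_step_pmf[OF assms] by (simp add: mult.commute)
  finally show ?thesis .
qed

lemma sample_t_pmf: "pmf (sample_t t) v = (if v < n then t $ v / lp_norm 1 t else 0)"
proof -
  have "(\<integral>\<^sup>+ v. ennreal (if v < n then t $ v / lp_norm 1 t else 0) \<partial>count_space UNIV) =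
      ennreal (\<Sum>v<n. t $ v / lp_norm 1 t)"
    using t_nonneg norm1_t_pos by (intro nn_integral_count_space_lessThan) auto
  also have "(\<Sum>v<n. t $ v / lp_norm 1 t) = 1"
    using norm1_t norm1_t_pos by (simp add: sum_divide_distrib[symmetric])
  finally show ?thesis
    unfolding sample_t_def dims using t_nonneg norm1_t_pos by (intro pmf_embed_pmf) auto
qed

lemma sample_t_support: "set_pmf (sample_t t) \<subseteq> {..<n}"
  using sample_t_pmf by (auto simp: set_pmf_iff split: if_splits)

lemma expectation_sample_t:
  "measure_pmf.expectation (sample_t t) G = (\<Sum>v<n. t $ v * G v) / lp_norm 1 t"
proof -
  have "measure_pmf.expectation (sample_t t) G = (\<Sum>v<n. G v * pmf (sample_t t) v)"
    using sample_t_support by (intro integral_measure_pmf_real) auto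
  also have "\<dots> = (\<Sum>v<n. t $ v * G v) / lp_norm 1 t"
    unfolding sum_divide_distrib by (intro sum.cong) (auto simp: sample_t_pmf)
  finally show ?thesis .
qed

lemma step_time_le: "v < n \<Longrightarrow> step_time I v \<le> f_row I"
  unfolding f_row_def sys dims by (intro Max_ge) auto

lemma f_row_pos: "1 \<le> f_row I"
proof -
  have "1 \<le> step_time I 0" using wf n_pos by (auto simp: well_formed_def)
  then show ?thesis using step_time_le[OF n_pos] by linarith
qed

end

section \<open>Sampling walks and accumulating their sums\<close>

definition walk_body :: com where
  "walk_body = block
    [setr 11 (RAdd (rv 11) (RGet 2 (NAdd (NMul (nv 10) (nv 0)) (NSub (nv 13) (NConst 1))))),
     setn 14 (NSub (nv 14) (NConst 1)),
     WalkStep 13 (NConst 0) (NSub (nv 13) (NConst 1))]"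

definition walk_loop :: com where
  "walk_loop = While (BAnd (NLess (NConst 0) (nv 14)) (NLess (NConst 0) (nv 13))) walk_body"

definition sample_body :: com where
  "sample_body = block
    [setn 12 (succ (nv 12)),
     Uniform 10 (NConst 0) (NSub (nv 9) (NConst 1)),
     SampleT 13 (NConst 0),
     setn 13 (succ (nv 13)),
     setn 14 (NSub (nv 9) (nv 10)),
     walk_loop]"

definition sample_loop :: com where
  "sample_loop = While (BNot (RLess (rv 8) (RNat (succ (nv 12))))) sample_body"

definition average :: com where
  "average = setr 1 (RAdd (rv 1) (RDiv (RMul (RMul (par 3) (RNat (nv 9))) (rv 11))
     (RMul (RNat (NConst 2)) (RNat (nv 12)))))"

definition sampling_frame :: "(nat \<Rightarrow> nat \<Rightarrow> nat) \<Rightarrow> (nat \<Rightarrow> nat \<Rightarrow> real) \<Rightarrow> state \<Rightarrow> bool" where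
  "sampling_frame N R s \<longleftrightarrow> nmem s 0 0 = N 0 0 \<and> nmem s 9 0 = N 9 0 \<and>
    rmem s 0 = R 0 \<and> rmem s 1 0 = R 1 0 \<and> rmem s 2 = R 2 \<and> rmem s 8 0 = R 8 0"

locale sampling = rcddz_instance +
  fixes N0 :: "nat \<Rightarrow> nat \<Rightarrow> nat" and R0 :: "nat \<Rightarrow> nat \<Rightarrow> real" and r :: "nat \<Rightarrow> nat \<Rightarrow> real"
    and L :: nat and \<theta> :: real
  assumes N0: "N0 0 0 = n" "N0 9 0 = L" and r_eq: "\<And>l v. r l v = R0 2 (l * n + v)"
    and L_pos: "0 < L" and \<theta>: "0 \<le> \<theta>" and r_nonneg: "\<And>l v. l < L \<Longrightarrow> v < n \<Longrightarrow> 0 \<le> r l v"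
    and r_le: "\<And>l v. l < L \<Longrightarrow> v < n \<Longrightarrow> r l v \<le> \<theta>"
begin

text \<open>The value 0 of the position cell stands for a terminated walk, which collects nothing
  further.\<close>

definition walk_mean :: "nat \<Rightarrow> nat \<Rightarrow> nat \<Rightarrow> real" where
  "walk_mean l m u = (if u = 0 then 0 else walk_sum n W (r l) m (u - 1))"

definition walk_sq :: "nat \<Rightarrow> nat \<Rightarrow> nat \<Rightarrow> real" where
  "walk_sq l m u = (if u = 0 then 0 else walk_sum_sq n W (r l) m (u - 1))"

text \<open>The conditional second moment of the final value of the accumulator, centred at \<open>a\<close>.\<close>

definition walk_pot :: "real \<Rightarrow> nat \<Rightarrow> state \<Rightarrow> real" where
  "walk_pot a l s = (rmem s 11 0 - a)\<^sup>2 + 2 * (rmem s 11 0 - a) * walk_mean l (nmem s 14 0) (nmem s 13 0)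
    + walk_sq l (nmem s 14 0) (nmem s 13 0)"

definition walk_inv :: "nat \<Rightarrow> nat \<Rightarrow> nat \<Rightarrow> state \<Rightarrow> bool" where
  "walk_inv l i K s \<longleftrightarrow> sampling_frame N0 R0 s \<and> nmem s 12 0 = i \<and> nmem s 10 0 = l \<and> nmem s 13 0 \<le> n \<and>
    clock s + nmem s 14 0 * (f_row I + 100) \<le> K"

lemma walk_body:
  assumes inv: "walk_inv l i K s" and "0 < nmem s 14 0" "0 < nmem s 13 0" and k: "k \<le> 20"
  shows "triple I walk_body (tick k s) (\<lambda>s'. walk_inv l i K s' \<and> nmem s' 14 0 < nmem s 14 0)
    (walk_pot a l) (walk_pot a l s)"
proof -
  obtain m where m: "nmem s 14 0 = Suc m" using assms(2) by (cases "nmem s 14 0") auto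
  obtain v where v: "nmem s 13 0 = Suc v" using assms(3) by (cases "nmem s 13 0") auto
  have vn: "v < n" using inv v by (simp add: walk_inv_def)
  have fr: "sampling_frame N0 R0 s" "nmem s 12 0 = i" "nmem s 10 0 = l"
      "clock s + Suc m * (f_row I + 100) \<le> K"
    using inv unfolding walk_inv_def m by blast+
  have n0: "nmem s 0 0 = n" "rmem s 2 (l * n + v) = r l v"
    using fr(1) N0 by (simp_all add: sampling_frame_def r_eq)
  define y where "y = rmem s 11 0 + r l v - a"
  have pot: "walk_pot a l s = y\<^sup>2 + 2 * y * kernel_apply n W (walk_sum n W (r l) m) v
      + kernel_apply n W (walk_sum_sq n W (r l) m) v"
    by (simp add: walk_pot_def walk_mean_def walk_sq_def m v y_def power2_eq_square algebra_simps)
  \<comment> \<open>The potential is a martingale: averaging over the next position, with the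
    missing row mass on termination, reproduces the recursions of \<open>walk_sum\<close> and
    \<open>walk_sum_sq\<close>.\<close>
  have avg: "(1 - (\<Sum>u<n. W v u)) * y\<^sup>2 + (\<Sum>u<n. W v u * (y\<^sup>2
      + 2 * y * walk_sum n W (r l) m u + walk_sum_sq n W (r l) m u)) = walk_pot a l s"
    unfolding pot kernel_apply_def
    by (simp add: distrib_left sum.distrib sum_distrib_left left_diff_distrib right_diff_distrib mult_ac sum_distrib_right)
  show ?thesis
    unfolding walk_body_def block.simps
    apply (rule exec_SetR_Seq, simp add: m v n0 fr(2,3))
    apply (rule exec_SetN_Seq, simp add: m v n0 fr(2,3))
    apply (rule exec_WalkStep)
    subgoal by (simp add: v sys dims vn)
    subgoal using finite_subset[OF walk_step_support[OF vn]] by (simp add: v sys)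
    subgoal for y
      using fr vn v m walk_step_support[OF vn] step_time_le[OF vn] k
      by (auto simp: walk_inv_def sampling_frame_def sys v split: option.splits)
    subgoal
      unfolding avg[symmetric]
      by (simp add: v sys expectation_walk_step[OF vn] walk_pot_def walk_mean_def walk_sq_def y_def[symmetric])
    done
qed

lemma walk_loop:
  assumes "walk_inv l i K s"
  shows "triple I walk_loop s (\<lambda>s'. sampling_frame N0 R0 s' \<and> nmem s' 12 0 = i \<and> clock s' \<le> K + 20)
    (\<lambda>s'. (rmem s' 11 0 - a)\<^sup>2) (walk_pot a l s)"
  unfolding walk_loop_def
proof (rule triple_While[where Inv = "walk_inv l i K" and V = "\<lambda>s. nmem s 14 0"])
  fix s assume "walk_inv l i K s" "bval s (BAnd (NLess (NConst 0) (nv 14)) (NLess (NConst 0) (nv 13)))"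
  then show "triple I walk_body (tick (1 + bcost (BAnd (NLess (NConst 0) (nv 14)) (NLess (NConst 0) (nv 13)))) s)
      (\<lambda>s'. walk_inv l i K s' \<and> nmem s' 14 0 < nmem s 14 0) (walk_pot a l) (walk_pot a l s)"
    by (intro walk_body) auto
next
  fix s assume s: "walk_inv l i K s" "\<not> bval s (BAnd (NLess (NConst 0) (nv 14)) (NLess (NConst 0) (nv 13)))"
  \<comment> \<open>No steps are left or the walk has terminated: both conditional moments vanish
    and the potential is the bare square.\<close>
  then have "walk_mean l (nmem s 14 0) (nmem s 13 0) = 0" "walk_sq l (nmem s 14 0) (nmem s 13 0) = 0"
    by (auto simp: walk_mean_def walk_sq_def)
  moreover have "clock s \<le> K" using s(1) unfolding walk_inv_def by linarith
  ultimately show "(sampling_frame N0 R0 (tick (1 + bcost (BAnd (NLess (NConst 0) (nv 14)) (NLess (NConst 0) (nv 13)))) s) \<and>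
      nmem (tick (1 + bcost (BAnd (NLess (NConst 0) (nv 14)) (NLess (NConst 0) (nv 13)))) s) 12 0 = i \<and>
      clock (tick (1 + bcost (BAnd (NLess (NConst 0) (nv 14)) (NLess (NConst 0) (nv 13)))) s) \<le> K + 20) \<and>
      (rmem (tick (1 + bcost (BAnd (NLess (NConst 0) (nv 14)) (NLess (NConst 0) (nv 13)))) s) 11 0 - a)\<^sup>2 \<le> walk_pot a l s"
    using s(1) by (simp add: walk_inv_def sampling_frame_def walk_pot_def)
qed (rule assms)

text \<open>The expectation of Y in the overview: an average over \<open>L\<close> levels and over
  starts drawn from \<open>t\<close>.\<close>

definition sample_mean :: real where
  "sample_mean = remaining L r / (real L * lp_norm 1 t)"

lemma remaining_eq: "remaining L r = (\<Sum>l<L. \<Sum>v<n. t $ v * walk_sum n W (r l) (L - l) v)"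
proof -
  have "remaining L r = (\<Sum>l\<le>L. \<Sum>v<n. t $ v * walk_sum n W (r l) (L - l) v)"
    unfolding remaining_def by (simp only: sum_walk_sum_eq_occupation)
  then show ?thesis by (simp add: lessThan_Suc_atMost[symmetric])
qed

lemma remaining_nonneg: "0 \<le> remaining L r"
  unfolding remaining_eq using t_nonneg r_nonneg W_nonneg
  by (intro sum_nonneg mult_nonneg_nonneg walk_sum_nonneg) auto

lemma sample_mean_nonneg: "0 \<le> sample_mean"
  using remaining_nonneg norm1_t_pos by (simp add: sample_mean_def)

lemma remaining_le: "remaining L r \<le> lp_norm 1 t * (real L)\<^sup>2 * \<theta>"
proof -
  have "walk_sum n W (r l) (L - l) v \<le> real L * \<theta>" if "l < L" "v < n" for l v
  proof -
    have "walk_sum n W (r l) (L - l) v \<le> real (L - l) * \<theta>"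
      using that r_le \<theta> W_nonneg W_row by (intro walk_sum_le) auto
    also have "\<dots> \<le> real L * \<theta>" using \<theta> by (intro mult_right_mono) auto
    finally show ?thesis .
  qed
  then have "remaining L r \<le> (\<Sum>l<L. \<Sum>v<n. t $ v * (real L * \<theta>))"
    unfolding remaining_eq using t_nonneg by (intro sum_mono mult_left_mono) auto
  also have "\<dots> = lp_norm 1 t * (real L)\<^sup>2 * \<theta>"
    unfolding norm1_t by (simp add: sum_distrib_right[symmetric] power2_eq_square)
  finally show ?thesis .
qed

lemma sample_second_moment:
  "(\<Sum>l<L. \<Sum>v<n. t $ v * walk_sum_sq n W (r l) (L - l) v) / (real L * lp_norm 1 t) \<le> real L * \<theta> * sample_mean"
proof -
  have "walk_sum_sq n W (r l) (L - l) v \<le> real L * \<theta> * walk_sum n W (r l) (L - l) v" if "l < L" "v < n" for l v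
  proof -
    have "walk_sum_sq n W (r l) (L - l) v \<le> real (L - l) * \<theta> * walk_sum n W (r l) (L - l) v"
      using that r_nonneg r_le \<theta> W_nonneg W_row by (intro walk_sum_sq_le) auto
    also have "\<dots> \<le> real L * \<theta> * walk_sum n W (r l) (L - l) v"
      using \<theta> that r_nonneg W_nonneg by (intro mult_right_mono walk_sum_nonneg) auto
    finally show ?thesis .
  qed
  then have "(\<Sum>l<L. \<Sum>v<n. t $ v * walk_sum_sq n W (r l) (L - l) v) \<le>
      (\<Sum>l<L. \<Sum>v<n. t $ v * (real L * \<theta> * walk_sum n W (r l) (L - l) v))"
    using t_nonneg by (intro sum_mono mult_left_mono) auto
  also have "\<dots> = real L * \<theta> * remaining L r"
    unfolding remaining_eq by (simp add: sum_distrib_left mult_ac)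
  finally have "(\<Sum>l<L. \<Sum>v<n. t $ v * walk_sum_sq n W (r l) (L - l) v) / (real L * lp_norm 1 t) \<le>
      real L * \<theta> * remaining L r / (real L * lp_norm 1 t)"
    using norm1_t_pos by (intro divide_right_mono) auto
  then show ?thesis by (simp only: sample_mean_def times_divide_eq_right)
qed

text \<open>The accumulator is shared by all samples. Given its value, a new sample comes with one
  more mean in the centre, so cross terms cancel and only a variance is added, here bounded by the
  second moment.\<close>

lemma sample_body:
  assumes "sampling_frame N0 R0 s" "nmem s 12 0 = i" "k \<le> 20"
  shows "triple I sample_body (tick k s) (\<lambda>s'. sampling_frame N0 R0 s' \<and> nmem s' 12 0 = Suc i \<and>
      clock s' \<le> clock s + 100 + L * (f_row I + 100))
    (\<lambda>s'. (rmem s' 11 0 - (1 + real i) * sample_mean)\<^sup>2)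
    ((rmem s 11 0 - real i * sample_mean)\<^sup>2 + real L * \<theta> * sample_mean)"
proof -
  define x where "x = rmem s 11 0 - (1 + real i) * sample_mean"
  define G where "G l v = x\<^sup>2 + 2 * x * walk_sum n W (r l) (L - l) v + walk_sum_sq n W (r l) (L - l) v" for l v
  have s9: "nmem s 9 0 = L" using assms(1) N0 by (simp add: sampling_frame_def)
  have walk: "triple I walk_loop s1 (\<lambda>s'. sampling_frame N0 R0 s' \<and> nmem s' 12 0 = Suc i \<and>
      clock s' \<le> clock s + 100 + L * (f_row I + 100)) (\<lambda>s'. (rmem s' 11 0 - (1 + real i) * sample_mean)\<^sup>2) (G l v)"
    if s1: "sampling_frame N0 R0 s1" "nmem s1 12 0 = Suc i" "nmem s1 10 0 = l" "nmem s1 13 0 = Suc v"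
      "nmem s1 14 0 = L - l" "rmem s1 11 0 = rmem s 11 0" "clock s1 \<le> clock s + 80" and lv: "l < L" "v < n" for s1 l v
  proof -
    have "walk_inv l (Suc i) (clock s + 80 + L * (f_row I + 100)) s1"
      using s1 lv by (auto simp: walk_inv_def intro!: add_mono mult_right_mono)
    from walk_loop[OF this, of "(1 + real i) * sample_mean"] show ?thesis
    proof (rule triple_weaken)
      show "walk_pot ((1 + real i) * sample_mean) l s1 \<le> G l v"
        using s1 by (simp add: walk_pot_def walk_mean_def walk_sq_def G_def x_def)
    qed auto
  qed
  have avg: "(\<Sum>l<L. (\<Sum>v<n. t $ v * G l v) / lp_norm 1 t) / real L \<le>
      (rmem s 11 0 - real i * sample_mean)\<^sup>2 + real L * \<theta> * sample_mean"
  proof -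
    let ?q = "\<Sum>l<L. \<Sum>v<n. t $ v * walk_sum_sq n W (r l) (L - l) v"
    have "(\<Sum>l<L. \<Sum>v<n. t $ v * G l v) = (\<Sum>l<L. \<Sum>v<n. t $ v * x\<^sup>2) + 2 * x * remaining L r + ?q"
      unfolding remaining_eq by (simp add: G_def distrib_left sum.distrib sum_distrib_left mult_ac)
    also have "(\<Sum>l<L. \<Sum>v<n. t $ v * x\<^sup>2) = real L * lp_norm 1 t * x\<^sup>2"
      unfolding norm1_t by (simp add: sum_distrib_right[symmetric])
    finally have "(\<Sum>l<L. (\<Sum>v<n. t $ v * G l v) / lp_norm 1 t) / real L =
        (real L * lp_norm 1 t * x\<^sup>2 + 2 * x * remaining L r + ?q) / (real L * lp_norm 1 t)"
      by (simp add: sum_divide_distrib[symmetric] mult.commute)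
    also have "\<dots> = x\<^sup>2 + 2 * x * sample_mean + ?q / (real L * lp_norm 1 t)"
      using L_pos norm1_t_pos by (simp add: sample_mean_def add_divide_distrib)
    also have "\<dots> \<le> x\<^sup>2 + 2 * x * sample_mean + real L * \<theta> * sample_mean"
      using sample_second_moment by simp
    \<comment> \<open>\<open>x\<close> is the old deviation minus one mean; completing the square
      recovers the old deviation, and the negative square of the mean is dropped afterwards.\<close>
    also have "x\<^sup>2 + 2 * x * sample_mean = (rmem s 11 0 - real i * sample_mean)\<^sup>2 - sample_mean\<^sup>2"
      by (simp add: x_def power2_eq_square algebra_simps)
    finally show ?thesis using zero_le_power2[of sample_mean] by linarith
  qed
  show ?thesis
    unfolding sample_body_def block.simps
    apply (rule exec_SetN_Seq, simp add: assms(2))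
    apply (rule exec_Uniform_Seq[where G = "\<lambda>l. (\<Sum>v<n. t $ v * G l v) / lp_norm 1 t"])
    subgoal for l
      apply (simp add: s9)
      apply (rule exec_SampleT_Seq[where G = "G l"])
      subgoal using finite_subset[OF sample_t_support] by (simp add: sys)
      subgoal for v
        apply simp
        apply (rule exec_SetN_Seq, simp)
        apply (rule exec_SetN_Seq, simp add: s9)
        apply (rule walk)
        using assms(1,3) s9 L_pos sample_t_support
        apply (auto simp: sampling_frame_def sys)
        done
      subgoal by (simp add: sys expectation_sample_t)
      done
    subgoal
      using avg L_pos by (simp add: s9 lessThan_Suc_atMost[symmetric])
    done
qed

lemma sample_loop:
  assumes s: "sampling_frame N0 R0 s" "nmem s 12 0 = 0" "rmem s 11 0 = 0" and Nt: "0 \<le> R0 8 0"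
  defines "N \<equiv> nat \<lfloor>R0 8 0\<rfloor>"
  shows "triple I sample_loop s (\<lambda>s'. sampling_frame N0 R0 s' \<and> nmem s' 12 0 = N \<and>
      clock s' \<le> clock s + 20 + N * (100 + L * (f_row I + 100)))
    (\<lambda>s'. (rmem s' 11 0 - real N * sample_mean)\<^sup>2) (R0 8 0 * (real L * \<theta> * sample_mean))"
proof -
  define V where "V = real L * \<theta> * sample_mean"
  define F where "F s' = (rmem s' 11 0 - real (nmem s' 12 0) * sample_mean)\<^sup>2 + (R0 8 0 - real (nmem s' 12 0)) * V" for s' :: state
  define Inv where "Inv s' \<longleftrightarrow> sampling_frame N0 R0 s' \<and> nmem s' 12 0 \<le> N \<and>
    clock s' \<le> clock s + nmem s' 12 0 * (100 + L * (f_row I + 100))" for s' :: state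
  have V: "0 \<le> V" using \<theta> sample_mean_nonneg by (simp add: V_def)
  have "triple I sample_loop s (\<lambda>s'. sampling_frame N0 R0 s' \<and> nmem s' 12 0 = N \<and>
      clock s' \<le> clock s + 20 + N * (100 + L * (f_row I + 100)))
    (\<lambda>s'. (rmem s' 11 0 - real N * sample_mean)\<^sup>2) (F s)"
    unfolding sample_loop_def
  proof (rule triple_While[where Inv = Inv and V = "\<lambda>s'. N - nmem s' 12 0"])
    show "Inv s" using s by (simp add: Inv_def)
  next
    fix s1 assume s1: "Inv s1" "bval s1 (BNot (RLess (rv 8) (RNat (succ (nv 12)))))"
    define i where "i = nmem s1 12 0"
    have fr: "sampling_frame N0 R0 s1" and ck: "clock s1 \<le> clock s + i * (100 + L * (f_row I + 100))"
      using s1(1) by (simp_all add: Inv_def i_def)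
    have "rmem s1 8 0 = R0 8 0" using fr by (simp add: sampling_frame_def)
    then have "real (Suc i) \<le> R0 8 0" using s1(2) by (simp add: i_def)
    then have iN: "i < N" unfolding N_def by (simp add: Suc_le_eq[symmetric] le_nat_floor)
    have "triple I sample_body (tick (1 + bcost (BNot (RLess (rv 8) (RNat (succ (nv 12)))))) s1)
      (\<lambda>s'. sampling_frame N0 R0 s' \<and> nmem s' 12 0 = Suc i \<and> clock s' \<le> clock s1 + 100 + L * (f_row I + 100))
      (\<lambda>s'. (rmem s' 11 0 - (1 + real i) * sample_mean)\<^sup>2 + (R0 8 0 - (1 + real i)) * V)
      ((rmem s1 11 0 - real i * sample_mean)\<^sup>2 + real L * \<theta> * sample_mean + (R0 8 0 - (1 + real i)) * V)"
      using fr by (intro triple_add_const sample_body) (simp_all add: i_def)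
    then show "triple I sample_body (tick (1 + bcost (BNot (RLess (rv 8) (RNat (succ (nv 12)))))) s1)
        (\<lambda>s'. Inv s' \<and> N - nmem s' 12 0 < N - nmem s1 12 0) F (F s1)"
    proof (rule triple_weaken)
      show "(rmem s1 11 0 - real i * sample_mean)\<^sup>2 + real L * \<theta> * sample_mean + (R0 8 0 - (1 + real i)) * V \<le> F s1"
        by (simp add: F_def V_def[symmetric] i_def left_diff_distrib distrib_right)
      show "Inv s' \<and> N - nmem s' 12 0 < N - nmem s1 12 0"
        if "sampling_frame N0 R0 s' \<and> nmem s' 12 0 = Suc i \<and> clock s' \<le> clock s1 + 100 + L * (f_row I + 100)" for s'
        using that ck iN by (simp add: Inv_def i_def[symmetric] diff_less_mono2)
    qed (simp add: F_def)
  next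
    fix s1 assume s1: "Inv s1" "\<not> bval s1 (BNot (RLess (rv 8) (RNat (succ (nv 12)))))"
    have "rmem s1 8 0 = R0 8 0" using s1(1) by (simp add: Inv_def sampling_frame_def)
    then have "R0 8 0 < real (Suc (nmem s1 12 0))" using s1(2) by simp
    then have "N \<le> nmem s1 12 0" unfolding N_def using Nt by linarith
    then have i: "nmem s1 12 0 = N" using s1(1) by (simp add: Inv_def)
    have "0 \<le> (R0 8 0 - real N) * V" using V Nt unfolding N_def by (intro mult_nonneg_nonneg) auto
    then show "(sampling_frame N0 R0 (tick (1 + bcost (BNot (RLess (rv 8) (RNat (succ (nv 12)))))) s1) \<and>
        nmem (tick (1 + bcost (BNot (RLess (rv 8) (RNat (succ (nv 12)))))) s1) 12 0 = N \<and>
        clock (tick (1 + bcost (BNot (RLess (rv 8) (RNat (succ (nv 12)))))) s1) \<le> clock s + 20 + N * (100 + L * (f_row I + 100))) \<and>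
        (rmem (tick (1 + bcost (BNot (RLess (rv 8) (RNat (succ (nv 12)))))) s1) 11 0 - real N * sample_mean)\<^sup>2 \<le> F s1"
      using s1(1) i by (simp add: Inv_def F_def sampling_frame_def)
  qed
  then show ?thesis by (rule triple_weaken) (simp_all add: F_def V_def s)
qed

lemma average:
  assumes "sampling_frame N0 R0 s"
  shows "triple I average s (\<lambda>s'. result s' = R0 1 0 + R0 0 3 * real L * rmem s 11 0 / (2 * real (nmem s 12 0)) \<and>
    clock s' \<le> clock s + 30) (\<lambda>_. g) g"
  unfolding average_def
  by (rule exec_SetR) (use assms N0 in \<open>simp_all add: result_def sampling_frame_def\<close>)

end

section \<open>Correctness and running time\<close>

definition estimate :: com where
  "estimate = Seq load_b (Seq set_length (Seq set_params (Seq push_loop (Seq sample_loop average))))"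

text \<open>For \<epsilon> \<ge> 1 the answer 0 is accurate enough. The case \<epsilon> < 1 is the
  one in which the argument of the logarithm is at least 2.\<close>

definition solver :: com where
  "solver = Cond (RLess (par 0) (RNat (NConst 1))) estimate (setr 1 (RNat (NConst 0)))"

context rcddz_instance
begin

text \<open>Chebyshev's inequality in the form that \<open>triple\<close> can use: pointwise in the
  accumulated sum \<open>z\<close>, the indicator of failure is dominated by a multiple of the
  squared deviation. Half of the tolerance is spent on truncation, half on sampling.\<close>

lemma chebyshev_estimate:
  fixes L :: nat and N :: nat
  assumes L: "0 < L" and \<theta>: "0 < \<theta>" and \<epsilon>: "0 < \<epsilon>" "\<epsilon> < 1" and \<eta>: "0 < \<eta>" "\<eta> \<le> target"
    and rem: "0 \<le> rm" "rm \<le> lp_norm 1 t * (real L)\<^sup>2 * \<theta>" "out + 1/2 * rm = truncated L" "0 \<le> out"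
    and tail: "target - truncated L \<le> \<epsilon> * \<eta> / 2"
  defines "Nt \<equiv> 32 * (real L * real L) * \<theta> * lp_norm 1 t / (\<epsilon> * \<epsilon> * \<eta>)"
  defines "N \<equiv> nat \<lfloor>Nt\<rfloor>" and "\<mu> \<equiv> rm / (real L * lp_norm 1 t)"
  shows "\<exists>\<kappa>\<ge>0. (\<forall>z. of_bool (\<not> \<bar>out + lp_norm 1 t * real L * z / (2 * real N) - target\<bar> \<le> \<epsilon> * target)
      \<le> \<kappa> * (z - real N * \<mu>)\<^sup>2) \<and> \<kappa> * (Nt * (real L * \<theta> * \<mu>)) \<le> 1/4"
proof -
  define T where "T = lp_norm 1 t"
  have T: "0 < T" using norm1_t_pos by (simp add: T_def)
  have tgt: "0 < target" using \<eta> by linarith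
  have tr: "\<bar>truncated L - target\<bar> \<le> \<epsilon> * target / 2"
  proof -
    have "\<epsilon> * \<eta> / 2 \<le> \<epsilon> * target / 2" using \<epsilon> \<eta> by simp
    then show ?thesis using tail truncated_le_target[of L] by linarith
  qed
  have Nt0: "0 < Nt" unfolding Nt_def using L \<theta> \<epsilon> \<eta> T by (simp add: T_def)
  have eq: "32 * ((real L)\<^sup>2 * \<theta> * T) = Nt * (\<epsilon> * \<epsilon> * \<eta>)"
    unfolding Nt_def using \<epsilon> \<eta> by (simp add: T_def power2_eq_square)
  show ?thesis
  proof (cases "N = 0")
    case True
    \<comment> \<open>Division by zero yields \<open>0\<close>, so the output is just \<open>out\<close>.\<close>
    then have "Nt < 1" by (simp add: N_def)
    then have "Nt * (\<epsilon> * \<epsilon> * \<eta>) \<le> 1 * (\<epsilon> * \<epsilon> * \<eta>)" using \<epsilon> \<eta> by (intro mult_right_mono) auto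
    also have "\<dots> \<le> \<epsilon> * target"
    proof -
      have "\<epsilon> * (\<epsilon> * \<eta>) \<le> \<epsilon> * (1 * target)" using \<epsilon> \<eta> by (intro mult_left_mono mult_mono) auto
      then show ?thesis by (simp add: mult.assoc)
    qed
    finally have "32 * rm \<le> \<epsilon> * target" using rem(2) eq by (simp add: T_def mult_ac)
    then have "\<bar>out - target\<bar> \<le> \<epsilon> * target" using tr rem by linarith
    then show ?thesis using True by (intro exI[of _ 0]) simp
  next
    case False
    then have N1: "1 \<le> real N" by simp
    have NtN: "Nt \<le> 2 * real N"
    proof -
      have "Nt < real N + 1" unfolding N_def using Nt0 by linarith
      then show ?thesis using N1 by linarith
    qed
    define a where "a = T * real L / (2 * real N)"
    define \<delta> where "\<delta> = \<epsilon> * target / 2"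
    have \<delta>: "0 < \<delta>" using \<epsilon> tgt by (simp add: \<delta>_def)
    have a: "0 < a" using T L N1 by (simp add: a_def)
    have aN: "a * (real N * \<mu>) = 1/2 * rm"
      using N1 L T by (simp add: a_def \<mu>_def T_def)
    define \<kappa> where "\<kappa> = (a / \<delta>)\<^sup>2"
    have "of_bool (\<not> \<bar>out + T * real L * z / (2 * real N) - target\<bar> \<le> \<epsilon> * target) \<le> \<kappa> * (z - real N * \<mu>)\<^sup>2" for z
    proof (cases "\<bar>out + T * real L * z / (2 * real N) - target\<bar> \<le> \<epsilon> * target")
      case False
      have "out + T * real L * z / (2 * real N) - truncated L = a * (z - real N * \<mu>)"
        using aN rem(3) by (simp add: a_def right_diff_distrib)
      then have "\<delta> < \<bar>a * (z - real N * \<mu>)\<bar>" using False tr unfolding \<delta>_def by linarith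
      then have "1 < \<bar>a * (z - real N * \<mu>) / \<delta>\<bar>" using \<delta> by (simp add: abs_divide)
      then have "1 < \<bar>a * (z - real N * \<mu>) / \<delta>\<bar>\<^sup>2" by (rule one_less_power) simp
      then have "1 < (a * (z - real N * \<mu>) / \<delta>)\<^sup>2" by (simp only: power2_abs)
      then show ?thesis using False by (simp add: \<kappa>_def power_mult_distrib power_divide)
    qed (simp add: \<kappa>_def)
    moreover have "\<kappa> * (Nt * (real L * \<theta> * \<mu>)) \<le> 1/4"
    proof -
      have "\<kappa> * (Nt * (real L * \<theta> * \<mu>)) = Nt / (real N)\<^sup>2 * (T * (real L)\<^sup>2 * \<theta> * rm) / (\<epsilon> * target)\<^sup>2"
        unfolding \<kappa>_def a_def \<delta>_def \<mu>_def T_def[symmetric]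
        using N1 L T \<epsilon> tgt by (simp add: power2_eq_square field_simps)
      \<comment> \<open>The constant 32 is made for this: Nt \<le> 2 N gives the 4, and rm \<le> 2
        target, which uses 0 \<le> out, gives the 2, so that 8 / 32 = 1 / 4 remains.\<close>
      also have "\<dots> \<le> 4 / Nt * (T * (real L)\<^sup>2 * \<theta> * (2 * target)) / (\<epsilon> * target)\<^sup>2"
      proof (intro divide_right_mono mult_mono)
        have "Nt * Nt \<le> 4 * (real N)\<^sup>2"
          using mult_mono[OF NtN NtN] Nt0 by (simp add: power2_eq_square)
        then show "Nt / (real N)\<^sup>2 \<le> 4 / Nt" using N1 Nt0 by (simp add: field_simps)
        show "rm \<le> 2 * target" using rem truncated_le_target[of L] by linarith
      qed (use T \<theta> rem tgt Nt0 in auto)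
      also have "\<dots> = (32 * ((real L)\<^sup>2 * \<theta> * T)) / (Nt * (\<epsilon> * \<epsilon> * target)) / 4"
        using Nt0 tgt \<epsilon> by (simp add: power2_eq_square field_simps)
      also have "\<dots> = \<eta> / target / 4"
        unfolding eq using Nt0 \<epsilon> by simp
      also have "\<dots> \<le> 1/4" using \<eta> tgt by simp
      finally show ?thesis .
    qed
    ultimately show ?thesis
      unfolding T_def by (intro exI[of _ \<kappa>]) (simp add: \<kappa>_def)
  qed
qed

lemma estimate_correct:
  assumes s: "nmem s = (\<lambda>a i. if a = 0 \<and> i = 0 then n else 0)"
      "rmem s = (\<lambda>a i. if a = 0 then ps i else 0)" "clock s \<le> 10"
    and ps: "ps 0 = \<epsilon>" "ps 1 = \<gamma>" "ps 2 = \<eta>" "ps 3 = lp_norm 1 t" "ps 4 = real (f_row I)"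
    and \<epsilon>: "0 < \<epsilon>" "\<epsilon> < 1" and \<eta>: "0 < \<eta>" "\<eta> \<le> target"
  defines "\<Lambda> \<equiv> log_arg \<gamma> (\<epsilon> * \<eta>) (ps 5) (ps 6) (ps 7) (ps 8) (ps 9)"
  defines "L \<equiv> Suc (nat \<lfloor>ln \<Lambda> / \<gamma>\<rfloor>)"
  assumes \<Lambda>: "bt / (\<gamma> * (\<epsilon> * \<eta>)) \<le> \<Lambda>" "1 \<le> \<Lambda>"
  defines "\<tau> \<equiv> (real L)\<^sup>2 * sqrt (real (f_row I)) * sqrt (lp_norm 1 t) * sqrt (lp_norm 1 b) / (\<epsilon> * sqrt \<eta>)"
  shows "triple I estimate s (\<lambda>s'. real (clock s') \<le> 240 + 161 * real (norm0 b) + 20 * real L + (620 / c + 6432) * \<tau>)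
    (\<lambda>s'. of_bool (\<not> \<bar>result s' - target\<bar> \<le> \<epsilon> * target)) (1/4)"
proof -
  define f where "f = real (f_row I)"
  define T where "T = lp_norm 1 t"
  define B where "B = lp_norm 1 b"
  have pos: "1 \<le> f" "0 < T" "0 < B" using f_row_pos norm1_t_pos norm1_b_pos by (simp_all add: f_def T_def B_def)
  have L: "1 \<le> real L" "0 < L" by (simp_all add: L_def)
  define \<theta> where "\<theta> = \<epsilon> * sqrt (\<eta> * B / (T * f)) / real L"
  define Nt where "Nt = 32 * (real L * real L) * \<theta> * T / (\<epsilon> * \<epsilon> * \<eta>)"
  have \<theta>: "0 < \<theta>" unfolding \<theta>_def using \<epsilon> \<eta> pos L by simp
  have Nt: "0 < Nt" unfolding Nt_def using \<theta> \<epsilon> \<eta> pos L by simp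
  have sq: "sqrt B * sqrt B = B" "sqrt T * sqrt T = T" "sqrt f * sqrt f = f" "sqrt \<eta> * sqrt \<eta> = \<eta>"
    using pos \<eta> by simp_all
  have spos: "0 < sqrt B" "0 < sqrt T" "0 < sqrt f" "0 < sqrt \<eta>" using pos \<eta> by simp_all
  have \<theta>': "\<theta> = \<epsilon> * sqrt \<eta> * sqrt B / (sqrt T * sqrt f * real L)"
    unfolding \<theta>_def by (simp add: real_sqrt_divide real_sqrt_mult)
  \<comment> \<open>Cost of pushing: L B is the initial potential, and each unit of it pays for O(1
    / \<theta>) time.\<close>
  have t1: "real L * B / \<theta> = \<tau>"
  proof -
    have "real L * B / \<theta> = real L * (sqrt B * sqrt B) / (\<epsilon> * sqrt \<eta> * sqrt B / (sqrt T * sqrt f * real L))"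
      by (simp only: \<theta>' sq)
    also have "\<dots> = \<tau>"
      unfolding \<tau>_def f_def[symmetric] T_def[symmetric] B_def[symmetric]
      using spos L \<epsilon> by (simp add: field_simps power2_eq_square)
    finally show ?thesis .
  qed
  \<comment> \<open>Cost of sampling: the same \<tau> up to the constant, as arranged by the choice
    of \<theta>.\<close>
  have t2: "Nt * real L * f = 32 * \<tau>"
  proof -
    have "Nt * real L * f = 32 * (real L * real L) * \<theta> * (sqrt T * sqrt T) / (\<epsilon> * \<epsilon> * (sqrt \<eta> * sqrt \<eta>)) * real L * (sqrt f * sqrt f)"
      by (simp only: Nt_def sq)
    also have "\<dots> = 32 * \<tau>"
      unfolding \<tau>_def f_def[symmetric] T_def[symmetric] B_def[symmetric] \<theta>'
      using spos L \<epsilon> by (simp add: field_simps power2_eq_square)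
    finally show ?thesis .
  qed
  have tail: "target - truncated L \<le> \<epsilon> * \<eta> / 2"
  proof (rule tail_small[OF _ \<Lambda>(1)])
    show "ln \<Lambda> / \<gamma> \<le> real L" unfolding L_def by linarith
  qed (use \<epsilon> \<eta> \<Lambda> in auto)
  have ln0: "0 \<le> ln \<Lambda> / \<gamma>" using \<Lambda>(2) \<gamma>_pos by simp
  let ?good = "\<lambda>s'. \<bar>result s' - target\<bar> \<le> \<epsilon> * target"
  let ?C = "240 + 161 * real (norm0 b) + 20 * real L + (620 / c + 6432) * \<tau>"
  show ?thesis
    unfolding estimate_def
  proof (rule triple_Seq_hoare[OF load_b[OF s]])
    fix s1 :: state assume s1: "loaded ps s1"
    have r1: "nmem s1 9 0 = 0" "rmem s1 0 = ps" using s1 by (simp_all add: loaded_def)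
    have x1: "ln (log_arg (rmem s1 0 1) (rmem s1 0 0 * rmem s1 0 2) (rmem s1 0 5) (rmem s1 0 6) (rmem s1 0 7)
        (rmem s1 0 8) (rmem s1 0 9)) / rmem s1 0 1 = ln \<Lambda> / \<gamma>"
      using ps by (simp add: r1 \<Lambda>_def)
    note sl = set_length[of s1 I, unfolded x1, OF ln0 r1(1), folded L_def]
    show "triple I (Seq set_length (Seq set_params (Seq push_loop (Seq sample_loop average)))) s1
        (\<lambda>s'. real (clock s') \<le> ?C) (\<lambda>s'. of_bool (\<not> ?good s')) (1/4)"
    proof (rule triple_Seq_hoare[OF sl])
      fix s2 :: state assume s2: "nmem s2 = (nmem s1)(9 := (nmem s1 9)(0 := L)) \<and>
        rmem s2 = (rmem s1)(12 := (rmem s1 12)(0 := ln \<Lambda> / \<gamma>)) \<and> clock s2 \<le> clock s1 + 70 + 20 * L"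
      have th: "rmem s2 0 0 * sqrt (rmem s2 0 2 * rmem s2 6 0 / (rmem s2 0 3 * rmem s2 0 4)) / real (nmem s2 9 0) = \<theta>"
        using s2 s1 ps by (simp add: loaded_def \<theta>_def T_def B_def f_def)
      have nt: "32 * (real (nmem s2 9 0) * real (nmem s2 9 0)) * \<theta> * rmem s2 0 3 / (rmem s2 0 0 * rmem s2 0 0 * rmem s2 0 2) = Nt"
        using s2 s1 ps by (simp add: loaded_def Nt_def T_def)
      note sp = set_params[of I s2, unfolded th nt]
      show "triple I (Seq set_params (Seq push_loop (Seq sample_loop average))) s2
          (\<lambda>s'. real (clock s') \<le> ?C) (\<lambda>s'. of_bool (\<not> ?good s')) (1/4)"
      proof (rule triple_Seq_hoare[OF sp])
        fix s3 :: state assume s3: "nmem s3 = nmem s2 \<and> clock s3 \<le> clock s2 + 80 \<and>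
          rmem s3 = (rmem s2)(5 := (rmem s2 5)(0 := \<theta>), 8 := (rmem s2 8)(0 := Nt))"
        have reg: "nmem s3 0 0 = n" "nmem s3 9 0 = L" "rmem s3 5 0 = \<theta>" "rmem s3 8 0 = Nt" "rmem s3 0 = ps"
            "nmem s3 7 0 = norm0 b" "rmem s3 1 0 = 0" "rmem s3 11 0 = 0" "nmem s3 12 0 = 0"
            "nmem s3 6 = (\<lambda>_. 0)" "nmem s3 5 = nmem s1 5"
          using s1 s2 s3 by (simp_all add: loaded_def)
        have ck3: "clock s3 \<le> 180 + 61 * norm0 b + 20 * L"
          using s1 s2 s3 by (simp add: loaded_def)
        have res3: "res s3 l v = (if l = 0 then b $ v / d v else 0)" if "v < n" for l v
        proof -
          have "rmem s3 2 = rmem s1 2" using s2 s3 by simp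
          \<comment> \<open>Loading fills only cells below \<open>n\<close>, which form level 0; all
            higher levels start at 0.\<close>
          moreover have "\<not> l * n + v < n" if "l \<noteq> 0" using that by (cases l) auto
          ultimately show ?thesis using s1 that unfolding loaded_def res_def by auto
        qed
        have sum3: "(\<Sum>l\<le>L. \<Sum>v<n. w l v * res s3 l v) = (\<Sum>v<n. w 0 v * (b $ v / d v))" for w :: "nat \<Rightarrow> nat \<Rightarrow> real"
        proof -
          have "(\<Sum>l\<le>L. \<Sum>v<n. w l v * res s3 l v) = (\<Sum>l\<le>L. if l = 0 then \<Sum>v<n. w 0 v * (b $ v / d v) else 0)"
            by (intro sum.cong refl) (auto simp: res3)
          then show ?thesis by simp
        qed
        have pot3: "potential L (res s3) = real L * B"
        proof -
          have "potential L (res s3) = (\<Sum>v<n. real L * d v * (b $ v / d v))"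
            unfolding potential_def sum3 by simp
          also have "\<dots> = (\<Sum>v<n. real L * b $ v)" using d_pos by (intro sum.cong) (auto simp: less_imp_neq[symmetric])
          finally show ?thesis unfolding B_def norm1_b by (simp add: sum_distrib_left)
        qed
        have rem3: "remaining L (res s3) = 2 * truncated L"
          unfolding remaining_def sum3 truncated_def by (simp add: sum_walk_sum_eq_occupation)
        define K where "K = real (clock s3) + 100 * real (norm0 b) + 620 / (c * \<theta>) * (real L * B)"
        have K: "K \<le> 180 + 161 * real (norm0 b) + 20 * real L + 620 / c * \<tau>"
        proof -
          have "620 / (c * \<theta>) * (real L * B) = 620 / c * \<tau>" unfolding t1[symmetric] by simp
          then show ?thesis unfolding K_def using ck3 by linarith
        qed
        have inv: "push_inv L \<theta> K s3 s3"
          unfolding push_inv_def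
        proof (intro conjI allI impI)
          show "same_frame s3 s3" by (simp add: same_frame_def)
          show "nmem s3 5 i < n" if "i < nmem s3 7 0" for i using that s1 reg by (simp add: loaded_def)
          show "0 \<le> res s3 l v" if "v < n" for l v
            using that b_nonneg d_pos by (auto simp: res3 intro!: divide_nonneg_pos)
          show "\<exists>i<nmem s3 7 0. nmem s3 5 i = v \<and> nmem s3 6 i = l" if "l < L" "v < n" "\<theta> < res s3 l v" for l v
          proof -
            have "l = 0" "b $ v \<noteq> 0" using that \<theta> by (auto simp: res3 split: if_splits)
            then show ?thesis using s1 that(2) reg by (simp add: loaded_def)
          qed
          show "rmem s3 1 0 + 1/2 * remaining L (res s3) = truncated L" using rem3 reg by simp
          show "real (clock s3) + 100 * real (nmem s3 7 0) + 620 / (c * \<theta>) * potential L (res s3) \<le> K"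
            by (simp add: K_def pot3 reg)
        qed (simp_all only: reg order_refl)
        show "triple I (Seq push_loop (Seq sample_loop average)) s3
            (\<lambda>s'. real (clock s') \<le> ?C) (\<lambda>s'. of_bool (\<not> ?good s')) (1/4)"
        proof (rule triple_Seq_hoare[OF push_loop[OF inv \<theta>]])
          fix s4 :: state assume s4: "same_frame s3 s4 \<and> nmem s4 0 0 = n \<and>
            (\<forall>l v. l < L \<longrightarrow> v < n \<longrightarrow> 0 \<le> res s4 l v \<and> res s4 l v \<le> \<theta>) \<and>
            rmem s4 1 0 + 1/2 * remaining L (res s4) = truncated L \<and> real (clock s4) \<le> K + 5 \<and> 0 \<le> rmem s4 1 0"
          have reg4: "nmem s4 0 0 = n" "nmem s4 9 0 = L" "rmem s4 8 0 = Nt" "rmem s4 0 = ps" "rmem s4 11 0 = 0" "nmem s4 12 0 = 0"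
            using s4 reg unfolding same_frame_def by simp_all
          have fr4: "sampling_frame (nmem s4) (rmem s4) s4" by (simp add: sampling_frame_def)
          have r4: "res s4 l v = rmem s4 2 (l * n + v)" for l v by (simp add: res_def)
          have b4: "\<And>l v. l < L \<Longrightarrow> v < n \<Longrightarrow> 0 \<le> res s4 l v" "\<And>l v. l < L \<Longrightarrow> v < n \<Longrightarrow> res s4 l v \<le> \<theta>"
            using s4 by blast+
          interpret smp: sampling n M b t \<gamma> I c "nmem s4" "rmem s4" "res s4" L \<theta>
            by unfold_locales (use reg4 r4 L(2) less_imp_le[OF \<theta>] b4 in blast)+
          define N where "N = nat \<lfloor>Nt\<rfloor>"
          define \<mu> where "\<mu> = remaining L (res s4) / (real L * lp_norm 1 t)"
          have \<mu>: "smp.sample_mean = \<mu>"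
            unfolding \<mu>_def by (rule smp.sample_mean_def)
          have Nt': "0 \<le> rmem s4 8 0" using Nt reg4 by simp
          have "\<exists>\<kappa>\<ge>0. (\<forall>z. of_bool (\<not> \<bar>rmem s4 1 0 + lp_norm 1 t * real L * z / (2 * real N) - target\<bar> \<le> \<epsilon> * target)
              \<le> \<kappa> * (z - real N * \<mu>)\<^sup>2) \<and> \<kappa> * (Nt * (real L * \<theta> * \<mu>)) \<le> 1/4"
            unfolding N_def \<mu>_def Nt_def T_def
          proof (rule chebyshev_estimate[OF L(2) \<theta> \<epsilon> \<eta> _ _ _ _ tail])
            show "0 \<le> remaining L (res s4)" by (rule smp.remaining_nonneg)
            show "remaining L (res s4) \<le> lp_norm 1 t * (real L)\<^sup>2 * \<theta>" by (rule smp.remaining_le)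
          qed (use s4 in blast)+
          then obtain \<kappa> where \<kappa>: "0 \<le> \<kappa>"
              "\<And>z. of_bool (\<not> \<bar>rmem s4 1 0 + lp_norm 1 t * real L * z / (2 * real N) - target\<bar> \<le> \<epsilon> * target) \<le> \<kappa> * (z - real N * \<mu>)\<^sup>2"
              "\<kappa> * (Nt * (real L * \<theta> * \<mu>)) \<le> 1/4"
            by blast
          note loop = smp.sample_loop[OF fr4 reg4(6,5) Nt', unfolded reg4(3) \<mu> N_def[symmetric]]
          show "triple I (Seq sample_loop average) s4
              (\<lambda>s'. real (clock s') \<le> ?C) (\<lambda>s'. of_bool (\<not> ?good s')) (1/4)"
          proof (rule triple_Seq)
            show "triple I sample_loop s4 (\<lambda>s'. sampling_frame (nmem s4) (rmem s4) s' \<and> nmem s' 12 0 = N \<and>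
                clock s' \<le> clock s4 + 20 + N * (100 + L * (f_row I + 100)))
                (\<lambda>s'. \<kappa> * (rmem s' 11 0 - real N * \<mu>)\<^sup>2) (1/4)"
              by (rule triple_weaken[OF triple_cmult[OF loop \<kappa>(1)]]) (assumption | rule order_refl \<kappa>(3))+
          next
            fix s5 :: state assume s5: "sampling_frame (nmem s4) (rmem s4) s5 \<and> nmem s5 12 0 = N \<and>
                clock s5 \<le> clock s4 + 20 + N * (100 + L * (f_row I + 100))"
            have cost: "real (N * (100 + L * (f_row I + 100))) \<le> 6432 * \<tau>"
            proof -
              have NN: "real N \<le> Nt" unfolding N_def using Nt by linarith
              have Lf: "1 \<le> real L * f" using mult_mono[of 1 "real L" 1 f] L pos by simp
              have "real (N * (100 + L * (f_row I + 100))) = real N * (100 + real L * f + 100 * real L)"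
                by (simp add: f_def algebra_simps)
              \<comment> \<open>Both 100 and 100 L are at most 100 L f, which makes 201; with the 32
                of \<open>t2\<close> this gives 6432.\<close>
              also have "\<dots> \<le> Nt * (201 * (real L * f))"
              proof (intro mult_mono NN)
                have "real L * 1 \<le> real L * f" using pos L by (intro mult_left_mono) auto
                then show "100 + real L * f + 100 * real L \<le> 201 * (real L * f)" using Lf by linarith
              qed (use Nt Lf in auto)
              also have "\<dots> = 201 * (Nt * real L * f)" by simp
              also have "\<dots> = 6432 * \<tau>" unfolding t2 by simp
              finally show ?thesis .
            qed
            have "triple I average s5 (\<lambda>s'. result s' = rmem s4 1 0 + rmem s4 0 3 * real L * rmem s5 11 0 / (2 * real (nmem s5 12 0)) \<and>
                clock s' \<le> clock s5 + 30) (\<lambda>_. \<kappa> * (rmem s5 11 0 - real N * \<mu>)\<^sup>2) (\<kappa> * (rmem s5 11 0 - real N * \<mu>)\<^sup>2)"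
              using s5 by (intro smp.average) blast
            then show "triple I average s5 (\<lambda>s'. real (clock s') \<le> ?C) (\<lambda>s'. of_bool (\<not> ?good s'))
                (\<kappa> * (rmem s5 11 0 - real N * \<mu>)\<^sup>2)"
            proof (rule triple_weaken)
              fix s' assume s': "result s' = rmem s4 1 0 + rmem s4 0 3 * real L * rmem s5 11 0 / (2 * real (nmem s5 12 0)) \<and>
                clock s' \<le> clock s5 + 30"
              have "real (clock s5) \<le> real (clock s4) + 20 + real (N * (100 + L * (f_row I + 100)))"
                using s5 by (metis (mono_tags, lifting) of_nat_add of_nat_le_iff of_nat_numeral)
              moreover have "real (clock s') \<le> real (clock s5) + 30" using s' by linarith
              moreover have "real (clock s4) \<le> K + 5" using s4 by blast
              moreover have "(620 / c + 6432) * \<tau> = 620 / c * \<tau> + 6432 * \<tau>" by (rule distrib_right)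
              ultimately show "real (clock s') \<le> ?C" using K cost by linarith
              have "result s' = rmem s4 1 0 + lp_norm 1 t * real L * rmem s5 11 0 / (2 * real N)"
                using s' s5 ps reg4 by simp
              then show "of_bool (\<not> ?good s') \<le> \<kappa> * (rmem s5 11 0 - real N * \<mu>)\<^sup>2"
                using \<kappa>(2) by metis
            qed simp
          qed
        qed
      qed
    qed
  qed
qed

text \<open>Absorbs the O(L) cost of counting up to \<open>L\<close>. With T and B the 1-norms of
  \<open>t\<close> and \<open>b\<close>, \<eta> / 2 \<le> truncated L \<le> L T B / (2 c), hence
  sqrt (c \<eta>) \<le> L sqrt (T B); the factors f \<ge> 1 and \<epsilon> < 1 only help.\<close>

lemma length_le_time:
  assumes L: "1 \<le> real L" and \<epsilon>: "0 < \<epsilon>" "\<epsilon> < 1" and \<eta>: "0 < \<eta>" "\<eta> \<le> target"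
    and tail: "target - truncated L \<le> \<epsilon> * \<eta> / 2"
  shows "real L \<le> 1 / sqrt c *
    ((real L)\<^sup>2 * sqrt (real (f_row I)) * sqrt (lp_norm 1 t) * sqrt (lp_norm 1 b) / (\<epsilon> * sqrt \<eta>))"
proof -
  define T where "T = lp_norm 1 t"
  define B where "B = lp_norm 1 b"
  define f where "f = real (f_row I)"
  have pos: "1 \<le> f" "0 < T" "0 < B" using f_row_pos norm1_t_pos norm1_b_pos by (simp_all add: f_def T_def B_def)
  have dc: "c \<le> d i" if "i < n" for i
    using entries[OF elements_matI[OF M that that refl]] d_pos[OF that] by (simp add: d_def)
  have "\<epsilon> * \<eta> \<le> 1 * \<eta>" using \<epsilon> \<eta> by (intro mult_right_mono) auto
  then have "\<eta> / 2 \<le> truncated L" using tail \<eta> by linarith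
  also have "\<dots> \<le> 1/2 * real L * T * B / c"
    unfolding T_def B_def by (rule truncated_le[OF c_pos dc])
  finally have "c * \<eta> \<le> real L * (T * B)" using c_pos by (simp add: field_simps)
  also have "\<dots> \<le> (real L)\<^sup>2 * (T * B)"
    using L pos by (intro mult_right_mono) (auto simp: self_le_power)
  finally have "sqrt (c * \<eta>) \<le> sqrt ((real L)\<^sup>2 * (T * B))" by (rule real_sqrt_le_mono)
  then have *: "sqrt c * sqrt \<eta> \<le> real L * (sqrt T * sqrt B)" by (simp add: real_sqrt_mult)
  have sp: "0 < sqrt c" "0 < sqrt \<eta>" "1 \<le> sqrt f" "0 < sqrt T" "0 < sqrt B" using c_pos \<eta> pos by simp_all
  have "real L * sqrt c * sqrt \<eta> * \<epsilon> \<le> real L * (sqrt c * sqrt \<eta>) * 1"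
    using \<epsilon> L sp by (simp add: mult.assoc)
  also have "\<dots> \<le> real L * (real L * (sqrt T * sqrt B)) * sqrt f"
  proof (rule mult_mono)
    show "real L * (sqrt c * sqrt \<eta>) \<le> real L * (real L * (sqrt T * sqrt B))"
      using * by (rule mult_left_mono) simp
  qed (use sp in auto)
  finally have "real L * sqrt c * sqrt \<eta> * \<epsilon> \<le> (real L)\<^sup>2 * sqrt f * sqrt T * sqrt B"
    by (simp add: power2_eq_square mult_ac)
  then show ?thesis
    unfolding T_def[symmetric] B_def[symmetric] f_def[symmetric]
    using sp \<epsilon> by (simp add: field_simps)
qed

lemma log_arg_of_eq: "log_arg_of \<gamma> E M b t = bt / (\<gamma> * E)"
  by (simp add: log_arg_of_def log_arg_def bt_def)

text \<open>From \<open>target_le\<close>, as \<epsilon> \<eta> is below the target. The logarithm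
  is thus bounded away from 0, and rounding the length up costs only a constant factor.\<close>

lemma log_arg_of_ge_2:
  assumes "0 < \<epsilon>" "\<epsilon> < 1" "0 < \<eta>" "\<eta> \<le> target"
  shows "2 \<le> log_arg_of \<gamma> (\<epsilon> * \<eta>) M b t"
proof -
  have "\<epsilon> * \<eta> \<le> 1 * target" using assms by (intro mult_mono) auto
  also have "\<dots> \<le> bt / (2 * \<gamma>)" using target_le by simp
  finally have "2 * (\<gamma> * (\<epsilon> * \<eta>)) \<le> bt" using \<gamma>_pos by (simp add: field_simps)
  then show ?thesis unfolding log_arg_of_eq using assms \<gamma>_pos by (simp add: le_divide_eq)
qed

lemma log_arg_mono:
  assumes "0 < E" "d_max M \<le> d'" "real (norm0 t) \<le> t0'" "lp_norm \<infinity> (diag_powr M (-1) *\<^sub>v t) \<le> ti'"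
    "real (norm0 b) \<le> b0'" "lp_norm \<infinity> (diag_powr M (-1) *\<^sub>v b) \<le> bi'"
  shows "log_arg_of \<gamma> E M b t \<le> log_arg \<gamma> E d' t0' ti' b0' bi'"
proof -
  have nn: "0 \<le> lp_norm \<infinity> (diag_powr M (-1) *\<^sub>v x)" if "x \<in> carrier_vec n" for x
    using that n_pos by (intro lp_norm_nonneg) (auto simp: carrier_matD[OF diag_powr_carrier[OF M]])
  have "d 0 \<le> d_max M"
    unfolding d_max_def d_def dim_M using n_pos by (intro Max_ge) auto
  then have dm: "0 \<le> d_max M" using d_pos[OF n_pos] by linarith
  show ?thesis
    unfolding log_arg_of_def log_arg_def
    using nn[OF t] nn[OF b] dm assms \<gamma>_pos
    by (intro mult_mono mult_nonneg_nonneg) auto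
qed

lemma solver_computes:
  fixes \<kappa> :: real
  assumes \<epsilon>: "0 < \<epsilon>" and \<eta>: "0 < \<eta>" "\<eta> \<le> target" and \<kappa>: "1 \<le> \<kappa>"
    and par: "d_max M \<le> d'" "real (norm0 t) \<le> t0'" "lp_norm \<infinity> (diag_powr M (-1) *\<^sub>v t) \<le> ti'"
      "real (norm0 b) \<le> b0'" "lp_norm \<infinity> (diag_powr M (-1) *\<^sub>v b) \<le> bi'"
    and ln_le: "ln (log_arg \<gamma> (\<epsilon> * \<eta>) d' t0' ti' b0' bi') \<le> \<kappa> * max 1 (ln (log_arg_of \<gamma> (\<epsilon> * \<eta>) M b t))"
  defines "C \<equiv> 401 + 16 * \<kappa>\<^sup>2 * (20 / sqrt c + 620 / c + 6432)"
    and "len \<equiv> 1 / \<gamma> * ln (log_arg_of \<gamma> (\<epsilon> * \<eta>) M b t)"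
  shows "computes solver I n [\<epsilon>, \<gamma>, \<eta>, lp_norm 1 t, real (f_row I), d', t0', ti', b0', bi']
    (C * real (norm0 b) + C * (sqrt (real (f_row I)) * sqrt (lp_norm 1 t) * sqrt (lp_norm 1 b)
       * len ^ 2 * (1 / \<epsilon>) * (1 / sqrt \<eta>)))
    (3/4) (\<lambda>x. \<bar>x - target\<bar> \<le> \<epsilon> * target)"
proof (rule triple_computes)
  let ?ps = "[\<epsilon>, \<gamma>, \<eta>, lp_norm 1 t, real (f_row I), d', t0', ti', b0', bi']"
  let ?T = "C * real (norm0 b) + C * (sqrt (real (f_row I)) * sqrt (lp_norm 1 t) * sqrt (lp_norm 1 b)
       * len ^ 2 * (1 / \<epsilon>) * (1 / sqrt \<eta>))"
  define X where "X = sqrt (real (f_row I)) * sqrt (lp_norm 1 t) * sqrt (lp_norm 1 b) / (\<epsilon> * sqrt \<eta>)"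
  have X: "0 \<le> X" unfolding X_def using \<epsilon> \<eta> norm1_t_pos norm1_b_pos by simp
  have T: "?T = C * real (norm0 b) + C * (len\<^sup>2 * X)"
    by (simp add: X_def mult_ac)
  define A where "A = 20 / sqrt c + 620 / c + 6432"
  have A: "0 \<le> A" using c_pos by (simp add: A_def)
  \<comment> \<open>401 = 240 + 161 covers the fixed costs because \<open>norm0 b\<close> \<ge> 1;
    16 \<kappa>^2 is the square of the factor 4 \<kappa> in \<open>L_le\<close>.\<close>
  have C: "401 \<le> C" "16 * \<kappa>\<^sup>2 * A \<le> C" unfolding C_def A_def[symmetric] using A by simp_all
  have n0: "1 \<le> real (norm0 b)" using norm0_pos[OF b b_nz] by simp
  define s where "s = tick (1 + bcost (RLess (par 0) (RNat (NConst 1)))) (initial_state n ?ps)"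
  have s: "nmem s = (\<lambda>a i. if a = 0 \<and> i = 0 then n else 0)"
      "rmem s = (\<lambda>a i. if a = 0 then if i < 10 then ?ps ! i else 0 else 0)" "clock s \<le> 10"
    by (auto simp: s_def initial_state_def fun_eq_iff)
  show "triple I solver (initial_state n ?ps) (\<lambda>s. real (clock s) \<le> ?T)
      (\<lambda>s. of_bool (\<not> \<bar>result s - target\<bar> \<le> \<epsilon> * target)) (1 - 3/4)"
    unfolding solver_def
  proof (rule triple_Cond)
    assume "\<not> bval (initial_state n ?ps) (RLess (par 0) (RNat (NConst 1)))"
    then have "1 \<le> \<epsilon>" by (simp add: initial_state_def)
    then have good: "\<bar>0 - target\<bar> \<le> \<epsilon> * target" using \<eta> by simp
    have "401 * 1 \<le> C * real (norm0 b)" using C(1) n0 by (intro mult_mono) auto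
    moreover have "0 \<le> C * (len\<^sup>2 * X)" using C(1) X by simp
    ultimately have "401 \<le> ?T" unfolding T by simp
    then show "triple I (setr 1 (RNat (NConst 0))) (tick (1 + bcost (RLess (par 0) (RNat (NConst 1)))) (initial_state n ?ps))
        (\<lambda>s. real (clock s) \<le> ?T) (\<lambda>s. of_bool (\<not> \<bar>result s - target\<bar> \<le> \<epsilon> * target)) (1 - 3/4)"
      unfolding s_def[symmetric] using good s(3)
      by (intro exec_SetR) (simp_all add: result_def)
  next
    assume "bval (initial_state n ?ps) (RLess (par 0) (RNat (NConst 1)))"
    then have \<epsilon>1: "\<epsilon> < 1" by (simp add: initial_state_def)
    define \<Lambda> where "\<Lambda> = log_arg \<gamma> (\<epsilon> * \<eta>) d' t0' ti' b0' bi'"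
    define L where "L = Suc (nat \<lfloor>ln \<Lambda> / \<gamma>\<rfloor>)"
    define lo where "lo = log_arg_of \<gamma> (\<epsilon> * \<eta>) M b t"
    have lo: "2 \<le> lo" unfolding lo_def by (rule log_arg_of_ge_2[OF \<epsilon> \<epsilon>1 \<eta>])
    have lo\<Lambda>: "lo \<le> \<Lambda>" unfolding lo_def \<Lambda>_def using \<epsilon> \<eta> by (intro log_arg_mono par) auto
    have half: "1/2 \<le> ln lo"
    proof -
      have "1/2 \<le> ln (2::real)" using ln2_ge_two_thirds by linarith
      also have "\<dots> \<le> ln lo" using lo by simp
      finally show ?thesis .
    qed
    have L1: "1 \<le> real L" by (simp add: L_def)
    \<comment> \<open>From ln lo \<ge> 1/2 follows max 1 (ln lo) \<le> 2 ln lo, hence 2 \<kappa> len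
      for the logarithm of the known bound; the 1 from rounding up is at most another 2 \<kappa>
      len, since \<gamma> \<le> 1.\<close>
    have L_le: "real L \<le> 4 * \<kappa> * len"
    proof -
      have ln0: "0 \<le> ln \<Lambda>" using lo lo\<Lambda> by simp
      have "ln \<Lambda> \<le> \<kappa> * max 1 (ln lo)" using ln_le by (simp add: \<Lambda>_def lo_def)
      also have "\<dots> \<le> \<kappa> * (2 * ln lo)" using \<kappa> half by (intro mult_left_mono) auto
      finally have "ln \<Lambda> / \<gamma> \<le> \<kappa> * (2 * ln lo) / \<gamma>" using \<gamma>_pos by (intro divide_right_mono) auto
      then have a: "ln \<Lambda> / \<gamma> \<le> 2 * \<kappa> * len" by (simp add: len_def lo_def mult_ac)
      have "1 * 1 \<le> (2 * ln lo) * (1 / \<gamma>)" using half \<gamma>_pos \<gamma>_le_1 by (intro mult_mono) auto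
      then have b1: "1 \<le> 2 * len" by (simp add: len_def lo_def)
      have "1 * (2 * len) \<le> \<kappa> * (2 * len)" using \<kappa> b1 by (intro mult_right_mono) auto
      then have b2: "1 \<le> \<kappa> * (2 * len)" using b1 by linarith
      have "real L \<le> ln \<Lambda> / \<gamma> + 1" unfolding L_def using ln0 \<gamma>_pos by simp
      then show ?thesis using a b2 by linarith
    qed
    have bt: "bt / (\<gamma> * (\<epsilon> * \<eta>)) \<le> \<Lambda>" using lo\<Lambda> unfolding lo_def log_arg_of_eq .
    have tail: "target - truncated L \<le> \<epsilon> * \<eta> / 2"
    proof (rule tail_small[OF _ bt])
      show "ln \<Lambda> / \<gamma> \<le> real L" unfolding L_def by linarith
    qed (use \<epsilon> \<eta> lo lo\<Lambda> in auto)
    define \<tau> where "\<tau> = (real L)\<^sup>2 * sqrt (real (f_row I)) * sqrt (lp_norm 1 t) * sqrt (lp_norm 1 b) / (\<epsilon> * sqrt \<eta>)"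
    have \<tau>X: "\<tau> = (real L)\<^sup>2 * X" by (simp add: \<tau>_def X_def)
    have L\<tau>: "real L \<le> 1 / sqrt c * \<tau>"
      unfolding \<tau>_def by (rule length_le_time[OF L1 \<epsilon> \<epsilon>1 \<eta> tail])
    have "\<tau> \<le> (4 * \<kappa> * len)\<^sup>2 * X"
      unfolding \<tau>X using L_le X by (intro mult_right_mono power_mono) auto
    then have \<tau>_le: "\<tau> \<le> 16 * \<kappa>\<^sup>2 * (len\<^sup>2 * X)" by (simp add: power_mult_distrib mult_ac)
    have bound: "240 + 161 * real (norm0 b) + 20 * real L + (620 / c + 6432) * \<tau> \<le> ?T"
    proof -
      have "20 * real L + (620 / c + 6432) * \<tau> \<le> A * \<tau>"
        using L\<tau> by (simp add: A_def distrib_right)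
      also have "\<dots> \<le> A * (16 * \<kappa>\<^sup>2 * (len\<^sup>2 * X))" using A \<tau>_le by (intro mult_left_mono)
      also have "\<dots> = 16 * \<kappa>\<^sup>2 * A * (len\<^sup>2 * X)" by simp
      also have "\<dots> \<le> C * (len\<^sup>2 * X)" using C(2) X by (intro mult_right_mono) auto
      finally have "20 * real L + (620 / c + 6432) * \<tau> \<le> C * (len\<^sup>2 * X)" .
      moreover have "401 * real (norm0 b) \<le> C * real (norm0 b)" using C(1) by (intro mult_right_mono) auto
      ultimately show ?thesis unfolding T using n0 by linarith
    qed
    let ?p = "\<lambda>i. if i < 10 then ?ps ! i else 0"
    have est: "triple I estimate s
        (\<lambda>s'. real (clock s') \<le> 240 + 161 * real (norm0 b) + 20 * real L + (620 / c + 6432) * \<tau>)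
        (\<lambda>s'. of_bool (\<not> \<bar>result s' - target\<bar> \<le> \<epsilon> * target)) (1/4)"
      using estimate_correct[OF s, of \<epsilon> \<eta>] \<epsilon> \<epsilon>1 \<eta> bt lo lo\<Lambda>
      by (simp add: \<Lambda>_def[symmetric] L_def[symmetric] \<tau>_def[symmetric])
    then show "triple I estimate (tick (1 + bcost (RLess (par 0) (RNat (NConst 1)))) (initial_state n ?ps))
        (\<lambda>s. real (clock s) \<le> ?T) (\<lambda>s. of_bool (\<not> \<bar>result s - target\<bar> \<le> \<epsilon> * target)) (1 - 3/4)"
      unfolding s_def[symmetric] by (rule triple_weaken) (use bound in auto)
  qed
qed

end

theorem theorem7p6:
  shows "\<exists>P :: com. \<forall>(c :: real) (\<kappa> :: real) (Q :: real poly). 0 < c \<longrightarrow> 1 \<le> \<kappa> \<longrightarrow>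
    (\<exists>C :: real. 0 < C \<and>
      (\<forall>(I :: problem) (n :: nat) (M :: real mat) (b :: real Matrix.vec) (t :: real Matrix.vec)
        (\<epsilon> :: real) (\<gamma> :: real) (\<eta> :: real)
        (d' :: real) (t0' :: real) (ti' :: real) (b0' :: real) (bi' :: real).
        well_formed n I \<longrightarrow> M = sysM I \<longrightarrow> b = sysb I \<longrightarrow> t = syst I \<longrightarrow>
        b \<in> mat_range M \<longrightarrow> b \<noteq> 0\<^sub>v n \<longrightarrow> t \<noteq> 0\<^sub>v n \<longrightarrow>
        (\<forall>x \<in> elements_mat M \<union> set\<^sub>v b \<union> set\<^sub>v t.
            x \<noteq> 0 \<longrightarrow> 1 / poly Q (real n) \<le> \<bar>x\<bar> \<and> \<bar>x\<bar> \<le> poly Q (real n)) \<longrightarrow>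
        RCDDZ M \<longrightarrow>
        (\<forall>x \<in> elements_mat M. x \<noteq> 0 \<longrightarrow> c \<le> \<bar>x\<bar>) \<longrightarrow>
        (\<forall>i<n. 0 \<le> b $ i \<and> 0 \<le> t $ i) \<longrightarrow>
        0 < \<epsilon> \<longrightarrow> 0 < \<gamma> \<longrightarrow> \<gamma> \<le> gamma_max M \<longrightarrow>
        0 < \<eta> \<longrightarrow> \<eta> \<le> scalar_prod t (x_star M b) \<longrightarrow>
        d_max M \<le> d' \<longrightarrow>
        real (norm0 t) \<le> t0' \<longrightarrow> lp_norm \<infinity> (diag_powr M (-1) *\<^sub>v t) \<le> ti' \<longrightarrow>
        real (norm0 b) \<le> b0' \<longrightarrow> lp_norm \<infinity> (diag_powr M (-1) *\<^sub>v b) \<le> bi' \<longrightarrow>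
        ln (log_arg \<gamma> (\<epsilon> * \<eta>) d' t0' ti' b0' bi')
          \<le> \<kappa> * max 1 (ln (log_arg_of \<gamma> (\<epsilon> * \<eta>) M b t)) \<longrightarrow>
        (let L = 1 / \<gamma> * ln (log_arg_of \<gamma> (\<epsilon> * \<eta>) M b t) in
         computes P I n [\<epsilon>, \<gamma>, \<eta>, lp_norm 1 t, real (f_row I), d', t0', ti', b0', bi']
           (C * real (norm0 b) +
            C * (sqrt (real (f_row I)) * sqrt (lp_norm 1 t) * sqrt (lp_norm 1 b)
                   * L ^ 2 * (1 / \<epsilon>) * (1 / sqrt \<eta>)))
           (3/4)
           (\<lambda>x. \<bar>x - scalar_prod t (x_star M b)\<bar> \<le> \<epsilon> * scalar_prod t (x_star M b)))))"
proof -
  \<comment> \<open>\<open>c\<close> and \<open>\<kappa>\<close> enter the constant and not the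
    program, so one \<open>solver\<close> serves all of them.\<close>
  define C where "C c \<kappa> = 401 + 16 * \<kappa>\<^sup>2 * (20 / sqrt c + 620 / c + 6432)" for c \<kappa> :: real
  have pos: "0 < C c \<kappa>" if "0 < c" for c \<kappa>
    unfolding C_def using that by (intro add_pos_nonneg mult_nonneg_nonneg) auto
  have main: "let L = 1 / \<gamma> * ln (log_arg_of \<gamma> (\<epsilon> * \<eta>) M b t) in
         computes solver I n [\<epsilon>, \<gamma>, \<eta>, lp_norm 1 t, real (f_row I), d', t0', ti', b0', bi']
           (C c \<kappa> * real (norm0 b) +
            C c \<kappa> * (sqrt (real (f_row I)) * sqrt (lp_norm 1 t) * sqrt (lp_norm 1 b)
                   * L ^ 2 * (1 / \<epsilon>) * (1 / sqrt \<eta>)))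
           (3/4)
           (\<lambda>x. \<bar>x - scalar_prod t (x_star M b)\<bar> \<le> \<epsilon> * scalar_prod t (x_star M b))"
    if c: "0 < c" and \<kappa>: "1 \<le> \<kappa>"
      and wf: "well_formed n I" and sys: "M = sysM I" "b = sysb I" "t = syst I"
      and rng: "b \<in> mat_range M" "b \<noteq> 0\<^sub>v n" "t \<noteq> 0\<^sub>v n" and rc: "RCDDZ M"
      and ent: "\<forall>x \<in> elements_mat M. x \<noteq> 0 \<longrightarrow> c \<le> \<bar>x\<bar>" and nn: "\<forall>i<n. 0 \<le> b $ i \<and> 0 \<le> t $ i"
      and \<epsilon>: "0 < \<epsilon>" and \<gamma>: "0 < \<gamma>" "\<gamma> \<le> gamma_max M"
      and \<eta>: "0 < \<eta>" "\<eta> \<le> scalar_prod t (x_star M b)"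
      and par: "d_max M \<le> d'" "real (norm0 t) \<le> t0'" "lp_norm \<infinity> (diag_powr M (-1) *\<^sub>v t) \<le> ti'"
        "real (norm0 b) \<le> b0'" "lp_norm \<infinity> (diag_powr M (-1) *\<^sub>v b) \<le> bi'"
      and ln_le: "ln (log_arg \<gamma> (\<epsilon> * \<eta>) d' t0' ti' b0' bi')
          \<le> \<kappa> * max 1 (ln (log_arg_of \<gamma> (\<epsilon> * \<eta>) M b t))"
    for c \<kappa> I n M b t \<epsilon> \<gamma> \<eta> d' t0' ti' b0' bi'
  proof -
    have car: "M \<in> carrier_mat n n" "b \<in> carrier_vec n" "t \<in> carrier_vec n"
      using wf unfolding well_formed_def sys by blast+
    interpret rcddz_instance n M b t \<gamma> I c
      by unfold_locales (use car rc rng nn \<gamma> wf sys c ent in auto)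
    show ?thesis
      using solver_computes[OF \<epsilon> \<eta>[folded target_def] \<kappa> par ln_le]
      unfolding Let_def target_def C_def .
  qed
  show ?thesis
    apply (intro exI[of _ solver] allI impI)
    subgoal for c \<kappa>
      by (intro exI[of _ "C c \<kappa>"] conjI allI impI pos) (assumption | rule main[of c \<kappa>])+
    done
qed

end
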